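(* Let $\mathcal E$ be a Hilbert space and let $\{A_{(\alpha_1,\dots,\alpha_k;\beta_1,\dots,\beta_k)}\}$ be a family of operators in $B(\mathcal E)$, where $\alpha_i,\beta_i\in\mathbb F_{n_i}^+$, $|\alpha_i|=m_i^-$, $|\beta_i|=m_i^+$, $m_i\in\mathbb Z$, $i\in\{1,\dots,k\}$. Then $$\varphi(\mathbf S):=\sum_{m_1\in\mathbb Z}\cdots\sum_{m_k\in\mathbb Z}\ \sum_{\alpha_i,\beta_i\in\mathbb F_{n_i}^+,\ |\alpha_i|=m_i^-,\ |\beta_i|=m_i^+}A_{(\alpha_1,\dots,\alpha_k;\beta_1,\dots,\beta_k)}\otimes\mathbf S_{1,\alpha_1}\cdots\mathbf S_{k,\alpha_k}\mathbf S_{1,\beta_1}^*\cdots\mathbf S_{k,\beta_k}^*$$ is the formal Fourier series of a $k$-multi-Toeplitz operator on $\mathcal E\otimes\bigotimes_{i=1}^kF^2(H_{n_i})$ if and only if the following conditions are satisfied: (i) for each $\boldsymbol\gamma\in\mathbb F_{n_1}^+\times\cdots\times\mathbb F_{n_k}^+$, the series $$\sum_{\boldsymbol\omega\in\mathbb F_{n_1}^+\times\cdots\times\mathbb F_{n_k}^+,\ \boldsymbol\omega\sim_{rc}\boldsymbol\gamma}A_{(c_r^+(\boldsymbol\omega,\boldsymbol\gamma);c_r^-(\boldsymbol\omega,\boldsymbol\gamma))}^*A_{(c_r^+(\boldsymbol\omega,\boldsymbol\gamma);c_r^-(\boldsymbol\omega,\boldsymbol\gamma))}$$ is WOT-convergent;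 (ii) if $\mathcal P$ is the set of all vector-valued polynomials in $\mathcal E\otimes\bigotimes_{i=1}^kF^2(H_{n_i})$, then $\sup_{r\in[0,1)}\sup_{p\in\mathcal P,\|p\|\le1}\|\varphi(r\mathbf S)p\|<\infty$. Moreover, if there is a $k$-multi-Toeplitz operator $A\in B(\mathcal E\otimes\bigotimes_{i=1}^kF^2(H_{n_i}))$ such that $\varphi(\mathbf S)=\varphi_A(\mathbf S)$, then: (a) for every $r\in[0,1)$ the series $$\varphi(r\mathbf S):=\sum_{m_1\in\mathbb Z}\cdots\sum_{m_k\in\mathbb Z}\ \sum_{\alpha_i,\beta_i\in\mathbb F_{n_i}^+,\ |\alpha_i|=m_i^-,\ |\beta_i|=m_i^+}A_{(\alpha_1,\dots,\alpha_k;\beta_1,\dots,\beta_k)}\otimes r^{\sum_{i=1}^k(|\alpha_i|+|\beta_i|)}\mathbf S_{1,\alpha_1}\cdots\mathbf S_{k,\alpha_k}\mathbf S_{1,\beta_1}^*\cdots\mathbf S_{k,\beta_k}^*$$ is convergent in the operator norm topology and its sum, which does not depend on the order of the series, is an operator in the norm closure of $\operatorname{span}\{f^*g:\ f,g\in B(\mathcal E)\otimes_{min}\boldsymbol{\mathcal A}_{\mathbf n}\}$; (b) $A=\text{SOT-}\lim_{r\to1}\varphi(r\mathbf S)$ and $$\|A\|=\sup_{r\in[0,1)}\|\varphi(r\mathbf S)\|=\lim_{r\to1}\|\varphi(r\mathbf S)\|=\sup_{q\in\mathcal P,\|q\|\le1}\|\varphi(\mathbf S)q\|.$$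
   Context: Let $k\ge1$, $\mathbf n=(n_1,\dots,n_k)\in\mathbb N^k$, $\mathbb N=\{1,2,\dots\}$. For $i=1,\dots,k$ let $H_{n_i}$ be an $n_i$-dimensional complex Hilbert space with orthonormal basis $e^i_1,\dots,e^i_{n_i}$, $F^2(H_{n_i})=\mathbb C1\oplus\bigoplus_{p\ge1}H_{n_i}^{\otimes p}$ its full Fock space, and $\mathbb F_{n_i}^+$ the unital free semigroup with generators $g^i_1,\dots,g^i_{n_i}$ and identity $g^i_0$. For $\alpha=g^i_{j_1}\cdots g^i_{j_p}$ put $|\alpha|=p$ and $e^i_\alpha=e^i_{j_1}\otimes\cdots\otimes e^i_{j_p}$; also $|g^i_0|=0$, $e^i_{g^i_0}=1$. The left and right creation operators on $F^2(H_{n_i})$ are $S_{i,j}e^i_\alpha=e^i_{g^i_j\alpha}$ and $R_{i,j}e^i_\alpha=e^i_{\alpha g^i_j}$; $\mathbf S_{i,j}$ and $\mathbf R_{i,j}$ are their ampliations to $\bigotimes_{i=1}^kF^2(H_{n_i})$ (acting on the $i$-th factor, identity on the others). $\boldsymbol{\mathcal A}_{\mathbf n}$ (the polyball algebra) is the norm closed non-selfadjoint algebra generated by all $\mathbf S_{i,j}$ and the identity. For operators $T_{i,1},\dots,T_{i,n_i}$ put $T_{i,\alpha}=T_{i,j_1}\cdots T_{i,j_p}$, $T_{i,g^i_0}=I$; $T_{i,\alpha}^*$ means $(T_{i,\alpha})^*$. For $m\in\mathbb Z$, $m^+=\max\{m,0\}$, $m^-=\max\{-m,0\}$. Comparability: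 for $\omega,\gamma\in\mathbb F_{n}^+$ write $\gamma<_r\omega$ if $\omega=\sigma\gamma$ for some $\sigma\ne g_0$, and then $\omega\backslash_r\gamma:=\sigma$. For $\boldsymbol\omega=(\omega_1,\dots,\omega_k)$, $\boldsymbol\gamma=(\gamma_1,\dots,\gamma_k)$ write $\boldsymbol\omega\sim_{rc}\boldsymbol\gamma$ if for each $i$ one of $\omega_i<_r\gamma_i$, $\gamma_i<_r\omega_i$, $\omega_i=\gamma_i$ holds. In this case $c_r^\pm(\boldsymbol\omega,\boldsymbol\gamma)=(c_r^\pm(\omega_1,\gamma_1),\dots,c_r^\pm(\omega_k,\gamma_k))$, where $c_r^+(\omega,\gamma)=\omega\backslash_r\gamma$ if $\gamma<_r\omega$ and $g_0$ otherwise, and $c_r^-(\omega,\gamma)=\gamma\backslash_r\omega$ if $\omega<_r\gamma$ and $g_0$ otherwise. A bounded operator $A$ on $\mathcal E\otimes\bigotimes_{i=1}^kF^2(H_{n_i})$ is $k$-multi-Toeplitz if $(I_{\mathcal E}\otimes\mathbf R_{i,s}^* )A(I_{\mathcal E}\otimes\mathbf R_{i,t})=\delta_{st}A$ for all $i$ and $s,t\in\{1,\dots,n_i\}$. Its formal Fourier series $\varphi_A(\mathbf S)$ is the formal series of the form displayed in the claim with coefficients $\langle A_{(\alpha_1,\dots,\alpha_k;\beta_1,\dots,\beta_k)}h,\ell\rangle=\langle A(h\otimes x),\ell\otimes y\rangle$, $h,\ell\in\mathcal E$, where $x=x_1\otimes\cdots\otimes x_k$, $y=y_1\otimes\cdots\otimes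 y_k$, with $x_i=e^i_{\beta_i}$, $y_i=1$ if $m_i\ge0$ and $x_i=1$, $y_i=e^i_{\alpha_i}$ if $m_i<0$. Vector-valued polynomials are finite sums $\sum h_{(\omega_1,\dots,\omega_k)}\otimes e^1_{\omega_1}\otimes\cdots\otimes e^k_{\omega_k}$ with $h_{(\omega_1,\dots,\omega_k)}\in\mathcal E$. For a polynomial $p$, $\varphi(\mathbf S)p$ and $\varphi(r\mathbf S)p$ are obtained by applying the series termwise (under (i) these are convergent series of vectors). A series $\sum_{m\in\mathbb Z}$ is convergent if the parts over $m<0$ and $m\ge0$ both converge, its sum being the sum of the two. WOT/SOT: weak/strong operator topology. *)

theory Defs
  imports "HOL-Analysis.Analysis" "HOL-Library.Sublist"
begin

section \<open>Complex Hilbert spaces\<close>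

class complex_vector = real_vector +
  fixes scaleC :: "complex \<Rightarrow> 'a \<Rightarrow> 'a" (infixr "*\<^sub>C" 75)
  assumes scaleC_add_right: "c *\<^sub>C (x + y) = c *\<^sub>C x + c *\<^sub>C y"
    and scaleC_add_left: "(c + d) *\<^sub>C x = c *\<^sub>C x + d *\<^sub>C x"
    and scaleC_scaleC: "c *\<^sub>C (d *\<^sub>C x) = (c * d) *\<^sub>C x"
    and scaleC_of_real: "complex_of_real r *\<^sub>C x = r *\<^sub>R x"

text \<open>The inner product is linear in its first argument. The last axiom contains positivity and
  definiteness, since the norm is the one of a normed space.\<close>

class complex_inner = complex_vector + real_normed_vector +
  fixes cinner :: "'a \<Rightarrow> 'a \<Rightarrow> complex"
  assumes cinner_commute: "cinner x y = cnj (cinner y x)"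
    and cinner_add_left: "cinner (x + y) z = cinner x z + cinner y z"
    and cinner_scaleC_left: "cinner (c *\<^sub>C x) y = c * cinner x y"
    and cinner_self: "cinner x x = complex_of_real ((norm x)\<^sup>2)"

class chilbert_space = complex_inner + complete_space

instantiation complex :: chilbert_space
begin

definition scaleC_complex :: "complex \<Rightarrow> complex \<Rightarrow> complex"
  where "scaleC_complex c x = c * x"

definition cinner_complex :: "complex \<Rightarrow> complex \<Rightarrow> complex"
  where "cinner_complex x y = x * cnj y"

instance
  by standard
    (simp_all add: scaleC_complex_def cinner_complex_def algebra_simps scaleR_conv_of_real
      complex_norm_square del: of_real_power)

end

abbreviation cspan :: "'a::complex_vector set \<Rightarrow> 'a set"
  where "cspan \<equiv> module.span scaleC"

lemma norm_scaleC: "norm (c *\<^sub>C x) = cmod c * norm (x :: 'a::complex_inner)"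
proof -
  have "complex_of_real ((norm (c *\<^sub>C x))\<^sup>2) = c * cnj c * cinner x x"
    using cinner_self[of "c *\<^sub>C x"] cinner_commute[of x "c *\<^sub>C x"] cinner_commute[of x x]
    by (simp add: cinner_scaleC_left mult.assoc)
  also have "\<dots> = complex_of_real ((cmod c * norm x)\<^sup>2)"
    by (simp add: cinner_self power_mult_distrib flip: complex_norm_square)
  finally have "(norm (c *\<^sub>C x))\<^sup>2 = (cmod c * norm x)\<^sup>2"
    using of_real_eq_iff by blast
  then show ?thesis
    by (simp add: power2_eq_iff_nonneg)
qed

lemma bounded_linear_scaleC: "bounded_linear (\<lambda>x::'a::complex_inner. c *\<^sub>C x)"
proof (rule bounded_linear_intro[where K = "cmod c"])
  show "c *\<^sub>C (r *\<^sub>R x) = r *\<^sub>R (c *\<^sub>C x)" for r and x :: 'a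
    by (simp add: scaleC_scaleC mult.commute flip: scaleC_of_real)
qed (simp_all add: scaleC_add_right norm_scaleC mult.commute)


section \<open>Bounded operators\<close>

instantiation blinfun :: (real_normed_vector, complex_inner) complex_vector
begin

definition scaleC_blinfun :: "complex \<Rightarrow> 'a \<Rightarrow>\<^sub>L 'b \<Rightarrow> 'a \<Rightarrow>\<^sub>L 'b"
  where "scaleC_blinfun c T = Blinfun (\<lambda>x. c *\<^sub>C T x)"

lemma scaleC_blinfun_apply: "blinfun_apply (c *\<^sub>C T) x = c *\<^sub>C T x"
  unfolding scaleC_blinfun_def
  by (subst bounded_linear_Blinfun_apply)
    (auto intro: bounded_linear_compose[OF bounded_linear_scaleC] blinfun.bounded_linear_right)

instance
  by standard
    (auto intro!: blinfun_eqI simp: scaleC_blinfun_apply blinfun.bilinear_simps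
      scaleC_add_right scaleC_add_left scaleC_scaleC scaleC_of_real)

end

text \<open>The library type of bounded operators only asks for real linearity; \<open>bop\<close> is
  the set of the complex linear ones, i.e. \<open>B(H, K)\<close>.\<close>

definition bop :: "('a::complex_inner \<Rightarrow>\<^sub>L 'b::complex_inner) set"
  where "bop = {T :: 'a \<Rightarrow>\<^sub>L 'b. \<forall>c x. T (c *\<^sub>C x) = c *\<^sub>C T x}"

definition adj :: "('a::complex_inner \<Rightarrow>\<^sub>L 'b::complex_inner) \<Rightarrow> 'b \<Rightarrow>\<^sub>L 'a"
  where "adj T = (THE T'. T' \<in> bop \<and> (\<forall>x y. cinner (T x) y = cinner x (T' y)))"

definition wot_summable_on :: "('i \<Rightarrow> 'a::complex_inner \<Rightarrow>\<^sub>L 'a) \<Rightarrow> 'i set \<Rightarrow> bool"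
  where "wot_summable_on f I \<longleftrightarrow>
    (\<exists>B\<in>bop. \<forall>h l. ((\<lambda>i. cinner (f i h) l) has_sum cinner (B h) l) I)"


section \<open>Tensor products\<close>

definition is_onb_on :: "'i set \<Rightarrow> ('i \<Rightarrow> 'a::complex_inner) \<Rightarrow> bool"
  where "is_onb_on I e \<longleftrightarrow>
    (\<forall>v\<in>I. \<forall>w\<in>I. cinner (e v) (e w) = (if v = w then 1 else 0)) \<and>
    closure (cspan (e ` I)) = UNIV"

text \<open>\<open>is_hilbert_tensor ten\<close>: the Hilbert space \<open>'c\<close>, with \<open>ten h x\<close> as the
  elementary tensor \<open>h \<otimes> x\<close>, is a Hilbert space tensor product of \<open>'a\<close> and \<open>'b\<close>. This determines
  \<open>('c, ten)\<close> up to a unitary operator that respects elementary tensors.\<close>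

definition is_hilbert_tensor ::
    "('a::complex_inner \<Rightarrow> 'b::complex_inner \<Rightarrow> 'c::chilbert_space) \<Rightarrow> bool"
  where "is_hilbert_tensor ten \<longleftrightarrow>
    (\<forall>h h' x. ten (h + h') x = ten h x + ten h' x) \<and>
    (\<forall>h x x'. ten h (x + x') = ten h x + ten h x') \<and>
    (\<forall>c h x. ten (c *\<^sub>C h) x = c *\<^sub>C ten h x \<and> ten h (c *\<^sub>C x) = c *\<^sub>C ten h x) \<and>
    (\<forall>h x l y. cinner (ten h x) (ten l y) = cinner h l * cinner x y) \<and>
    closure (cspan {ten h x |h x. True}) = UNIV"

definition op_tensor ::
    "('a::complex_inner \<Rightarrow> 'b::complex_inner \<Rightarrow> 'c::complex_inner) \<Rightarrow>
     'a \<Rightarrow>\<^sub>L 'a \<Rightarrow> 'b \<Rightarrow>\<^sub>L 'b \<Rightarrow> 'c \<Rightarrow>\<^sub>L 'c"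
  where "op_tensor ten X Y =
    (THE T. T \<in> bop \<and> (\<forall>h x. T (ten h x) = ten (X h) (Y x)))"


section \<open>Words\<close>

text \<open>An element of the free semigroup with generators \<open>g\<^sub>1, \<dots>, g\<^sub>n\<close> is a list over
  \<open>{1..n}\<close>, the identity being \<open>[]\<close>. A tuple \<open>(\<omega>\<^sub>1, \<dots>, \<omega>\<^sub>k)\<close> of words is a function on \<open>nat\<close> that
  takes the value \<open>[]\<close> outside \<open>{1..k}\<close>.\<close>

type_synonym mword = "nat \<Rightarrow> nat list"

definition mwords :: "nat \<Rightarrow> (nat \<Rightarrow> nat) \<Rightarrow> mword set"
  where "mwords k n =
    {w. (\<forall>i\<in>{1..k}. set (w i) \<subseteq> {1..n i}) \<and> (\<forall>i. i \<notin> {1..k} \<longrightarrow> w i = [])}"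

text \<open>\<open>\<gamma> <\<^sub>r \<omega>\<close> is \<open>strict_suffix \<gamma> \<omega>\<close>.\<close>

definition rquot :: "nat list \<Rightarrow> nat list \<Rightarrow> nat list"
  where "rquot \<omega> \<gamma> = (THE \<sigma>. \<omega> = \<sigma> @ \<gamma>)"

definition comparable_rc :: "nat \<Rightarrow> mword \<Rightarrow> mword \<Rightarrow> bool"
  where "comparable_rc k \<omega> \<gamma> \<longleftrightarrow>
    (\<forall>i\<in>{1..k}. strict_suffix (\<omega> i) (\<gamma> i) \<or> strict_suffix (\<gamma> i) (\<omega> i) \<or> \<omega> i = \<gamma> i)"

definition cr_plus :: "mword \<Rightarrow> mword \<Rightarrow> mword"
  where "cr_plus \<omega> \<gamma> = (\<lambda>i. if strict_suffix (\<gamma> i) (\<omega> i) then rquot (\<omega> i) (\<gamma> i) else [])"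

definition cr_minus :: "mword \<Rightarrow> mword \<Rightarrow> mword"
  where "cr_minus \<omega> \<gamma> = (\<lambda>i. if strict_suffix (\<omega> i) (\<gamma> i) then rquot (\<gamma> i) (\<omega> i) else [])"

definition multi_ints :: "nat \<Rightarrow> (nat \<Rightarrow> int) set"
  where "multi_ints k = {m. \<forall>i. i \<notin> {1..k} \<longrightarrow> m i = 0}"

definition word_pairs :: "nat \<Rightarrow> (nat \<Rightarrow> nat) \<Rightarrow> (nat \<Rightarrow> int) \<Rightarrow> (mword \<times> mword) set"
  where "word_pairs k n m =
    {(\<alpha>, \<beta>). \<alpha> \<in> mwords k n \<and> \<beta> \<in> mwords k n \<and>
      (\<forall>i\<in>{1..k}. int (length (\<alpha> i)) = max (- m i) 0 \<and> int (length (\<beta> i)) = max (m i) 0)}"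


section \<open>Creation operators and the polyball algebra\<close>

text \<open>Here and below \<open>e\<close> is an orthonormal basis of the Hilbert space \<open>'f\<close> indexed by
  \<open>mwords k n\<close>. Such a space is \<open>F\<^sup>2(H\<^bsub>n\<^sub>1\<^esub>) \<otimes> \<dots> \<otimes> F\<^sup>2(H\<^bsub>n\<^sub>k\<^esub>)\<close>, with \<open>e \<omega>\<close> playing the role of
  the basis vector \<open>e\<^sup>1\<^bsub>\<omega>\<^sub>1\<^esub> \<otimes> \<dots> \<otimes> e\<^sup>k\<^bsub>\<omega>\<^sub>k\<^esub>\<close>. The operators act on the \<open>i\<close>-th factor and as the
  identity on the others, i.e. they are the ampliations.\<close>

definition left_creation ::
    "nat \<Rightarrow> (nat \<Rightarrow> nat) \<Rightarrow> (mword \<Rightarrow> 'f::complex_inner) \<Rightarrow> nat \<Rightarrow> nat \<Rightarrow> 'f \<Rightarrow>\<^sub>L 'f"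
  where "left_creation k n e i j =
    (THE T. T \<in> bop \<and> (\<forall>w\<in>mwords k n. T (e w) = e (w(i := j # w i))))"

definition right_creation ::
    "nat \<Rightarrow> (nat \<Rightarrow> nat) \<Rightarrow> (mword \<Rightarrow> 'f::complex_inner) \<Rightarrow> nat \<Rightarrow> nat \<Rightarrow> 'f \<Rightarrow>\<^sub>L 'f"
  where "right_creation k n e i j =
    (THE T. T \<in> bop \<and> (\<forall>w\<in>mwords k n. T (e w) = e (w(i := w i @ [j]))))"

definition op_prod :: "('a::real_normed_vector \<Rightarrow>\<^sub>L 'a) list \<Rightarrow> 'a \<Rightarrow>\<^sub>L 'a"
  where "op_prod Ts = foldr (o\<^sub>L) Ts id_blinfun"

definition left_creation_word ::
    "nat \<Rightarrow> (nat \<Rightarrow> nat) \<Rightarrow> (mword \<Rightarrow> 'f::complex_inner) \<Rightarrow> nat \<Rightarrow> nat list \<Rightarrow> 'f \<Rightarrow>\<^sub>L 'f"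
  where "left_creation_word k n e i \<alpha> = op_prod (map (left_creation k n e i) \<alpha>)"

text \<open>\<open>S\<^bsub>1,\<alpha>\<^sub>1\<^esub> \<dots> S\<^bsub>k,\<alpha>\<^sub>k\<^esub> S\<^bsub>1,\<beta>\<^sub>1\<^esub>\<^sup>* \<dots> S\<^bsub>k,\<beta>\<^sub>k\<^esub>\<^sup>*\<close>\<close>

definition creation_monomial ::
    "nat \<Rightarrow> (nat \<Rightarrow> nat) \<Rightarrow> (mword \<Rightarrow> 'f::complex_inner) \<Rightarrow> mword \<Rightarrow> mword \<Rightarrow> 'f \<Rightarrow>\<^sub>L 'f"
  where "creation_monomial k n e \<alpha> \<beta> =
    op_prod (map (\<lambda>i. left_creation_word k n e i (\<alpha> i)) [1..<Suc k]) o\<^sub>L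
    op_prod (map (\<lambda>i. adj (left_creation_word k n e i (\<beta> i))) [1..<Suc k])"

definition closed_operator_algebra :: "('a::complex_inner \<Rightarrow>\<^sub>L 'a) set \<Rightarrow> bool"
  where "closed_operator_algebra U \<longleftrightarrow> U \<subseteq> bop \<and> closed U \<and> 0 \<in> U \<and>
    (\<forall>X\<in>U. \<forall>Y\<in>U. X + Y \<in> U \<and> X o\<^sub>L Y \<in> U) \<and> (\<forall>c. \<forall>X\<in>U. c *\<^sub>C X \<in> U)"

definition polyball_algebra ::
    "nat \<Rightarrow> (nat \<Rightarrow> nat) \<Rightarrow> (mword \<Rightarrow> 'f::complex_inner) \<Rightarrow> ('f \<Rightarrow>\<^sub>L 'f) set"
  where "polyball_algebra k n e = closed_operator_algebra hull
    insert id_blinfun {left_creation k n e i j |i j. i \<in> {1..k} \<and> j \<in> {1..n i}}"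

definition min_tensor ::
    "('a::complex_inner \<Rightarrow> 'b::complex_inner \<Rightarrow> 'c::complex_inner) \<Rightarrow>
     ('a \<Rightarrow>\<^sub>L 'a) set \<Rightarrow> ('b \<Rightarrow>\<^sub>L 'b) set \<Rightarrow> ('c \<Rightarrow>\<^sub>L 'c) set"
  where "min_tensor ten U V = closure (cspan {op_tensor ten X Y |X Y. X \<in> U \<and> Y \<in> V})"


section \<open>Multi-Toeplitz operators and their formal Fourier series\<close>

definition multi_toeplitz ::
    "nat \<Rightarrow> (nat \<Rightarrow> nat) \<Rightarrow> (mword \<Rightarrow> 'f::complex_inner) \<Rightarrow>
     ('e::complex_inner \<Rightarrow> 'f \<Rightarrow> 'h::complex_inner) \<Rightarrow> 'h \<Rightarrow>\<^sub>L 'h \<Rightarrow> bool"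
  where "multi_toeplitz k n e ten A \<longleftrightarrow> A \<in> bop \<and>
    (\<forall>i\<in>{1..k}. \<forall>s\<in>{1..n i}. \<forall>t\<in>{1..n i}.
      op_tensor ten id_blinfun (adj (right_creation k n e i s)) o\<^sub>L A o\<^sub>L
      op_tensor ten id_blinfun (right_creation k n e i t) = (if s = t then A else 0))"

text \<open>A formal series is given by its coefficients \<open>C \<alpha> \<beta>\<close>; only the
  pairs in some \<open>word_pairs k n m\<close> matter.\<close>

definition is_fourier_series ::
    "nat \<Rightarrow> (nat \<Rightarrow> nat) \<Rightarrow> (mword \<Rightarrow> 'f::complex_inner) \<Rightarrow>
     ('e::complex_inner \<Rightarrow> 'f \<Rightarrow> 'h::complex_inner) \<Rightarrow>
     (mword \<Rightarrow> mword \<Rightarrow> 'e \<Rightarrow>\<^sub>L 'e) \<Rightarrow> 'h \<Rightarrow>\<^sub>L 'h \<Rightarrow> bool"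
  where "is_fourier_series k n e ten C A \<longleftrightarrow>
    (\<forall>m\<in>multi_ints k. \<forall>(\<alpha>, \<beta>)\<in>word_pairs k n m. \<forall>h l.
      cinner (C \<alpha> \<beta> h) l =
      cinner (A (ten h (e (\<lambda>i. if m i \<ge> 0 then \<beta> i else []))))
             (ten l (e (\<lambda>i. if m i \<ge> 0 then [] else \<alpha> i))))"


section \<open>Sums of the series\<close>

definition int_sums :: "(int \<Rightarrow> 'v::real_normed_vector) \<Rightarrow> 'v \<Rightarrow> bool"
  where "int_sums f s \<longleftrightarrow>
    (\<exists>a b. (\<lambda>p. f (- int (Suc p))) sums a \<and> (\<lambda>p. f (int p)) sums b \<and> s = a + b)"

text \<open>\<open>iter_sums [i\<^sub>1, \<dots>, i\<^sub>q] f s\<close>: the iterated series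
  \<open>\<Sum>m\<^bsub>i\<^sub>1\<^esub>\<in>\<int>. \<dots> \<Sum>m\<^bsub>i\<^sub>q\<^esub>\<in>\<int>. f m\<close> converges to \<open>s\<close>, where \<open>m\<close> vanishes at the other indices.\<close>

fun iter_sums :: "nat list \<Rightarrow> ((nat \<Rightarrow> int) \<Rightarrow> 'v::real_normed_vector) \<Rightarrow> 'v \<Rightarrow> bool"
  where
    "iter_sums [] f s \<longleftrightarrow> s = f (\<lambda>_. 0)"
  | "iter_sums (i # ks) f s \<longleftrightarrow>
      (\<exists>g. (\<forall>z. iter_sums ks (\<lambda>m. f (m(i := z))) (g z)) \<and> int_sums g s)"

definition phi_block ::
    "nat \<Rightarrow> (nat \<Rightarrow> nat) \<Rightarrow> (mword \<Rightarrow> 'f::complex_inner) \<Rightarrow>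
     ('e::complex_inner \<Rightarrow> 'f \<Rightarrow> 'h::complex_inner) \<Rightarrow>
     (mword \<Rightarrow> mword \<Rightarrow> 'e \<Rightarrow>\<^sub>L 'e) \<Rightarrow> real \<Rightarrow> (nat \<Rightarrow> int) \<Rightarrow> 'h \<Rightarrow>\<^sub>L 'h"
  where "phi_block k n e ten C r m =
    (\<Sum>(\<alpha>, \<beta>)\<in>word_pairs k n m.
      op_tensor ten (C \<alpha> \<beta>)
        (r ^ (\<Sum>i=1..k. length (\<alpha> i) + length (\<beta> i)) *\<^sub>R creation_monomial k n e \<alpha> \<beta>))"

text \<open>\<open>\<phi>(rS)\<close> as a norm convergent series of operators\<close>

definition phi_op ::
    "nat \<Rightarrow> (nat \<Rightarrow> nat) \<Rightarrow> (mword \<Rightarrow> 'f::complex_inner) \<Rightarrow>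
     ('e::complex_inner \<Rightarrow> 'f \<Rightarrow> 'h::complex_inner) \<Rightarrow>
     (mword \<Rightarrow> mword \<Rightarrow> 'e \<Rightarrow>\<^sub>L 'e) \<Rightarrow> real \<Rightarrow> 'h \<Rightarrow>\<^sub>L 'h"
  where "phi_op k n e ten C r = (THE \<Phi>. iter_sums [1..<Suc k] (phi_block k n e ten C r) \<Phi>)"

text \<open>\<open>\<phi>(rS)p\<close>, the series being applied termwise to the vector \<open>p\<close>; \<open>r = 1\<close> gives \<open>\<phi>(S)p\<close>\<close>

definition phi_vec ::
    "nat \<Rightarrow> (nat \<Rightarrow> nat) \<Rightarrow> (mword \<Rightarrow> 'f::complex_inner) \<Rightarrow>
     ('e::complex_inner \<Rightarrow> 'f \<Rightarrow> 'h::complex_inner) \<Rightarrow>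
     (mword \<Rightarrow> mword \<Rightarrow> 'e \<Rightarrow>\<^sub>L 'e) \<Rightarrow> real \<Rightarrow> 'h \<Rightarrow> 'h"
  where "phi_vec k n e ten C r p =
    (THE v. iter_sums [1..<Suc k] (\<lambda>m. phi_block k n e ten C r m p) v)"

definition polynomials ::
    "nat \<Rightarrow> (nat \<Rightarrow> nat) \<Rightarrow> (mword \<Rightarrow> 'f::complex_inner) \<Rightarrow>
     ('e::complex_inner \<Rightarrow> 'f \<Rightarrow> 'h::complex_inner) \<Rightarrow> 'h set"
  where "polynomials k n e ten =
    {\<Sum>w\<in>F. ten (h w) (e w) |F h. finite F \<and> F \<subseteq> mwords k n}"

end

theory Submission
  imports Defs
begin

text \<open>Write \<open>V\<^sub>w h = h \<otimes> e\<^sub>w\<close>. A bounded operator is determined by its entries \<open>V\<^sub>v\<^sup>* A V\<^sub>w\<close>, and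
  stripping common last letters shows that \<open>A\<close> is multi-Toeplitz with Fourier coefficients \<open>C\<close> iff its
  entry at \<open>(v, w)\<close> is \<open>C(c\<^sub>r\<^sup>+(v, w); c\<^sub>r\<^sup>-(v, w))\<close> when \<open>v\<close> and \<open>w\<close> are comparable and \<open>0\<close> otherwise.
  The part of \<open>\<phi>(rS)\<close> of multidegree \<open>m\<close> is \<open>r\<^bsup>|m|\<^esup>\<close> times the \<open>m\<close>-th block diagonal of this
  matrix, and \<open>\<phi>(rS)\<close> is the Schur product of the matrix with \<open>\<Prod>\<^sub>i r\<^bsup>|p\<^sub>i - q\<^sub>i|\<^esup>\<close>, where \<open>p, q\<close> are
  the multidegrees of the row and the column. Both kernels have the form \<open>\<Sum>\<^sub>j a\<^sub>j(v) b\<^sub>j(w)\<close> with rows of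
  Euclidean norm at most one (or are products of such), hence are contractive Schur multipliers. So the
  multidegree parts are bounded by \<open>r\<^bsup>|m|\<^esup> \<parallel>A\<parallel>\<close>, which gives norm convergence, and \<open>\<parallel>\<phi>(rS)\<parallel> \<le> \<parallel>A\<parallel>\<close>, which
  reduces strong convergence to the vectors \<open>V\<^sub>w h\<close>. Conversely, (ii) bounds all finite sections of the
  matrix as \<open>r \<rightarrow> 1\<close>, (i) makes its columns vectors, and the finite sections converge strongly to the
  required operator.\<close>

subsection \<open>Complex inner product spaces\<close>

text \<open>Cutting out the part of multidegree m and damping by r are both averages of A over
  conjugations by the unitaries that multiply e_w by the product of the z_i^|w_i|, with each z_i on
  the unit circle: the first against a character of the torus, the second against a product of
  Poisson kernels. This is why neither can increase the norm. Finite factorisations of the two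
  kernels give the same bounds on finite sections without operator valued integrals. What shapes the
  development is that adjoints, creation operators, tensor products of operators,
  \<open>phi_op\<close> and \<open>phi_vec\<close> are definite descriptions: nothing is known about
  any of them until existence and uniqueness are proved. Operators are therefore produced as strong
  limits of uniformly bounded finite sums and compared through their matrix entries. Condition (i)
  acts twice: it makes the series \<phi>(rS)p converge, so that the norms in (ii) are those of the
  actual sums, and it supplies the columns from which the operator is built.\<close>

instance chilbert_space \<subseteq> banach ..

interpretation complex_vector: vector_space "scaleC :: complex \<Rightarrow> 'a \<Rightarrow> 'a::complex_vector"
proof
  show "1 *\<^sub>C x = x" for x :: 'a
    using scaleC_of_real[of 1 x] by simp
qed (simp_all add: scaleC_add_right scaleC_add_left scaleC_scaleC)

lemma scaleC_zero_left [simp]: "0 *\<^sub>C x = 0"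
  by (rule complex_vector.scale_zero_left)

lemma scaleC_zero_right [simp]: "c *\<^sub>C 0 = 0"
  by (rule complex_vector.scale_zero_right)

lemma scaleC_one [simp]: "1 *\<^sub>C x = x"
  by (rule complex_vector.scale_one)

lemma cinner_zero_left [simp]: "cinner 0 y = 0"
  using cinner_scaleC_left[of 0 0 y] by simp

lemma cinner_zero_right [simp]: "cinner x 0 = 0"
  using cinner_commute[of x 0] by simp

lemma cinner_add_right: "cinner x (y + z) = cinner x y + cinner x z"
  by (metis cinner_add_left cinner_commute complex_cnj_add)

lemma cinner_scaleC_right: "cinner x (c *\<^sub>C y) = cnj c * cinner x y"
  by (metis cinner_commute cinner_scaleC_left complex_cnj_mult)

lemma cinner_scaleR_left: "cinner (r *\<^sub>R x) y = of_real r * cinner x y"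
  by (simp add: cinner_scaleC_left flip: scaleC_of_real)

lemma cinner_scaleR_right: "cinner x (r *\<^sub>R y) = of_real r * cinner x y"
  by (simp add: cinner_scaleC_right flip: scaleC_of_real)

lemma cinner_minus_left: "cinner (- x) y = - cinner x y"
  using cinner_scaleR_left[of "-1" x y] by simp

lemma cinner_minus_right: "cinner x (- y) = - cinner x y"
  using cinner_scaleR_right[of x "-1" y] by simp

lemma cinner_diff_left: "cinner (x - z) y = cinner x y - cinner z y"
  using cinner_add_left[of x "- z" y] by (simp add: cinner_minus_left)

lemma cinner_diff_right: "cinner x (y - z) = cinner x y - cinner x z"
  using cinner_add_right[of x y "- z"] by (simp add: cinner_minus_right)

lemma cinner_sum_left: "cinner (\<Sum>i\<in>A. f i) y = (\<Sum>i\<in>A. cinner (f i) y)"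
  by (induction A rule: infinite_finite_induct) (simp_all add: cinner_add_left)

lemma cinner_sum_right: "cinner x (\<Sum>i\<in>A. f i) = (\<Sum>i\<in>A. cinner x (f i))"
  by (induction A rule: infinite_finite_induct) (simp_all add: cinner_add_right)

lemma Re_cinner_commute: "Re (cinner y x) = Re (cinner x y)"
  by (subst cinner_commute) simp

lemma norm_add_sq: "(norm (x + y))\<^sup>2 = (norm x)\<^sup>2 + (norm y)\<^sup>2 + 2 * Re (cinner x y)"
  for x y :: "'a::complex_inner"
proof -
  have sq: "Re (cinner z z) = (norm z)\<^sup>2" for z :: 'a
    by (simp add: cinner_self del: of_real_power)
  have "Re (cinner (x + y) (x + y)) = Re (cinner x x) + Re (cinner y y) + 2 * Re (cinner x y)"
    by (simp add: cinner_add_left cinner_add_right Re_cinner_commute[of y x])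
  then show ?thesis
    by (simp only: sq)
qed

lemma norm_diff_sq: "(norm (x - y))\<^sup>2 = (norm x)\<^sup>2 + (norm y)\<^sup>2 - 2 * Re (cinner x y)"
  for x y :: "'a::complex_inner"
  using norm_add_sq[of x "- y"] by (simp add: cinner_minus_right)

lemma norm_cinner_le: "cmod (cinner x y) \<le> norm x * norm y"
  for x y :: "'a::complex_inner"
proof (cases "y = 0")
  case False
  \<comment> \<open>The multiple c y is the orthogonal projection of x onto the line of y; the
    inequality says that the remainder has nonnegative squared norm.\<close>
  define c where "c = cinner x y / of_real ((norm y)\<^sup>2)"
  have ny: "norm y > 0" using False by simp
  have cc: "c * cnj (cinner x y) = of_real ((cmod (cinner x y))\<^sup>2 / (norm y)\<^sup>2)"
    by (simp add: c_def complex_norm_square del: of_real_power)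
  have "Re (cinner x (c *\<^sub>C y)) = Re (cnj (c * cnj (cinner x y)))"
    by (simp add: cinner_scaleC_right)
  then have re: "Re (cinner x (c *\<^sub>C y)) = (cmod (cinner x y))\<^sup>2 / (norm y)\<^sup>2"
    by (simp add: cc del: complex_cnj_mult)
  have nc: "(norm (c *\<^sub>C y))\<^sup>2 = (cmod (cinner x y))\<^sup>2 / (norm y)\<^sup>2"
    using ny by (simp add: norm_scaleC c_def norm_divide norm_power field_simps power2_eq_square
        del: of_real_power of_real_mult flip: of_real_power of_real_mult)
  have "0 \<le> (norm x)\<^sup>2 - (cmod (cinner x y))\<^sup>2 / (norm y)\<^sup>2"
    using norm_diff_sq[of x "c *\<^sub>C y"] re nc zero_le_power2[of "norm (x - c *\<^sub>C y)"] by linarith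
  then have "(cmod (cinner x y))\<^sup>2 \<le> (norm x * norm y)\<^sup>2"
    using ny by (simp add: divide_le_eq power_mult_distrib)
  then show ?thesis
    by (rule power2_le_imp_le) simp
qed simp

lemma bounded_linear_cinner_left: "bounded_linear (\<lambda>x. cinner x (y::'a::complex_inner))"
  by (rule bounded_linear_intro[where K = "norm y"])
    (simp_all add: cinner_add_left cinner_scaleR_left scaleR_conv_of_real norm_cinner_le)

lemma bounded_linear_cinner_right: "bounded_linear (\<lambda>y. cinner (x::'a::complex_inner) y)"
  by (rule bounded_linear_intro[where K = "norm x"])
    (simp_all add: cinner_add_right cinner_scaleR_right scaleR_conv_of_real norm_cinner_le
      mult.commute[of _ "norm x"])

lemma bounded_bilinear_cinner:
  "bounded_bilinear (cinner :: 'a::complex_inner \<Rightarrow> 'a \<Rightarrow> complex)"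
proof
  show "\<exists>K. \<forall>x y :: 'a. norm (cinner x y) \<le> norm x * norm y * K"
    using norm_cinner_le by (intro exI[of _ 1]) auto
qed (simp_all add: cinner_add_left cinner_add_right cinner_scaleR_left cinner_scaleR_right
    scaleR_conv_of_real)

lemma norm_eq_sqrt_cinner: "norm (x::'a::complex_inner) = sqrt (Re (cinner x x))"
  by (simp add: cinner_self)

lemma cinner_eq_zero_all: "(\<And>y. cinner x y = 0) \<Longrightarrow> x = (0::'a::complex_inner)"
  by (metis cinner_self of_real_eq_0_iff norm_eq_zero zero_eq_power2)

lemma cinner_eqI: "(\<And>l. cinner x l = cinner y l) \<Longrightarrow> x = (y::'a::complex_inner)"
  using cinner_eq_zero_all[of "x - y"] by (simp add: cinner_diff_left)

lemma norm_le_of_cinner_le: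
  fixes x :: "'a::complex_inner"
  assumes "\<And>y. cmod (cinner x y) \<le> B * norm y" and "0 \<le> B"
  shows "norm x \<le> B"
proof (cases "x = 0")
  case False
  have "cmod (cinner x x) = norm x * norm x"
    by (simp add: cinner_self norm_power norm_mult power2_eq_square)
  with assms(1)[of x] have "norm x * norm x \<le> B * norm x" by simp
  then show ?thesis using False by simp
qed (use assms in simp)

text \<open>Induction over a total set: linearity carries \<open>P\<close> to the span and
  closedness carries it to the limits. Identities between bounded maps are thereby checked on
  generating vectors.\<close>

lemma closure_cspan_induct:
  fixes S :: "'a::complex_inner set"
  assumes "closure (cspan S) = UNIV" and base: "\<And>x. x \<in> S \<Longrightarrow> P x" and zero: "P 0"
    and add: "\<And>x y. P x \<Longrightarrow> P y \<Longrightarrow> P (x + y)" and scale: "\<And>c x. P x \<Longrightarrow> P (c *\<^sub>C x)"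
    and cl: "closed {x. P x}"
  shows "P x"
proof -
  have "P y" if "y \<in> cspan S" for y
    using that
  proof (induction rule: complex_vector.span_induct_alt)
    case (step c x y)
    then show ?case using base add scale by blast
  qed (rule zero)
  then have "closure (cspan S) \<subseteq> {x. P x}"
    by (intro closure_minimal cl) auto
  then show ?thesis using assms(1) by auto
qed


subsection \<open>Riesz representation and adjoints\<close>

lemma bopI: "(\<And>c x. blinfun_apply T (c *\<^sub>C x) = c *\<^sub>C T x) \<Longrightarrow> T \<in> bop"
  by (simp add: bop_def)

lemma bop_scaleC: "T \<in> bop \<Longrightarrow> blinfun_apply T (c *\<^sub>C x) = c *\<^sub>C T x"
  by (simp add: bop_def)

lemma bop_id [intro, simp]: "id_blinfun \<in> bop"
  by (simp add: bop_def)

lemma bop_zero [intro, simp]: "0 \<in> bop"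
  by (simp add: bop_def)

lemma bop_compose [intro, simp]: "S \<in> bop \<Longrightarrow> T \<in> bop \<Longrightarrow> S o\<^sub>L T \<in> bop"
  by (simp add: bop_def)

lemma bop_add [intro, simp]: "S \<in> bop \<Longrightarrow> T \<in> bop \<Longrightarrow> S + T \<in> bop"
  by (simp add: bop_def blinfun.add_left scaleC_add_right)

lemma bop_scaleR [intro, simp]: "T \<in> bop \<Longrightarrow> r *\<^sub>R T \<in> bop"
  by (simp add: bop_def blinfun.scaleR_left)
    (simp add: scaleC_scaleC mult.commute flip: scaleC_of_real)

lemma bop_sum [intro]: "(\<And>i. i \<in> A \<Longrightarrow> T i \<in> bop) \<Longrightarrow> (\<Sum>i\<in>A. T i) \<in> bop"
  by (induction A rule: infinite_finite_induct) auto

lemma closed_bop: "closed (bop :: ('a::complex_inner \<Rightarrow>\<^sub>L 'b::complex_inner) set)"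
proof -
  have "closed {T :: 'a \<Rightarrow>\<^sub>L 'b. T (c *\<^sub>C x) = c *\<^sub>C T x}" for c x
    by (intro closed_Collect_eq continuous_intros linear_continuous_on
        bounded_linear_compose[OF bounded_linear_scaleC] blinfun.bounded_linear_left)
  then have "closed (\<Inter>c. \<Inter>x. {T :: 'a \<Rightarrow>\<^sub>L 'b. T (c *\<^sub>C x) = c *\<^sub>C T x})"
    by blast
  also have "(\<Inter>c. \<Inter>x. {T :: 'a \<Rightarrow>\<^sub>L 'b. T (c *\<^sub>C x) = c *\<^sub>C T x}) = bop"
    by (auto simp: bop_def)
  finally show ?thesis .
qed

(* The representing vector minimises the functional norm x ^ 2 - 2 Re (f x). *)
lemma riesz_representation:
  fixes f :: "'a::chilbert_space \<Rightarrow> complex"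
  assumes add: "\<And>x y. f (x + y) = f x + f y" and scale: "\<And>c x. f (c *\<^sub>C x) = c * f x"
    and bnd: "\<And>x. cmod (f x) \<le> norm x * K"
  shows "\<exists>y. \<forall>x. f x = cinner x y"
proof -
  have bl: "bounded_linear f"
    by (rule bounded_linear_intro[where K = K])
      (simp_all add: add bnd scale scaleR_conv_of_real flip: scaleC_of_real)
  interpret f: bounded_linear f by (rule bl)
  define J where "J x = (norm x)\<^sup>2 - 2 * Re (f x)" for x
  have lower: "J x \<ge> - K\<^sup>2" for x
  proof -
    have "Re (f x) \<le> norm x * K"
      using bnd[of x] complex_Re_le_cmod order_trans by blast
    moreover have "0 \<le> (norm x - K)\<^sup>2" by simp
    ultimately show ?thesis by (simp add: J_def power2_diff)
  qed
  define d where "d = (INF x. J x)"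
  have bdd: "bdd_below (range J)" using lower by (auto simp: bdd_below_def)
  have d_le: "d \<le> J x" for x unfolding d_def by (rule cINF_lower[OF bdd]) simp
  have "\<exists>x. J x < d + 1 / Suc m" for m
  proof (rule ccontr)
    assume "\<not> ?thesis"
    then have "d + 1 / Suc m \<le> d" unfolding d_def by (intro cINF_greatest) (auto simp: not_less)
    then show False by simp
  qed
  then obtain X where X: "J (X m) < d + 1 / Suc m" for m by metis
  \<comment> \<open>Parallelogram law: the linear terms cancel, and the midpoint costs at least d,
    so near-minimisers are close to each other.\<close>
  have par: "(norm (x - y))\<^sup>2 \<le> 2 * (J x - d) + 2 * (J y - d)" for x y
  proof -
    have "4 * J ((1/2) *\<^sub>R (x + y)) = (norm (x + y))\<^sup>2 - 4 * Re (f (x + y))"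
      by (simp add: J_def f.scaleR power2_eq_square del: scaleR_add_right)
    then have "2 * J x + 2 * J y - 4 * J ((1/2) *\<^sub>R (x + y)) = (norm (x - y))\<^sup>2"
      using norm_add_sq[of x y] norm_diff_sq[of x y] by (simp add: J_def add)
    then show ?thesis using d_le[of "(1/2) *\<^sub>R (x + y)"] by argo
  qed
  have "Cauchy X"
  proof (rule metric_CauchyI)
    fix \<epsilon> :: real assume "0 < \<epsilon>"
    \<comment> \<open>Each of the two near-minimisers contributes at most 2 / Suc M to the squared
      distance.\<close>
    then obtain M where M: "4 / Suc M < \<epsilon>\<^sup>2"
      using reals_Archimedean[of "\<epsilon>\<^sup>2 / 4"] by (auto simp: field_simps)
    have "dist (X p) (X q) < \<epsilon>" if "p \<ge> M" "q \<ge> M" for p q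
    proof -
      have "1 / Suc p \<le> 1 / Suc M" "1 / Suc q \<le> 1 / Suc M"
        using that by (auto simp: field_simps)
      moreover have "(norm (X p - X q))\<^sup>2 \<le> 2 * (1 / Suc p) + 2 * (1 / Suc q)"
        using par[of "X p" "X q"] X[of p] X[of q] by argo
      ultimately have "(norm (X p - X q))\<^sup>2 < \<epsilon>\<^sup>2" using M by simp
      then show ?thesis using \<open>0 < \<epsilon>\<close> by (simp add: dist_norm power_less_imp_less_base)
    qed
    then show "\<exists>M. \<forall>m\<ge>M. \<forall>n\<ge>M. dist (X m) (X n) < \<epsilon>" by blast
  qed
  then obtain y where y: "X \<longlonglongrightarrow> y" using Cauchy_convergent convergent_def by blast
  have "(\<lambda>m. J (X m)) \<longlonglongrightarrow> J y"
    unfolding J_def by (intro tendsto_intros y f.tendsto)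
  moreover have "(\<lambda>m. d + 1 / Suc m) \<longlonglongrightarrow> d + 0"
    by (intro tendsto_intros LIMSEQ_Suc[OF lim_1_over_n])
  ultimately have "J y \<le> d"
    using X by (intro LIMSEQ_le) (auto intro: less_imp_le)
  then have min: "J y \<le> J x" for x using d_le order_trans by blast
  have re: "Re (f x) = Re (cinner x y)" for x
  proof (rule ccontr)
    assume ne: "Re (f x) \<noteq> Re (cinner x y)"
    define g where "g = Re (f x) - Re (cinner x y)"
    have x0: "norm x > 0" using ne by (auto simp: f.zero)
    have exp: "J (y + t *\<^sub>R x) = J y + t\<^sup>2 * (norm x)\<^sup>2 - 2 * t * g" for t
      by (simp add: J_def norm_add_sq cinner_scaleR_right f.add f.scaleR g_def
          Re_cinner_commute[of y x] power_mult_distrib algebra_simps)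
    have "2 * t * g \<le> t\<^sup>2 * (norm x)\<^sup>2" for t using min[of "y + t *\<^sub>R x"] exp[of t] by simp
    \<comment> \<open>This t minimises the quadratic t^2 |x|^2 - 2 t g, so it extracts the most from
      minimality of \<open>J\<close> at y.\<close>
    from this[of "g / (norm x)\<^sup>2"] have "2 * g\<^sup>2 / (norm x)\<^sup>2 \<le> g\<^sup>2 / (norm x)\<^sup>2"
      using x0 by (simp add: power2_eq_square field_simps)
    then have "g\<^sup>2 \<le> 0" using x0 by (simp add: field_simps)
    then show False using ne by (simp add: g_def)
  qed
  have "f x = cinner x y" for x
  proof (rule complex_eqI)
    show "Im (f x) = Im (cinner x y)"
      using re[of "\<i> *\<^sub>C x"] by (simp add: scale cinner_scaleC_left)
  qed (rule re)
  then show ?thesis by blast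
qed

lemma adjoint_exists:
  fixes T :: "'a::chilbert_space \<Rightarrow>\<^sub>L 'b::complex_inner"
  assumes "T \<in> bop"
  shows "\<exists>T'\<in>bop. \<forall>x y. cinner (T x) y = cinner x (blinfun_apply T' y)"
proof -
  have "\<exists>z. \<forall>x. cinner (T x) y = cinner x z" for y
  proof (rule riesz_representation)
    show "cmod (cinner (T x) y) \<le> norm x * (norm T * norm y)" for x
    proof -
      have "cmod (cinner (T x) y) \<le> norm (T x) * norm y" by (rule norm_cinner_le)
      also have "\<dots> \<le> (norm T * norm x) * norm y"
        by (intro mult_right_mono norm_blinfun) simp
      finally show ?thesis by (simp add: ac_simps)
    qed
  qed (simp_all add: blinfun.add_right cinner_add_left bop_scaleC[OF assms] cinner_scaleC_left)
  then obtain G where G: "cinner (T x) y = cinner x (G y)" for x y by metis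
  have ext: "u = v" if "\<And>x. cinner x u = cinner x v" for u v :: 'a
  proof -
    have "cinner (u - v) x = 0" for x
      using that[of x] by (metis cinner_commute cinner_diff_left right_minus_eq)
    then show ?thesis using cinner_eq_zero_all[of "u - v"] by simp
  qed
  have sc: "G (c *\<^sub>C y) = c *\<^sub>C G y" for c y
    by (rule ext) (simp add: cinner_scaleC_right flip: G)
  have "bounded_linear G"
  proof (rule bounded_linear_intro[where K = "norm T"])
    show "G (x + y) = G x + G y" for x y
      by (rule ext) (simp add: cinner_add_right flip: G)
    show "G (r *\<^sub>R x) = r *\<^sub>R G x" for r x
      using sc by (simp flip: scaleC_of_real)
    show "norm (G y) \<le> norm y * norm T" for y
    proof (rule norm_le_of_cinner_le)
      fix x
      have "cmod (cinner (G y) x) = cmod (cinner (T x) y)"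
        by (subst cinner_commute) (simp add: G)
      also have "\<dots> \<le> norm (T x) * norm y" by (rule norm_cinner_le)
      also have "\<dots> \<le> (norm T * norm x) * norm y"
        by (intro mult_right_mono norm_blinfun) simp
      finally show "cmod (cinner (G y) x) \<le> norm y * norm T * norm x" by (simp add: ac_simps)
    qed simp
  qed
  then have "blinfun_apply (Blinfun G) = G" by (simp add: bounded_linear_Blinfun_apply)
  then show ?thesis using G sc by (intro bexI[of _ "Blinfun G"]) (auto intro: bopI)
qed

lemma
  fixes T :: "'a::chilbert_space \<Rightarrow>\<^sub>L 'b::complex_inner"
  assumes "T \<in> bop"
  shows adj_bop: "adj T \<in> bop" and cinner_adj: "cinner (T x) y = cinner x (adj T y)"
proof -
  let ?P = "\<lambda>T'. T' \<in> bop \<and> (\<forall>x y. cinner (T x) y = cinner x (blinfun_apply T' y))"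
  obtain T' where T': "?P T'" using adjoint_exists[OF assms] by blast
  have "S = T'" if "?P S" for S
  proof (rule blinfun_eqI)
    fix y
    have "cinner x (S y - T' y) = 0" for x
      using that T' by (simp add: cinner_diff_right)
    then have "cinner (S y - T' y) x = 0" for x
      by (metis cinner_commute complex_cnj_zero)
    then show "S y = T' y" using cinner_eq_zero_all by (metis right_minus_eq)
  qed
  then have "?P (adj T)" unfolding adj_def using T' by (rule theI[rotated])
  then show "adj T \<in> bop" "cinner (T x) y = cinner x (adj T y)" by auto
qed

lemma cinner_adj': "T \<in> bop \<Longrightarrow> cinner y (T x) = cinner (adj T y) x"
  for T :: "'a::chilbert_space \<Rightarrow>\<^sub>L 'b::complex_inner"
  by (metis cinner_adj cinner_commute)


subsection \<open>Strong limits\<close>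

text \<open>The uniform bound makes the set of vectors with a limit closed, by comparison with a
  nearby vector and completeness of the target. The filter is arbitrary because limits are needed
  both along finite index sets and for r tending to 1.\<close>

lemma strong_limit_exists:
  fixes T :: "'i \<Rightarrow> 'a::complex_inner \<Rightarrow>\<^sub>L 'b::chilbert_space"
  assumes F: "F \<noteq> bot" and bop: "\<And>i. T i \<in> bop" and bnd: "\<And>i. norm (T i) \<le> K"
    and S: "closure (cspan S) = UNIV"
    and conv: "\<And>x. x \<in> S \<Longrightarrow> \<exists>l. ((\<lambda>i. T i x) \<longlongrightarrow> l) F"
  shows "\<exists>L\<in>bop. norm L \<le> K \<and> (\<forall>x. ((\<lambda>i. T i x) \<longlongrightarrow> blinfun_apply L x) F)"
proof -
  have K: "K \<ge> 0" using bnd[of undefined] norm_ge_zero order_trans by blast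
  have T_le: "norm (T i x) \<le> K * norm x" for i x
    using norm_blinfun[of "T i" x] bnd[of i] by (meson mult_right_mono norm_ge_zero order_trans)
  have "\<exists>l. ((\<lambda>i. T i x) \<longlongrightarrow> l) F" for x
    using S conv
  proof (rule closure_cspan_induct[where P = "\<lambda>x. \<exists>l. ((\<lambda>i. T i x) \<longlongrightarrow> l) F"])
    show "\<exists>l. ((\<lambda>i. T i 0) \<longlongrightarrow> l) F" by (auto intro: tendsto_const simp: blinfun.zero_right)
    show "\<exists>l. ((\<lambda>i. T i (x + y)) \<longlongrightarrow> l) F"
      if "\<exists>l. ((\<lambda>i. T i x) \<longlongrightarrow> l) F" "\<exists>l. ((\<lambda>i. T i y) \<longlongrightarrow> l) F" for x y
      using that by (auto simp: blinfun.add_right intro: tendsto_add)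
    show "\<exists>l. ((\<lambda>i. T i (c *\<^sub>C x)) \<longlongrightarrow> l) F" if "\<exists>l. ((\<lambda>i. T i x) \<longlongrightarrow> l) F" for c x
      using that by (auto simp: bop_scaleC[OF bop]
          intro: bounded_linear.tendsto[OF bounded_linear_scaleC])
    show "closed {x. \<exists>l. ((\<lambda>i. T i x) \<longlongrightarrow> l) F}"
      unfolding closure_subset_eq[symmetric]
    proof safe
      fix x assume x: "x \<in> closure {x. \<exists>l. ((\<lambda>i. T i x) \<longlongrightarrow> l) F}"
      have "cauchy_filter (filtermap (\<lambda>i. T i x) F)"
        unfolding cauchy_filter_metric_filtermap
      proof (intro allI impI)
        fix \<epsilon> :: real assume \<epsilon>: "\<epsilon> > 0"
        \<comment> \<open>The divisor contains K + 1 because K may be 0. The four quarters of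
          \<epsilon> pay for x against x' at both indices and for x' against its limit at
          both.\<close>
        obtain x' l where l: "((\<lambda>i. T i x') \<longlongrightarrow> l) F" and d: "dist x' x < \<epsilon> / (4 * (K + 1))"
        proof -
          have "\<epsilon> / (4 * (K + 1)) > 0" using \<epsilon> K by simp
          then have "\<exists>y\<in>{x. \<exists>l. ((\<lambda>i. T i x) \<longlongrightarrow> l) F}. dist y x < \<epsilon> / (4 * (K + 1))"
            using x unfolding closure_approachable by blast
          then show thesis using that by blast
        qed
        have le: "dist (T i x) (T i x') \<le> \<epsilon> / 4" for i
        proof -
          have "dist (T i x) (T i x') \<le> K * dist x x'"
            using T_le[of i "x - x'"] by (simp add: dist_norm blinfun.diff_right)
          also have "\<dots> \<le> (K + 1) * (\<epsilon> / (4 * (K + 1)))"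
            using d K by (intro mult_mono) (auto simp: dist_commute)
          also have "\<dots> = \<epsilon> / 4" using K by (simp add: field_simps)
          finally show ?thesis .
        qed
        let ?P = "\<lambda>i. dist (T i x') l < \<epsilon> / 4"
        have "eventually ?P F" using tendstoD[OF l, of "\<epsilon> / 4"] \<epsilon> by simp
        moreover have "dist (T i x) (T j x) < \<epsilon>" if "?P i" "?P j" for i j
        proof -
          have "dist (T i x) (T j x) \<le> dist (T i x) (T i x') + dist (T i x') l
            + (dist (T j x') l + dist (T j x) (T j x'))"
            using dist_triangle[of "T i x" l "T i x'"] dist_triangle[of "T j x" l "T j x'"]
              dist_triangle2[of "T i x" "T j x" l] by linarith
          then show ?thesis using le[of i] le[of j] that by linarith
        qed
        ultimately show "\<exists>P. eventually P F \<and> (\<forall>i j. P i \<and> P j \<longrightarrow> dist (T i x) (T j x) < \<epsilon>)"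
          by blast
      qed
      moreover have "filtermap (\<lambda>i. T i x) F \<noteq> bot" using F by (simp add: filtermap_bot_iff)
      ultimately have "\<exists>l. filtermap (\<lambda>i. T i x) F \<le> nhds l"
        using complete_UNIV unfolding complete_uniform by fastforce
      then show "\<exists>l. ((\<lambda>i. T i x) \<longlongrightarrow> l) F" by (simp add: filterlim_def)
    qed
  qed
  then obtain L where L: "((\<lambda>i. T i x) \<longlongrightarrow> L x) F" for x by metis
  have add: "L (x + y) = L x + L y" for x y
    by (rule tendsto_unique[OF F L]) (simp add: blinfun.add_right tendsto_add L)
  have scale: "L (c *\<^sub>C x) = c *\<^sub>C L x" for c x
    by (rule tendsto_unique[OF F L])
      (simp add: bop_scaleC[OF bop] bounded_linear.tendsto[OF bounded_linear_scaleC L])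
  have le: "norm (L x) \<le> norm x * K" for x
    using tendsto_upperbound[OF tendsto_norm[OF L] _ F, of x "norm x * K"] T_le
    by (simp add: mult.commute)
  have "bounded_linear L"
    by (rule bounded_linear_intro[where K = K])
      (use scale[of "of_real _"] in \<open>simp_all add: add le scaleC_of_real\<close>)
  then have app: "blinfun_apply (Blinfun L) = L" by (simp add: bounded_linear_Blinfun_apply)
  have "norm (Blinfun L) \<le> K"
    by (rule norm_blinfun_bound[OF K]) (simp only: app le mult.commute[of K])
  with app scale L show ?thesis
    by (intro bexI[of _ "Blinfun L"]) (auto intro: bopI)
qed

lemma strong_limit_eq:
  fixes T :: "'i \<Rightarrow> 'a::complex_inner \<Rightarrow>\<^sub>L 'b::chilbert_space"
  assumes F: "F \<noteq> bot" and "\<And>i. T i \<in> bop" and "\<And>i. norm (T i) \<le> K" and A: "A \<in> bop"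
    and S: "closure (cspan S) = UNIV"
    and conv: "\<And>x. x \<in> S \<Longrightarrow> ((\<lambda>i. T i x) \<longlongrightarrow> A x) F"
  shows "((\<lambda>i. T i x) \<longlongrightarrow> A x) F"
proof -
  have "\<exists>L\<in>bop. norm L \<le> K \<and> (\<forall>x. ((\<lambda>i. T i x) \<longlongrightarrow> blinfun_apply L x) F)"
    by (rule strong_limit_exists[OF assms(1-3) S]) (rule exI, erule conv)
  then obtain L where L: "L \<in> bop" "((\<lambda>i. T i x) \<longlongrightarrow> blinfun_apply L x) F" for x
    by metis
  have "L x = A x"
    using S
  proof (rule closure_cspan_induct[where P = "\<lambda>x. blinfun_apply L x = A x"])
    show "L x = A x" if "x \<in> S" for x
      using tendsto_unique[OF F L(2) conv[OF that]] .
    show "closed {x. blinfun_apply L x = A x}"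
      by (intro closed_Collect_eq linear_continuous_on blinfun.bounded_linear_right)
  qed (simp_all add: blinfun.bilinear_simps bop_scaleC[OF L(1)] bop_scaleC[OF A])
  then show ?thesis using L(2)[of x] by simp
qed

lemma bop_eqI_dense:
  assumes S: "closure (cspan S) = UNIV" and "L \<in> bop" "M \<in> bop"
    and eq: "\<And>x. x \<in> S \<Longrightarrow> blinfun_apply L x = M x"
  shows "L = M"
proof (rule blinfun_eqI)
  show "L x = M x" for x
    using S eq
  proof (rule closure_cspan_induct[where P = "\<lambda>x. blinfun_apply L x = M x"])
    show "closed {x. blinfun_apply L x = M x}"
      by (intro closed_Collect_eq linear_continuous_on blinfun.bounded_linear_right)
  qed (simp_all add: blinfun.bilinear_simps bop_scaleC[OF assms(2)] bop_scaleC[OF assms(3)])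
qed

subsection \<open>Hilbert direct sums of copies of one space\<close>

text \<open>Both \<open>'f\<close>, as the direct sum of the lines \<open>\<complex> e\<^sub>w\<close>, and \<open>'e \<otimes> 'f\<close>, as the
  direct sum of the subspaces \<open>'e \<otimes> e\<^sub>w\<close>, are instances.\<close>

locale hilbert_sum =
  fixes I :: "'i set" and V :: "'i \<Rightarrow> 'e::chilbert_space \<Rightarrow> 'h::chilbert_space"
  assumes V_add: "V w (h + l) = V w h + V w l"
    and V_scaleC: "V w (c *\<^sub>C h) = c *\<^sub>C V w h"
    and cinner_V: "v \<in> I \<Longrightarrow> w \<in> I \<Longrightarrow>
      cinner (V v h) (V w l) = (if v = w then cinner h l else 0)"
    and dense_V: "closure (cspan {V w h |w h. w \<in> I}) = UNIV"
begin

lemma V_zero [simp]: "V w 0 = 0"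
  using V_scaleC[of w 0 0] by simp

lemma V_scaleR: "V w (r *\<^sub>R h) = r *\<^sub>R V w h"
  using V_scaleC[of w "of_real r" h] by (simp add: scaleC_of_real)

lemma norm_V: "w \<in> I \<Longrightarrow> norm (V w h) = norm h"
  by (simp add: norm_eq_sqrt_cinner cinner_V)

definition inj_op :: "'i \<Rightarrow> 'e \<Rightarrow>\<^sub>L 'h"
  where "inj_op w = Blinfun (V w)"

text \<open>The adjoint of the isometric embedding of the w-th copy, hence the projection onto that
  copy followed by its identification with \<open>'e\<close>.\<close>

definition coord :: "'i \<Rightarrow> 'h \<Rightarrow>\<^sub>L 'e"
  where "coord w = adj (inj_op w)"

lemma inj_op_apply: "w \<in> I \<Longrightarrow> blinfun_apply (inj_op w) = V w"
  unfolding inj_op_def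
  by (rule bounded_linear_Blinfun_apply, rule bounded_linear_intro[where K = 1])
    (simp_all add: V_add V_scaleR norm_V)

lemma inj_op_bop: "w \<in> I \<Longrightarrow> inj_op w \<in> bop"
  by (rule bopI) (simp add: inj_op_apply V_scaleC)

lemma coord_bop: "w \<in> I \<Longrightarrow> coord w \<in> bop"
  unfolding coord_def by (intro adj_bop inj_op_bop)

lemma cinner_V_left: "w \<in> I \<Longrightarrow> cinner (V w h) x = cinner h (coord w x)"
  unfolding coord_def by (metis cinner_adj inj_op_apply inj_op_bop)

lemma cinner_V_right: "w \<in> I \<Longrightarrow> cinner x (V w h) = cinner (coord w x) h"
  by (metis cinner_V_left cinner_commute)

lemma coord_V:
  assumes "v \<in> I" "w \<in> I"
  shows "coord v (V w h) = (if v = w then h else 0)"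
proof -
  have "cinner (coord v (V w h) - (if v = w then h else 0)) l = 0" for l
    using assms by (auto simp: cinner_diff_left cinner_V simp flip: cinner_V_right)
  from cinner_eq_zero_all[OF this] show ?thesis by simp
qed

text \<open>The reindexing by an injective f is there for shifts, which move the w-th component to
  the place f w and keep the components orthogonal.\<close>

lemma norm_sum_V_inj:
  assumes "finite G" "inj_on f G" "f ` G \<subseteq> I"
  shows "(norm (\<Sum>w\<in>G. V (f w) (a w)))\<^sup>2 = (\<Sum>w\<in>G. (norm (a w))\<^sup>2)"
proof -
  have "cinner (\<Sum>w\<in>G. V (f w) (a w)) (\<Sum>w\<in>G. V (f w) (a w)) =
      (\<Sum>w\<in>G. \<Sum>v\<in>G. if w = v then cinner (a w) (a v) else 0)"
    by (subst cinner_sum_left, rule sum.cong[OF refl], subst cinner_sum_right, rule sum.cong[OF refl])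
      (use assms in \<open>auto simp: cinner_V image_subset_iff dest: inj_onD\<close>)
  also have "\<dots> = (\<Sum>w\<in>G. complex_of_real ((norm (a w))\<^sup>2))"
    using \<open>finite G\<close> by (simp add: cinner_self)
  also have "\<dots> = complex_of_real (\<Sum>w\<in>G. (norm (a w))\<^sup>2)"
    by simp
  finally show ?thesis
    unfolding cinner_self of_real_eq_iff .
qed

lemma norm_sum_V:
  "finite F \<Longrightarrow> F \<subseteq> I \<Longrightarrow> (norm (\<Sum>w\<in>F. V w (a w)))\<^sup>2 = (\<Sum>w\<in>F. (norm (a w))\<^sup>2)"
  using norm_sum_V_inj[of F "\<lambda>w. w"] by simp

lemma norm_sum_V_L2:
  "finite F \<Longrightarrow> F \<subseteq> I \<Longrightarrow> norm (\<Sum>w\<in>F. V w (a w)) = L2_set (\<lambda>w. norm (a w)) F"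
  unfolding L2_set_def by (metis norm_sum_V norm_ge_zero real_sqrt_abs abs_of_nonneg)

text \<open>The projection q of x onto the copies in F satisfies <q, x> = |q|^2, and Cauchy-Schwarz
  then gives |q| \<le> |x|.\<close>

lemma bessel:
  assumes "finite F" "F \<subseteq> I"
  shows "L2_set (\<lambda>w. norm (coord w x)) F \<le> norm x"
proof -
  let ?q = "\<Sum>w\<in>F. V w (coord w x)"
  have "cinner ?q x = (\<Sum>w\<in>F. complex_of_real ((norm (coord w x))\<^sup>2))"
    unfolding cinner_sum_left
    by (intro sum.cong refl) (use assms in \<open>auto simp: cinner_V_left cinner_self\<close>)
  also have "\<dots> = complex_of_real ((norm ?q)\<^sup>2)"
    by (simp add: norm_sum_V[OF assms] del: of_real_power)
  finally have "cmod (cinner ?q x) = norm ?q * norm ?q"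
    by (simp add: norm_mult power2_eq_square)
  then have "norm ?q * norm ?q \<le> norm ?q * norm x"
    using norm_cinner_le[of ?q x] by simp
  then have "norm ?q \<le> norm x"
    by (cases "norm ?q = 0") (simp_all add: mult_le_cancel_left)
  then show ?thesis by (simp add: norm_sum_V_L2[OF assms])
qed

lemma hilbert_sum_eqI:
  assumes "\<And>w h. w \<in> I \<Longrightarrow> cinner x (V w h) = cinner y (V w h)"
  shows "x = y"
proof -
  have "cinner (x - y) z = 0" for z
    using dense_V
  proof (rule closure_cspan_induct[where P = "\<lambda>z. cinner (x - y) z = 0"])
    show "closed {z. cinner (x - y) z = 0}"
      by (intro closed_Collect_eq continuous_intros
          linear_continuous_on bounded_linear_cinner_right)
  qed (use assms in \<open>auto simp: cinner_add_right cinner_scaleC_right cinner_diff_left\<close>)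
  from cinner_eq_zero_all[OF this] show ?thesis by simp
qed

lemma bop_eqI:
  fixes S T :: "'h \<Rightarrow>\<^sub>L 'b::complex_inner"
  assumes "S \<in> bop" "T \<in> bop" and eq: "\<And>w h. w \<in> I \<Longrightarrow> S (V w h) = T (V w h)"
  shows "S = T"
  by (rule bop_eqI_dense[OF dense_V assms(1,2)]) (use eq in auto)

lemma bop_eqI_entries:
  assumes "S \<in> bop" "T \<in> bop"
    and "\<And>v w h l. v \<in> I \<Longrightarrow> w \<in> I \<Longrightarrow> cinner (blinfun_apply S (V w h)) (V v l) = cinner (blinfun_apply T (V w h)) (V v l)"
  shows "S = T"
  by (intro bop_eqI hilbert_sum_eqI assms)

lemma eventually_mem_finite_subsets:
  "w \<in> A \<Longrightarrow> eventually (\<lambda>F. finite F \<and> F \<subseteq> A \<and> w \<in> F) (finite_subsets_at_top A)"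
  unfolding eventually_finite_subsets_at_top by (intro exI[of _ "{w}"]) auto

lemma has_sum_coord: "((\<lambda>w. V w (coord w x)) has_sum x) I"
proof -
  \<comment> \<open>The value 0 at other sets makes the norm bound hold at every index, as the
    strong limit lemma asks; the filter does not see these sets.\<close>
  define Q where "Q F = (if finite F \<and> F \<subseteq> I then \<Sum>w\<in>F. inj_op w o\<^sub>L coord w else 0)" for F
  have Q: "Q F x = (\<Sum>w\<in>F. V w (coord w x))" if "finite F" "F \<subseteq> I" for F x
    unfolding Q_def using that
    by (auto simp: blinfun.sum_left inj_op_apply subset_iff intro!: sum.cong)
  have "((\<lambda>F. Q F x) \<longlongrightarrow> id_blinfun x) (finite_subsets_at_top I)"
  proof (rule strong_limit_eq[where K = 1 and S = "{V w h |w h. w \<in> I}"])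
    show "Q F \<in> bop" for F
      unfolding Q_def by (auto intro!: bop_sum bop_compose inj_op_bop coord_bop)
    show "norm (Q F) \<le> 1" for F
    proof (cases "finite F \<and> F \<subseteq> I")
      case True
      then show ?thesis
        by (intro norm_blinfun_bound) (auto simp: Q norm_sum_V_L2 bessel)
    qed (auto simp: Q_def)
    fix y assume "y \<in> {V w h |w h. w \<in> I}"
    then obtain w h where y: "y = V w h" "w \<in> I" by blast
    have "eventually (\<lambda>F. Q F y = id_blinfun y) (finite_subsets_at_top I)"
      using eventually_mem_finite_subsets[OF y(2)]
    proof eventually_elim
      case (elim F)
      then have "Q F y = (\<Sum>v\<in>F. V v (coord v y))" by (simp add: Q)
      also have "\<dots> = (\<Sum>v\<in>F. if v = w then V w h else 0)"
        using y(2) elim by (intro sum.cong refl) (auto simp: y(1) coord_V subset_iff)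
      finally show ?case using elim by (simp add: y(1))
    qed
    then show "((\<lambda>F. Q F y) \<longlongrightarrow> id_blinfun y) (finite_subsets_at_top I)"
      by (rule tendsto_eventually)
  qed (simp, simp, rule dense_V)
  then show ?thesis
    unfolding has_sum_def id_blinfun.rep_eq id_apply
    by (rule Lim_transform_eventually)
      (rule eventually_finite_subsets_at_top_weakI, simp add: Q)
qed

lemma op_tendsto_coord_sum:
  "((\<lambda>F. \<Sum>w\<in>F. V w (coord w x)) \<longlongrightarrow> x) (finite_subsets_at_top I)"
  using has_sum_coord[of x] unfolding has_sum_def .

lemma parseval: "((\<lambda>w. cinner (coord w x) (coord w y)) has_sum cinner x y) I"
proof -
  have "((\<lambda>w. cinner (V w (coord w x)) y) has_sum cinner x y) I"
    by (rule has_sum_bounded_linear[OF bounded_linear_cinner_left has_sum_coord])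
  then show ?thesis
    by (rule has_sum_cong[THEN iffD1, rotated]) (simp add: cinner_V_left)
qed

lemma coord_has_sum:
  assumes "((\<lambda>v. V v (a v)) has_sum x) I" "w \<in> I"
  shows "coord w x = a w"
proof -
  have "((\<lambda>v. coord w (V v (a v))) has_sum coord w x) I"
    by (rule has_sum_bounded_linear[OF blinfun.bounded_linear_right assms(1)])
  moreover have "((\<lambda>v. coord w (V v (a v))) has_sum a w) I"
    using assms(2) by (intro has_sum_finite_neutralI[of "{w}"]) (auto simp: coord_V)
  ultimately show ?thesis using has_sum_unique by blast
qed

lemma parseval_norm: "((\<lambda>v. (norm (coord v x))\<^sup>2) has_sum (norm x)\<^sup>2) I"
  using has_sum_Re[OF parseval[of x x]] by (simp add: cinner_self)

lemma norm_le_of_coord_le: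
  assumes "\<And>v. v \<in> I \<Longrightarrow> norm (coord v x) \<le> norm (coord v y)"
  shows "norm x \<le> norm y"
proof -
  have "(norm x)\<^sup>2 \<le> (norm y)\<^sup>2"
    by (rule has_sum_mono[OF parseval_norm parseval_norm]) (use assms in \<open>simp add: power_mono\<close>)
  then show ?thesis by (rule power2_le_imp_le) simp
qed

text \<open>A dominated convergence argument. A finite set F carries y up to \<epsilon> / 2; on F
  the factors converge uniformly, and elsewhere 1 - c has modulus at most 1, so the error is at most
  the tail of y.\<close>

lemma damped_tendsto:
  fixes c :: "'j \<Rightarrow> 'i \<Rightarrow> real"
  assumes ev: "eventually (\<lambda>r. \<forall>v\<in>I. 0 \<le> c r v \<and> c r v \<le> 1 \<and> coord v (Y r) = c r v *\<^sub>R coord v y) G"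
    and lim: "\<And>v. v \<in> I \<Longrightarrow> ((\<lambda>r. c r v) \<longlongrightarrow> 1) G"
  shows "(Y \<longlongrightarrow> y) G"
proof (rule tendstoI)
  fix \<epsilon> :: real assume \<epsilon>: "\<epsilon> > 0"
  have "eventually (\<lambda>F. dist (\<Sum>v\<in>F. V v (coord v y)) y < \<epsilon> / 2) (finite_subsets_at_top I)"
    using tendstoD[OF has_sum_coord[unfolded has_sum_def], of "\<epsilon> / 2"] \<epsilon> by simp
  then obtain F where F: "finite F" "F \<subseteq> I" and d: "dist (\<Sum>v\<in>F. V v (coord v y)) y < \<epsilon> / 2"
    unfolding eventually_finite_subsets_at_top by blast
  define z where "z = y - (\<Sum>v\<in>F. V v (coord v y))"
  have z: "norm z < \<epsilon> / 2" using d by (simp add: z_def dist_norm norm_minus_commute)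
  have coord_sum: "coord u (\<Sum>v\<in>F. V v (a v)) = (if u \<in> F then a u else 0)" if "u \<in> I" for u a
  proof -
    have "coord u (\<Sum>v\<in>F. V v (a v)) = (\<Sum>v\<in>F. coord u (V v (a v)))"
      by (simp add: blinfun.sum_right)
    also have "\<dots> = (\<Sum>v\<in>F. if v = u then a u else 0)"
      using F that by (intro sum.cong refl) (auto simp: coord_V)
    finally show ?thesis using F by simp
  qed
  \<comment> \<open>The part of the error y - Y r that lives on F. Removing it leaves a vector that
    vanishes on F and is dominated coordinatewise by the tail z.\<close>
  let ?q = "\<lambda>r. \<Sum>v\<in>F. V v ((1 - c r v) *\<^sub>R coord v y)"
  have "((\<lambda>r. \<Sum>v\<in>F. (1 - c r v) *\<^sub>R V v (coord v y)) \<longlongrightarrow> (\<Sum>v\<in>F. (1 - 1) *\<^sub>R V v (coord v y))) G"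
    using F by (intro tendsto_intros lim) auto
  then have q: "(?q \<longlongrightarrow> 0) G" by (simp add: V_scaleR)
  have "eventually (\<lambda>r. norm (?q r) < \<epsilon> / 2) G"
    using tendstoD[OF q, of "\<epsilon> / 2"] \<epsilon> by simp
  then show "eventually (\<lambda>r. dist (Y r) y < \<epsilon>) G"
    using ev
  proof eventually_elim
    case (elim r)
    have "norm (y - Y r - ?q r) \<le> norm z"
    proof (rule norm_le_of_coord_le)
      fix u assume u: "u \<in> I"
      show "norm (coord u (y - Y r - ?q r)) \<le> norm (coord u z)"
      proof (cases "u \<in> F")
        case True
        then have "coord u (y - Y r - ?q r) = 0"
          using elim(2) u by (simp add: blinfun.diff_right coord_sum scaleR_left_diff_distrib)
        then show ?thesis by simp
      next
        case False
        then have "coord u (y - Y r - ?q r) = (1 - c r u) *\<^sub>R coord u z"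
          using elim(2) u
          by (simp add: z_def blinfun.diff_right coord_sum scaleR_left_diff_distrib)
        moreover have "\<bar>1 - c r u\<bar> \<le> 1" using elim(2) u by auto
        ultimately show ?thesis by (simp add: mult_left_le_one_le)
      qed
    qed
    then have "norm (y - Y r) < \<epsilon>"
      using elim(1) z norm_triangle_sub[of "y - Y r" "?q r"] by linarith
    then show ?case by (simp add: dist_norm norm_minus_commute)
  qed
qed

text \<open>Orthogonality turns the Cauchy criterion for the vectors into the one for the squared
  norms of their coefficients.\<close>

lemma summable_on_V:
  assumes "(\<lambda>v. (norm (a v))\<^sup>2) summable_on I"
  shows "(\<lambda>v. V v (a v)) summable_on I"
proof -
  let ?f = "\<lambda>v. V v (a v)"
  obtain S where S: "((\<lambda>v. (norm (a v))\<^sup>2) has_sum S) I"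
    using assms summable_on_def by blast
  have "cauchy_filter (filtermap (sum ?f) (finite_subsets_at_top I))"
    unfolding cauchy_filter_metric_filtermap
  proof (intro allI impI)
    fix \<epsilon> :: real assume \<epsilon>: "\<epsilon> > 0"
    \<comment> \<open>Two partial sums within \<epsilon>^2 / 16 of S differ by less than
      \<epsilon>^2 / 8, which is below the square of \<epsilon> / 2.\<close>
    then have "eventually (\<lambda>F. dist (\<Sum>v\<in>F. (norm (a v))\<^sup>2) S < \<epsilon>\<^sup>2 / 16) (finite_subsets_at_top I)"
      using tendstoD[OF S[unfolded has_sum_def], of "\<epsilon>\<^sup>2 / 16"] by simp
    then obtain F0 where F0: "finite F0" "F0 \<subseteq> I"
      and d: "\<And>F. finite F \<Longrightarrow> F0 \<subseteq> F \<Longrightarrow> F \<subseteq> I \<Longrightarrow> dist (\<Sum>v\<in>F. (norm (a v))\<^sup>2) S < \<epsilon>\<^sup>2 / 16"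
      unfolding eventually_finite_subsets_at_top by metis
    let ?P = "\<lambda>F. finite F \<and> F0 \<subseteq> F \<and> F \<subseteq> I"
    have near: "norm (sum ?f F - sum ?f F0) < \<epsilon> / 2" if "?P F" for F
    proof -
      have "(norm (sum ?f F - sum ?f F0))\<^sup>2 = (norm (sum ?f (F - F0)))\<^sup>2"
        using that by (simp add: sum_diff)
      also have "\<dots> = (\<Sum>v\<in>F - F0. (norm (a v))\<^sup>2)"
        using that by (intro norm_sum_V) auto
      also have "\<dots> = (\<Sum>v\<in>F. (norm (a v))\<^sup>2) - (\<Sum>v\<in>F0. (norm (a v))\<^sup>2)"
        using that by (simp add: sum_diff)
      also have "\<dots> < \<epsilon>\<^sup>2 / 8"
        using d[of F] d[of F0] F0 that unfolding dist_real_def abs_less_iff by auto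
      also have "\<dots> \<le> (\<epsilon> / 2)\<^sup>2" by (simp add: power2_eq_square)
      finally show ?thesis by (rule power_less_imp_less_base) (use \<epsilon> in simp)
    qed
    have 1: "dist (sum ?f F) (sum ?f G) < \<epsilon>" if "?P F" "?P G" for F G
      using near[OF that(1)] near[OF that(2)]
        dist_triangle2[of "sum ?f F" "sum ?f G" "sum ?f F0"] by (simp add: dist_norm)
    have 2: "eventually ?P (finite_subsets_at_top I)"
      unfolding eventually_finite_subsets_at_top by (rule exI[of _ F0]) (simp add: F0)
    show "\<exists>P. eventually P (finite_subsets_at_top I) \<and>
        (\<forall>F G. P F \<and> P G \<longrightarrow> dist (sum ?f F) (sum ?f G) < \<epsilon>)"
      by (rule exI[of _ ?P]) (simp add: 1 2)
  qed
  moreover have "filtermap (sum ?f) (finite_subsets_at_top I) \<noteq> bot"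
    by (simp add: filtermap_bot_iff)
  ultimately have "\<exists>l. filtermap (sum ?f) (finite_subsets_at_top I) \<le> nhds l"
    using complete_UNIV[where 'a = 'h] unfolding complete_uniform
    by (metis principal_eq_bot_iff top_greatest top_eq_principal_UNIV)
  then show ?thesis
    by (simp add: summable_on_def has_sum_def filterlim_def)
qed

text \<open>The finite partial sums are bounded by the norm of X because f keeps the images
  orthogonal, and on each generator they are eventually constant. With \<open>'e\<close> the complex
  numbers and X the identity this yields the creation operators; with general X it yields the tensor
  products X \<otimes> Y for partial shifts Y.\<close>

lemma partial_shift_exists:
  fixes X :: "'e \<Rightarrow>\<^sub>L 'e"
  assumes D: "D \<subseteq> I" "inj_on f D" "f ` D \<subseteq> I" and X: "X \<in> bop"
  shows "\<exists>T\<in>bop. \<forall>w\<in>I. \<forall>h. blinfun_apply T (V w h) = (if w \<in> D then V (f w) (X h) else 0)"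
proof -
  define Q where "Q F = (if finite F then \<Sum>w\<in>F \<inter> D. inj_op (f w) o\<^sub>L X o\<^sub>L coord w else 0)" for F
  have Q: "Q F x = (\<Sum>w\<in>F \<inter> D. V (f w) (X (coord w x)))" if "finite F" for F x
    unfolding Q_def using that D
    by (auto simp: blinfun.sum_left inj_op_apply image_subset_iff intro!: sum.cong)
  have lim: "((\<lambda>F. Q F (V w h)) \<longlongrightarrow> (if w \<in> D then V (f w) (X h) else 0)) (finite_subsets_at_top I)"
    if w: "w \<in> I" for w h
  proof (rule tendsto_eventually)
    show "eventually (\<lambda>F. Q F (V w h) = (if w \<in> D then V (f w) (X h) else 0)) (finite_subsets_at_top I)"
      using eventually_mem_finite_subsets[OF w]
    proof eventually_elim
      case (elim F)
      then have "Q F (V w h) = (\<Sum>v\<in>F \<inter> D. V (f v) (X (coord v (V w h))))" by (simp add: Q)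
      also have "\<dots> = (\<Sum>v\<in>F \<inter> D. if v = w then V (f w) (X h) else 0)"
        using w D(1) by (intro sum.cong refl) (auto simp: coord_V subset_iff blinfun.zero_right)
      finally show ?case using elim by simp
    qed
  qed
  have "\<exists>L\<in>bop. norm L \<le> norm X \<and> (\<forall>x. ((\<lambda>F. Q F x) \<longlongrightarrow> blinfun_apply L x) (finite_subsets_at_top I))"
  proof (rule strong_limit_exists)
    show "Q F \<in> bop" for F
      unfolding Q_def using D X by (auto intro!: bop_sum bop_compose inj_op_bop coord_bop)
    show "norm (Q F) \<le> norm X" for F
    proof (cases "finite F")
      case True
      show ?thesis
      proof (rule norm_blinfun_bound)
        fix x
        have "(norm (Q F x))\<^sup>2 = (\<Sum>w\<in>F \<inter> D. (norm (X (coord w x)))\<^sup>2)"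
          unfolding Q[OF True] using D True
          by (intro norm_sum_V_inj) (auto intro: inj_on_subset)
        also have "\<dots> \<le> (\<Sum>w\<in>F \<inter> D. (norm X * norm (coord w x))\<^sup>2)"
          by (intro sum_mono power_mono norm_blinfun) simp
        also have "\<dots> = (norm X * L2_set (\<lambda>w. norm (coord w x)) (F \<inter> D))\<^sup>2"
          by (simp add: power_mult_distrib L2_set_def sum_nonneg sum_distrib_left)
        also have "\<dots> \<le> (norm X * norm x)\<^sup>2"
          using D True by (intro power_mono mult_left_mono bessel) auto
        finally show "norm (Q F x) \<le> norm X * norm x"
          by (rule power2_le_imp_le) simp
      qed simp
    qed (simp add: Q_def)
    show "\<exists>l. ((\<lambda>F. Q F x) \<longlongrightarrow> l) (finite_subsets_at_top I)" if "x \<in> {V w h |w h. w \<in> I}" for x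
      using that lim by blast
  qed (simp, rule dense_V)
  then obtain L where L: "L \<in> bop"
    "\<And>x. ((\<lambda>F. Q F x) \<longlongrightarrow> blinfun_apply L x) (finite_subsets_at_top I)" by blast
  have "L (V w h) = (if w \<in> D then V (f w) (X h) else 0)" if "w \<in> I" for w h
    by (rule tendsto_unique[OF _ L(2) lim[OF that]]) simp
  then show ?thesis using L(1) by blast
qed


subsection \<open>Bounded operator matrices\<close>

text \<open>A bound on the sesquilinear form over finite sections, so that a matrix can be called
  bounded before an operator is known to induce it. Entries are plain functions, which lets Schur
  products be written entrywise.\<close>

definition mat_bdd :: "('i \<Rightarrow> 'i \<Rightarrow> 'e \<Rightarrow> 'e) \<Rightarrow> real \<Rightarrow> bool"
  where "mat_bdd M K \<longleftrightarrow> 0 \<le> K \<and>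
    (\<forall>F x y. finite F \<longrightarrow> F \<subseteq> I \<longrightarrow>
      cmod (\<Sum>w\<in>F. \<Sum>v\<in>F. cinner (M v w (x w)) (y v)) \<le>
        K * (L2_set (\<lambda>w. norm (x w)) F * L2_set (\<lambda>w. norm (y w)) F))"

lemma mat_bddD:
  "mat_bdd M K \<Longrightarrow> finite F \<Longrightarrow> F \<subseteq> I \<Longrightarrow>
      cmod (\<Sum>w\<in>F. \<Sum>v\<in>F. cinner (M v w (x w)) (y v)) \<le>
        K * (L2_set (\<lambda>w. norm (x w)) F * L2_set (\<lambda>w. norm (y w)) F)"
  unfolding mat_bdd_def by blast

lemma cinner_op_sum:
  assumes "F \<subseteq> I"
    and M: "\<And>v w h l. v \<in> I \<Longrightarrow> w \<in> I \<Longrightarrow> cinner (blinfun_apply T (V w h)) (V v l) = cinner (M v w h) l"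
  shows "cinner (T (\<Sum>w\<in>F. V w (x w))) (\<Sum>w\<in>F. V w (y w)) =
    (\<Sum>w\<in>F. \<Sum>v\<in>F. cinner (M v w (x w)) (y v))"
  unfolding blinfun.sum_right
  by (subst cinner_sum_left, rule sum.cong[OF refl], subst cinner_sum_right, rule sum.cong[OF refl])
    (simp add: M subsetD[OF assms(1)])

lemma mat_bdd_entries:
  assumes "\<And>v w h l. v \<in> I \<Longrightarrow> w \<in> I \<Longrightarrow> cinner (blinfun_apply T (V w h)) (V v l) = cinner (M v w h) l"
  shows "mat_bdd M (norm T)"
  unfolding mat_bdd_def
proof (intro conjI allI impI)
  fix F x y assume F: "finite F" "F \<subseteq> I"
  let ?x = "\<Sum>w\<in>F. V w (x w)" and ?y = "\<Sum>w\<in>F. V w (y w)"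
  have "cmod (cinner (T ?x) ?y) \<le> norm (T ?x) * norm ?y" by (rule norm_cinner_le)
  also have "\<dots> \<le> (norm T * norm ?x) * norm ?y"
    by (intro mult_right_mono norm_blinfun) simp
  finally show "cmod (\<Sum>w\<in>F. \<Sum>v\<in>F. cinner (M v w (x w)) (y v)) \<le>
        norm T * (L2_set (\<lambda>w. norm (x w)) F * L2_set (\<lambda>w. norm (y w)) F)"
    by (simp add: cinner_op_sum[OF F(2) assms] norm_sum_V_L2[OF F] mult.assoc)
qed simp

lemma norm_le_mat_bdd:
  assumes "T \<in> bop"
    and M: "\<And>v w h l. v \<in> I \<Longrightarrow> w \<in> I \<Longrightarrow> cinner (blinfun_apply T (V w h)) (V v l) = cinner (M v w h) l"
    and K: "mat_bdd M K"
  shows "norm T \<le> K"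
proof -
  have K0: "K \<ge> 0" using K by (simp add: mat_bdd_def)
  have "cmod (cinner (T x) y) \<le> K * norm x * norm y" for x y
  proof -
    define Q where "Q F z = (\<Sum>w\<in>F. V w (coord w z))" for F z
    have Q: "((\<lambda>F. Q F z) \<longlongrightarrow> z) (finite_subsets_at_top I)" for z
      using has_sum_coord[of z] unfolding has_sum_def Q_def .
    have lim: "((\<lambda>F. cmod (cinner (T (Q F x)) (Q F y))) \<longlongrightarrow> cmod (cinner (T x) y)) (finite_subsets_at_top I)"
      by (intro tendsto_norm bounded_bilinear.tendsto[OF bounded_bilinear_cinner] Q
          bounded_linear.tendsto[OF blinfun.bounded_linear_right])
    show ?thesis
    proof (rule tendsto_upperbound[OF lim])
      show "eventually (\<lambda>F. cmod (cinner (T (Q F x)) (Q F y)) \<le> K * norm x * norm y) (finite_subsets_at_top I)"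
      proof (rule eventually_finite_subsets_at_top_weakI)
        fix F assume F: "finite F" "F \<subseteq> I"
        have "cmod (cinner (T (Q F x)) (Q F y)) \<le>
            K * (L2_set (\<lambda>w. norm (coord w x)) F * L2_set (\<lambda>w. norm (coord w y)) F)"
          unfolding Q_def using mat_bddD[OF K F] by (simp add: cinner_op_sum[OF F(2) M])
        also have "\<dots> \<le> K * (norm x * norm y)"
          by (intro mult_left_mono mult_mono bessel F K0) auto
        finally show "cmod (cinner (T (Q F x)) (Q F y)) \<le> K * norm x * norm y" by simp
      qed
    qed simp
  qed
  then show ?thesis
    by (intro norm_blinfun_bound K0, rule norm_le_of_cinner_le) (simp_all add: K0)
qed

text \<open>The finite sections are bounded by K uniformly, and on a generator they converge to its
  column, a vector by \<open>col\<close>. Their strong limit is the operator.\<close>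

lemma op_of_mat_exists:
  fixes M :: "'i \<Rightarrow> 'i \<Rightarrow> 'e \<Rightarrow>\<^sub>L 'e"
  assumes M: "\<And>v w. v \<in> I \<Longrightarrow> w \<in> I \<Longrightarrow> M v w \<in> bop"
    and bdd: "mat_bdd (\<lambda>v w. blinfun_apply (M v w)) K"
    and col: "\<And>w h. w \<in> I \<Longrightarrow> (\<lambda>v. V v (M v w h)) summable_on I"
  shows "\<exists>T\<in>bop. \<forall>v\<in>I. \<forall>w\<in>I. \<forall>h l.
    cinner (blinfun_apply T (V w h)) (V v l) = cinner (M v w h) l"
proof -
  have K0: "K \<ge> 0" using bdd by (simp add: mat_bdd_def)
  define Q where "Q F = (if finite F \<and> F \<subseteq> I
    then \<Sum>w\<in>F. \<Sum>v\<in>F. inj_op v o\<^sub>L M v w o\<^sub>L coord w else 0)" for F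
  have Q: "Q F x = (\<Sum>w\<in>F. \<Sum>v\<in>F. V v (M v w (coord w x)))" if "finite F" "F \<subseteq> I" for F x
    unfolding Q_def using that
    by (auto simp: blinfun.sum_left inj_op_apply subset_iff intro!: sum.cong)
  define c where "c w h = (\<Sum>\<^sub>\<infinity>v\<in>I. V v (M v w h))" for w h
  have c: "((\<lambda>v. V v (M v w h)) has_sum c w h) I" if "w \<in> I" for w h
    unfolding c_def by (rule has_sum_infsum[OF col[OF that]])
  have lim: "((\<lambda>F. Q F (V w h)) \<longlongrightarrow> c w h) (finite_subsets_at_top I)" if w: "w \<in> I" for w h
  proof (rule Lim_transform_eventually)
    show "(sum (\<lambda>v. V v (M v w h)) \<longlongrightarrow> c w h) (finite_subsets_at_top I)"
      using c[OF w] unfolding has_sum_def .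
    show "eventually (\<lambda>F. (\<Sum>v\<in>F. V v (M v w h)) = Q F (V w h)) (finite_subsets_at_top I)"
      using eventually_mem_finite_subsets[OF w]
    proof eventually_elim
      case (elim F)
      then have "Q F (V w h) = (\<Sum>u\<in>F. \<Sum>v\<in>F. V v (M v u (coord u (V w h))))" by (simp add: Q)
      also have "\<dots> = (\<Sum>u\<in>F. if u = w then \<Sum>v\<in>F. V v (M v w h) else 0)"
        using w elim by (intro sum.cong refl) (auto simp: coord_V subset_iff blinfun.zero_right)
      finally show ?case using elim by simp
    qed
  qed
  have "\<exists>L\<in>bop. norm L \<le> K \<and> (\<forall>x. ((\<lambda>F. Q F x) \<longlongrightarrow> blinfun_apply L x) (finite_subsets_at_top I))"
  proof (rule strong_limit_exists)
    show "Q F \<in> bop" for F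
      unfolding Q_def using M by (auto intro!: bop_sum bop_compose inj_op_bop coord_bop)
    show "norm (Q F) \<le> K" for F
    proof (cases "finite F \<and> F \<subseteq> I")
      case True
      then have F: "finite F" "F \<subseteq> I" by auto
      show ?thesis
      proof (rule norm_blinfun_bound[OF K0], rule norm_le_of_cinner_le)
        fix x y
        have "cinner (Q F x) y = (\<Sum>w\<in>F. \<Sum>v\<in>F. cinner (M v w (coord w x)) (coord v y))"
          unfolding Q[OF F] cinner_sum_left
          using F by (intro sum.cong refl) (auto simp: cinner_V_left)
        then have "cmod (cinner (Q F x) y) \<le>
            K * (L2_set (\<lambda>w. norm (coord w x)) F * L2_set (\<lambda>w. norm (coord w y)) F)"
          using mat_bddD[OF bdd F] by simp
        also have "\<dots> \<le> K * (norm x * norm y)"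
          by (intro mult_left_mono mult_mono bessel F K0) auto
        finally show "cmod (cinner (Q F x) y) \<le> K * norm x * norm y" by simp
      qed (simp_all add: K0)
    qed (auto simp: Q_def K0)
    show "\<exists>l. ((\<lambda>F. Q F x) \<longlongrightarrow> l) (finite_subsets_at_top I)" if "x \<in> {V w h |w h. w \<in> I}" for x
      using that lim by blast
  qed (simp, rule dense_V)
  then obtain L where L: "L \<in> bop"
    "\<And>x. ((\<lambda>F. Q F x) \<longlongrightarrow> blinfun_apply L x) (finite_subsets_at_top I)" by blast
  have "L (V w h) = c w h" if "w \<in> I" for w h
    by (rule tendsto_unique[OF _ L(2) lim[OF that]]) simp
  then have "cinner (L (V w h)) (V v l) = cinner (M v w h) l" if "v \<in> I" "w \<in> I" for v w h l
    using that by (simp add: cinner_V_right coord_has_sum[OF c])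
  then show ?thesis using L(1) by blast
qed

text \<open>The factorisation writes the form of the Schur product at (x, y) as the sum over j of
  the form of \<open>M\<close> at (b_j x, a_j y). Cauchy-Schwarz in j and the row bounds give back
  the original constant. The factorisation may depend on F, so that only finitely many terms occur
  even where a single factorisation for all of I would be infinite.\<close>

lemma mat_bdd_schur:
  assumes M: "mat_bdd M K" and hom: "\<And>v w t h. M v w (t *\<^sub>R h) = t *\<^sub>R M v w h"
    and fac: "\<And>F. finite F \<Longrightarrow> F \<subseteq> I \<Longrightarrow> \<exists>(J :: 'j set) a b. finite J \<and>
      (\<forall>v\<in>F. \<forall>w\<in>F. \<kappa> v w = (\<Sum>j\<in>J. a j v * b j w)) \<and>
      (\<forall>v\<in>F. (\<Sum>j\<in>J. (a j v)\<^sup>2) \<le> 1) \<and> (\<forall>w\<in>F. (\<Sum>j\<in>J. (b j w)\<^sup>2) \<le> 1)"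
  shows "mat_bdd (\<lambda>v w h. \<kappa> v w *\<^sub>R M v w h) K"
  unfolding mat_bdd_def
proof (intro conjI allI impI)
  show K0: "0 \<le> K" using M by (simp add: mat_bdd_def)
  fix F x y assume F: "finite F" "F \<subseteq> I"
  obtain J :: "'j set" and a b where J: "finite J"
    and \<kappa>: "\<And>v w. v \<in> F \<Longrightarrow> w \<in> F \<Longrightarrow> \<kappa> v w = (\<Sum>j\<in>J. a j v * b j w)"
    and a: "\<And>v. v \<in> F \<Longrightarrow> (\<Sum>j\<in>J. (a j v)\<^sup>2) \<le> 1"
    and b: "\<And>w. w \<in> F \<Longrightarrow> (\<Sum>j\<in>J. (b j w)\<^sup>2) \<le> 1"
    using fac[OF F] by blast
  let ?L = "\<lambda>c z. L2_set (\<lambda>w. norm (c w *\<^sub>R z w)) F"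
  \<comment> \<open>Exchanging the sums over j and w exposes the squared row norm of c at each w,
    which is at most 1.\<close>
  have L2: "L2_set (\<lambda>j. ?L (c j) z) J \<le> L2_set (\<lambda>w. norm (z w)) F"
    if c: "\<And>w. w \<in> F \<Longrightarrow> (\<Sum>j\<in>J. (c j w)\<^sup>2) \<le> 1" for c :: "'j \<Rightarrow> 'i \<Rightarrow> real" and z :: "'i \<Rightarrow> 'e"
  proof -
    have "(\<Sum>j\<in>J. (?L (c j) z)\<^sup>2) = (\<Sum>j\<in>J. \<Sum>w\<in>F. (c j w)\<^sup>2 * (norm (z w))\<^sup>2)"
      by (simp add: L2_set_def sum_nonneg power_mult_distrib)
    also have "\<dots> = (\<Sum>w\<in>F. (\<Sum>j\<in>J. (c j w)\<^sup>2) * (norm (z w))\<^sup>2)"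
      by (subst sum.swap) (simp add: sum_distrib_right)
    also have "\<dots> \<le> (\<Sum>w\<in>F. 1 * (norm (z w))\<^sup>2)"
      by (intro sum_mono mult_right_mono c) auto
    finally show ?thesis unfolding L2_set_def[of _ J] L2_set_def[of "\<lambda>w. norm (z w)"]
      by (intro real_sqrt_le_mono) simp
  qed
  have "(\<Sum>w\<in>F. \<Sum>v\<in>F. cinner (\<kappa> v w *\<^sub>R M v w (x w)) (y v)) =
      (\<Sum>w\<in>F. \<Sum>v\<in>F. \<Sum>j\<in>J. cinner (M v w (b j w *\<^sub>R x w)) (a j v *\<^sub>R y v))"
    by (intro sum.cong refl)
      (simp add: \<kappa> hom cinner_scaleR_left cinner_scaleR_right sum_distrib_left sum_distrib_right ac_simps)
  also have "\<dots> = (\<Sum>w\<in>F. \<Sum>j\<in>J. \<Sum>v\<in>F. cinner (M v w (b j w *\<^sub>R x w)) (a j v *\<^sub>R y v))"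
    by (intro sum.cong refl sum.swap)
  also have "\<dots> = (\<Sum>j\<in>J. \<Sum>w\<in>F. \<Sum>v\<in>F. cinner (M v w (b j w *\<^sub>R x w)) (a j v *\<^sub>R y v))"
    by (rule sum.swap)
  finally have "cmod (\<Sum>w\<in>F. \<Sum>v\<in>F. cinner (\<kappa> v w *\<^sub>R M v w (x w)) (y v)) \<le>
      (\<Sum>j\<in>J. cmod (\<Sum>w\<in>F. \<Sum>v\<in>F. cinner (M v w (b j w *\<^sub>R x w)) (a j v *\<^sub>R y v)))"
    by (simp add: norm_sum)
  also have "\<dots> \<le> (\<Sum>j\<in>J. K * (?L (b j) x * ?L (a j) y))"
    by (intro sum_mono mat_bddD[OF M F])
  also have "\<dots> = K * (\<Sum>j\<in>J. \<bar>?L (b j) x\<bar> * \<bar>?L (a j) y\<bar>)"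
    by (simp only: sum_distrib_left abs_of_nonneg[OF L2_set_nonneg])
  also have "\<dots> \<le> K * (L2_set (\<lambda>j. ?L (b j) x) J * L2_set (\<lambda>j. ?L (a j) y) J)"
    by (intro mult_left_mono L2_set_mult_ineq K0)
  also have "\<dots> \<le> K * (L2_set (\<lambda>w. norm (x w)) F * L2_set (\<lambda>w. norm (y w)) F)"
    by (intro mult_left_mono mult_mono L2 a b K0 L2_set_nonneg)
  finally show "cmod (\<Sum>w\<in>F. \<Sum>v\<in>F. cinner (\<kappa> v w *\<^sub>R M v w (x w)) (y v)) \<le>
      K * (L2_set (\<lambda>w. norm (x w)) F * L2_set (\<lambda>w. norm (y w)) F)" .
qed

end

subsection \<open>Iterated series over the integers\<close>

lemma int_sums_unique: "int_sums f s \<Longrightarrow> int_sums f t \<Longrightarrow> s = t"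
  unfolding int_sums_def by (metis sums_unique2)

lemma iter_sums_unique: "iter_sums ks f s \<Longrightarrow> iter_sums ks f t \<Longrightarrow> s = t"
proof (induction ks arbitrary: f s t)
  case (Cons i ks)
  then obtain g g' where g: "\<And>z. iter_sums ks (\<lambda>m. f (m(i := z))) (g z)" "int_sums g s"
    and g': "\<And>z. iter_sums ks (\<lambda>m. f (m(i := z))) (g' z)" "int_sums g' t"
    by (metis iter_sums.simps(2))
  have "g z = g' z" for z by (rule Cons.IH[OF g(1) g'(1)])
  then have "g = g'" by blast
  then show ?case using int_sums_unique g(2) g'(2) by blast
qed simp

lemma int_sums_of_has_sum:
  fixes f :: "int \<Rightarrow> 'v::banach"
  assumes "(f has_sum s) UNIV"
  shows "int_sums f s"
proof -
  have s: "f summable_on UNIV" using assms summable_on_def by blast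
  have "f summable_on {..<0}" "f summable_on {0..}"
    by (rule summable_on_subset_banach[OF s], simp)+
  then obtain a b where ab: "(f has_sum a) {..<0}" "(f has_sum b) {0..}"
    by (auto simp: summable_on_def)
  have "(f has_sum (a + b)) ({..<0} \<union> {0..})"
    by (rule has_sum_Un_disjoint[OF ab]) auto
  moreover have "{..<0} \<union> {0..} = (UNIV :: int set)" by auto
  ultimately have "s = a + b" using assms has_sum_unique by metis
  moreover have "bij_betw (\<lambda>p. - int (Suc p)) UNIV {..<0}"
    by (rule bij_betwI[where g = "\<lambda>z. nat (- z) - 1"]) auto
  then have "((\<lambda>p. f (- int (Suc p))) has_sum a) UNIV"
    by (subst has_sum_reindex_bij_betw) (use ab in auto)
  moreover have "bij_betw int UNIV {0..}"
    by (rule bij_betwI[where g = nat]) auto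
  then have "((\<lambda>p. f (int p)) has_sum b) UNIV"
    by (subst has_sum_reindex_bij_betw) (use ab in auto)
  ultimately show ?thesis
    unfolding int_sums_def using has_sum_imp_sums by blast
qed

lemma bij_betw_fun_upd_multi:
  assumes "i \<notin> J"
  shows "bij_betw (\<lambda>(z, m). m(i := z)) (UNIV \<times> {m. \<forall>j. j \<notin> J \<longrightarrow> m j = 0})
    {m :: nat \<Rightarrow> int. \<forall>j. j \<notin> insert i J \<longrightarrow> m j = 0}"
  by (rule bij_betwI[where g = "\<lambda>m. (m i, m(i := 0))"]) (use assms in \<open>auto simp: fun_eq_iff\<close>)

text \<open>Unconditional convergence permits summation one coordinate at a time, and completeness
  makes every slice summable. As nothing is assumed about the order of \<open>ks\<close>, the
  independence of the order of the series comes from here.\<close>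

lemma iter_sums_of_has_sum:
  fixes f :: "(nat \<Rightarrow> int) \<Rightarrow> 'v::banach"
  assumes "distinct ks" "(f has_sum s) {m. \<forall>j. j \<notin> set ks \<longrightarrow> m j = 0}"
  shows "iter_sums ks f s"
  using assms
proof (induction ks arbitrary: f s)
  case Nil
  have eq: "{m. \<forall>j. j \<notin> set [] \<longrightarrow> m j = (0::int)} = {\<lambda>_. 0}" by auto
  from Nil.prems(2)[unfolded eq] show ?case by (simp add: has_sum_finite_iff)
next
  case (Cons i ks)
  let ?m = "{m. \<forall>j. j \<notin> set ks \<longrightarrow> m j = (0::int)}"
  have "((\<lambda>x. f (case x of (z, m) \<Rightarrow> m(i := z))) has_sum s) (UNIV \<times> ?m)"
    using Cons.prems has_sum_reindex_bij_betw[OF bij_betw_fun_upd_multi[of i "set ks"], of f s]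
    by simp
  then have hs: "((\<lambda>(z, m). f (m(i := z))) has_sum s) (UNIV \<times> ?m)"
    by (simp add: case_prod_unfold)
  have "(\<lambda>m. f (m(i := z))) summable_on ?m" for z
  proof -
    have "(\<lambda>(z, m). f (m(i := z))) summable_on ({z} \<times> ?m)"
      by (rule summable_on_subset_banach[OF has_sum_imp_summable[OF hs]]) auto
    moreover have "bij_betw (Pair z) ?m ({z} \<times> ?m)"
      by (auto simp: bij_betw_def inj_on_def)
    ultimately show ?thesis
      using summable_on_reindex_bij_betw[of "Pair z" ?m "{z} \<times> ?m" "\<lambda>(z, m). f (m(i := z))"] by simp
  qed
  then have sm: "((\<lambda>m. f (m(i := z))) has_sum infsum (\<lambda>m. f (m(i := z))) ?m) ?m" for z
    by (rule has_sum_infsum)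
  have "((\<lambda>z. infsum (\<lambda>m. f (m(i := z))) ?m) has_sum s) UNIV"
    by (rule has_sum_SigmaD[OF hs]) (use sm in simp)
  then show ?case
    unfolding iter_sums.simps
    using Cons.IH[OF _ sm] Cons.prems(1) int_sums_of_has_sum
    by (intro exI[of _ "\<lambda>z. infsum (\<lambda>m. f (m(i := z))) ?m"]) (auto simp del: fun_upd_apply)
qed

lemma multi_ints_eq: "multi_ints k = {m. \<forall>j. j \<notin> {1..k} \<longrightarrow> m j = 0}"
  unfolding multi_ints_def ..

lemma iter_sums_multi_ints:
  fixes f :: "(nat \<Rightarrow> int) \<Rightarrow> 'v::banach"
  assumes "(f has_sum s) (multi_ints k)" "distinct ks" "set ks = {1..k}"
  shows "iter_sums ks f s"
  by (rule iter_sums_of_has_sum[OF assms(2)]) (use assms in \<open>simp only: multi_ints_eq\<close>)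

text \<open>Evaluates \<open>phi_op\<close> and \<open>phi_vec\<close>, which are definite
  descriptions of iterated sums: unconditional convergence gives existence, and limits of iterated
  series are unique.\<close>

lemma iter_sums_eq_multi_ints:
  fixes f :: "(nat \<Rightarrow> int) \<Rightarrow> 'v::banach"
  assumes "(f has_sum s) (multi_ints k)"
  shows "(THE x. iter_sums [1..<Suc k] f x) = s"
proof (rule the_equality)
  show "iter_sums [1..<Suc k] f s"
    by (rule iter_sums_multi_ints[OF assms]) auto
  then show "x = s" if "iter_sums [1..<Suc k] f x" for x
    using iter_sums_unique that by blast
qed

lemma summable_on_geometric_int:
  fixes r :: real
  assumes "0 \<le> r" "r < 1"
  shows "(\<lambda>z. r ^ nat \<bar>z\<bar>) summable_on UNIV"
proof -
  have s: "(\<lambda>p. r ^ p) summable_on UNIV"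
    using assms by (intro norm_summable_imp_summable_on) simp
  have b1: "bij_betw (\<lambda>p. - int p) UNIV {..0}"
    by (rule bij_betwI[where g = "\<lambda>z. nat (- z)"]) auto
  have b2: "bij_betw int UNIV {0..}"
    by (rule bij_betwI[where g = nat]) auto
  have "(\<lambda>z. r ^ nat \<bar>z\<bar>) summable_on {..0}"
    using s summable_on_reindex_bij_betw[OF b1, of "\<lambda>z. r ^ nat \<bar>z\<bar>"] by simp
  moreover have "(\<lambda>z. r ^ nat \<bar>z\<bar>) summable_on {0..}"
    using s summable_on_reindex_bij_betw[OF b2, of "\<lambda>z. r ^ nat \<bar>z\<bar>"] by simp
  ultimately have "(\<lambda>z. r ^ nat \<bar>z\<bar>) summable_on ({..0} \<union> {0..})"
    by (rule summable_on_union)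
  moreover have "{..0} \<union> {0..} = (UNIV :: int set)" by auto
  ultimately show ?thesis by simp
qed

text \<open>A product of two-sided geometric series, one per index. It serves as the majorant of the
  norms of the homogeneous parts.\<close>

lemma summable_on_geometric_multi:
  fixes r :: real
  assumes "0 \<le> r" "r < 1" "finite J"
  shows "(\<lambda>m. r ^ (\<Sum>i\<in>J. nat \<bar>m i\<bar>)) summable_on {m :: nat \<Rightarrow> int. \<forall>j. j \<notin> J \<longrightarrow> m j = 0}"
  using \<open>finite J\<close>
proof (induction J rule: finite_induct)
  case empty
  have "{m :: nat \<Rightarrow> int. \<forall>j. j \<notin> {} \<longrightarrow> m j = 0} = {\<lambda>_. 0}" by auto
  then show ?case by simp
next
  case (insert i J)
  let ?m = "{m :: nat \<Rightarrow> int. \<forall>j. j \<notin> J \<longrightarrow> m j = 0}"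
  let ?f = "\<lambda>m. r ^ (\<Sum>i\<in>J. nat \<bar>m i\<bar>)"
  have "(\<lambda>x. r ^ nat \<bar>fst x\<bar> * ?f (snd x)) summable_on (UNIV \<times> ?m)"
  proof (rule summable_on_SigmaI)
    show "((\<lambda>m. r ^ nat \<bar>fst (z, m)\<bar> * ?f (snd (z, m))) has_sum r ^ nat \<bar>z\<bar> * infsum ?f ?m) ?m" for z
      using has_sum_cmult_right[OF has_sum_infsum[OF insert.IH], of "r ^ nat \<bar>z\<bar>"] by simp
    show "(\<lambda>z. r ^ nat \<bar>z\<bar> * infsum ?f ?m) summable_on UNIV"
      by (intro summable_on_cmult_left summable_on_geometric_int assms)
  qed (use assms in simp)
  also have "?this \<longleftrightarrow> (\<lambda>x. (\<lambda>m. r ^ (\<Sum>i\<in>insert i J. nat \<bar>m i\<bar>)) (case x of (z, m) \<Rightarrow> m(i := z)))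
      summable_on (UNIV \<times> ?m)"
  proof (intro summable_on_cong, clarify)
    fix z m assume "\<forall>j. j \<notin> J \<longrightarrow> m j = (0::int)"
    have "(\<Sum>j\<in>J. nat \<bar>(m(i := z)) j\<bar>) = (\<Sum>j\<in>J. nat \<bar>m j\<bar>)"
      using insert.hyps by (intro sum.cong) auto
    then show "r ^ nat \<bar>fst (z, m)\<bar> * ?f (snd (z, m)) = r ^ (\<Sum>j\<in>insert i J. nat \<bar>(m(i := z)) j\<bar>)"
      using insert.hyps by (simp add: power_add)
  qed
  finally show ?case
    by (subst (asm) summable_on_reindex_bij_betw[OF bij_betw_fun_upd_multi[OF insert.hyps(2)]])
qed

lemma has_sum_sum_index:
  fixes f :: "'j \<Rightarrow> 'i \<Rightarrow> 'v::real_normed_vector"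
  assumes "\<And>j. j \<in> F \<Longrightarrow> (f j has_sum s j) A"
  shows "((\<lambda>i. \<Sum>j\<in>F. f j i) has_sum (\<Sum>j\<in>F. s j)) A"
  using assms
  by (induction F rule: infinite_finite_induct) (auto intro: has_sum_add)

lemma eventually_at_left_one: "eventually (\<lambda>r::real. 0 \<le> r \<and> r < 1) (at_left 1)"
  using eventually_at_left_real[of 0 "1::real"] by (rule eventually_mono) auto

lemma closed_has_sum_mem:
  fixes f :: "'i \<Rightarrow> 'v::real_normed_vector"
  assumes "(f has_sum s) A" "closed S" "0 \<in> S" "\<And>x y. x \<in> S \<Longrightarrow> y \<in> S \<Longrightarrow> x + y \<in> S"
    and "\<And>i. i \<in> A \<Longrightarrow> f i \<in> S"
  shows "s \<in> S"
proof (rule Lim_in_closed_set[OF assms(2)])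
  show "(sum f \<longlongrightarrow> s) (finite_subsets_at_top A)" using assms(1) unfolding has_sum_def .
  show "eventually (\<lambda>F. sum f F \<in> S) (finite_subsets_at_top A)"
  proof (rule eventually_finite_subsets_at_top_weakI)
    fix F assume "finite F" "F \<subseteq> A"
    then show "sum f F \<in> S"
      by (induction F rule: finite_induct) (use assms in auto)
  qed
qed simp


subsection \<open>Contractive Schur multipliers\<close>

text \<open>Square root of the Gram matrix \<open>r\<^bsup>|p - q|\<^esup>\<close>: the row \<open>p\<close> is the state at
  time \<open>p\<close> of the stationary autoregressive process \<open>x\<^bsub>p+1\<^esub> = r x\<^sub>p + \<surd>(1 - r\<^sup>2) \<xi>\<^bsub>p+1\<^esub>\<close> expressed in
  its innovations.\<close>

definition ar_row :: "real \<Rightarrow> nat \<Rightarrow> nat \<Rightarrow> real"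
  where "ar_row r p j = (if j \<le> p then r ^ (p - j) * (if j = 0 then 1 else sqrt (1 - r\<^sup>2)) else 0)"

lemma ar_row_Suc: "j \<le> p \<Longrightarrow> ar_row r (Suc p) j = r * ar_row r p j"
  by (simp add: ar_row_def Suc_diff_le)

text \<open>Stationarity of the process: a state of variance 1 has a successor of variance r^2 + (1
  - r^2) = 1.\<close>

lemma ar_row_norm:
  assumes "r\<^sup>2 \<le> 1"
  shows "(\<Sum>j\<le>p. (ar_row r p j)\<^sup>2) = 1"
proof (induction p)
  case (Suc p)
  have "(\<Sum>j\<le>p. (ar_row r (Suc p) j)\<^sup>2) = r\<^sup>2 * (\<Sum>j\<le>p. (ar_row r p j)\<^sup>2)"
    unfolding sum_distrib_left by (intro sum.cong) (auto simp: ar_row_Suc power_mult_distrib)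
  moreover have "(ar_row r (Suc p) (Suc p))\<^sup>2 = 1 - r\<^sup>2"
    using assms by (simp add: ar_row_def)
  ultimately show ?case using Suc.IH by simp
qed (simp add: ar_row_def)

text \<open>Innovations after time p are uncorrelated with the state at time p, and the earlier part
  of the state at time q is r^(q - p) times that state. The bound \<open>N\<close> only has to cover
  both times; it provides one index set for a whole finite section.\<close>

lemma ar_row_gram_le:
  assumes "r\<^sup>2 \<le> 1" "p \<le> q" "q \<le> N"
  shows "(\<Sum>j\<le>N. ar_row r p j * ar_row r q j) = r ^ (q - p)"
proof -
  have "(\<Sum>j\<le>N. ar_row r p j * ar_row r q j) = (\<Sum>j\<le>p. ar_row r p j * ar_row r q j)"
    using assms by (intro sum.mono_neutral_right) (auto simp: ar_row_def)
  also have "\<dots> = (\<Sum>j\<le>p. r ^ (q - p) * (ar_row r p j)\<^sup>2)"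
  proof (intro sum.cong refl)
    fix j assume "j \<in> {..p}"
    then have "q - j = (q - p) + (p - j)" using assms by auto
    then have "r ^ (q - j) = r ^ (q - p) * r ^ (p - j)" by (simp add: power_add)
    then show "ar_row r p j * ar_row r q j = r ^ (q - p) * (ar_row r p j)\<^sup>2"
      using \<open>j \<in> {..p}\<close> assms by (simp add: ar_row_def power2_eq_square)
  qed
  also have "\<dots> = r ^ (q - p)"
    by (simp add: ar_row_norm[OF assms(1)] flip: sum_distrib_left)
  finally show ?thesis .
qed

lemma ar_row_gram:
  assumes "r\<^sup>2 \<le> 1" "p \<le> N" "q \<le> N"
  shows "(\<Sum>j\<le>N. ar_row r p j * ar_row r q j) = r ^ nat \<bar>int q - int p\<bar>"
proof (cases "p \<le> q")
  case True
  then show ?thesis using ar_row_gram_le[OF assms(1) True assms(3)]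
    by (simp add: nat_diff_distrib)
next
  case False
  then have "(\<Sum>j\<le>N. ar_row r q j * ar_row r p j) = r ^ (p - q)"
    using assms by (intro ar_row_gram_le) auto
  moreover have "nat \<bar>int q - int p\<bar> = p - q" using False by simp
  ultimately show ?thesis by (simp only: mult.commute)
qed

context hilbert_sum
begin

text \<open>The kernel is the inner product of the unit vectors at m + D v and at D w in the square
  summable families over the integer tuples. Coordinates outside the image of F under D do not
  contribute, so a finite set is enough.\<close>

lemma mat_bdd_diagonal:
  fixes D :: "'i \<Rightarrow> nat \<Rightarrow> int"
  assumes M: "mat_bdd M K" and hom: "\<And>v w t h. M v w (t *\<^sub>R h) = t *\<^sub>R M v w h"
  shows "mat_bdd (\<lambda>v w h. of_bool ((\<lambda>i. D w i - D v i) = m) *\<^sub>R M v w h) K"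
proof (rule mat_bdd_schur[OF M hom])
  fix F :: "'i set" assume F: "finite F" "F \<subseteq> I"
  let ?a = "\<lambda>j v. of_bool (j = (\<lambda>i. m i + D v i)) :: real"
  let ?b = "\<lambda>j w. of_bool (j = D w) :: real"
  have J: "finite (D ` F)" using F by simp
  have fin: "(\<Sum>j\<in>D ` F. of_bool (j = u) * of_bool (j = D w) :: real) = of_bool (D w = u)"
    if "w \<in> F" for u w
  proof -
    have "(\<Sum>j\<in>D ` F. of_bool (j = u) * of_bool (j = D w) :: real) =
        (\<Sum>j\<in>D ` F. if j = D w then of_bool (D w = u) else 0)"
      by (intro sum.cong) auto
    then show ?thesis using that J by simp
  qed
  have le: "(\<Sum>j\<in>D ` F. (of_bool (j = u) :: real)\<^sup>2) \<le> 1" for u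
  proof -
    have "(\<Sum>j\<in>D ` F. (of_bool (j = u) :: real)\<^sup>2) = (\<Sum>j\<in>D ` F. if j = u then 1 else 0)"
      by (intro sum.cong) auto
    then show ?thesis using J by simp
  qed
  have eq: "(\<lambda>i. D w i - D v i) = m \<longleftrightarrow> D w = (\<lambda>i. m i + D v i)" for v w
    by (auto simp: fun_eq_iff algebra_simps)
  have f1: "\<forall>v\<in>F. \<forall>w\<in>F. of_bool ((\<lambda>i. D w i - D v i) = m) = (\<Sum>j\<in>D ` F. ?a j v * ?b j w)"
    by (intro ballI) (simp only: eq fin)
  have f2: "\<forall>v\<in>F. (\<Sum>j\<in>D ` F. (?a j v)\<^sup>2) \<le> 1"
    and f3: "\<forall>w\<in>F. (\<Sum>j\<in>D ` F. (?b j w)\<^sup>2) \<le> 1"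
    using le by blast+
  show "\<exists>(J :: (nat \<Rightarrow> int) set) a b. finite J \<and>
      (\<forall>v\<in>F. \<forall>w\<in>F. (of_bool ((\<lambda>i. D w i - D v i) = m) :: real) = (\<Sum>j\<in>J. a j v * b j w)) \<and>
      (\<forall>v\<in>F. (\<Sum>j\<in>J. (a j v)\<^sup>2) \<le> 1) \<and> (\<forall>w\<in>F. (\<Sum>j\<in>J. (b j w)\<^sup>2) \<le> 1)"
    by (rule exI[of _ "D ` F"], rule exI[of _ ?a], rule exI[of _ ?b]) (intro conjI J f1 f2 f3)
qed

text \<open>The kernel is the Gram matrix of the unit vectors \<open>ar_row r (d v)\<close>,
  truncated at the largest degree that occurs in F.\<close>

lemma mat_bdd_power:
  fixes d :: "'i \<Rightarrow> nat"
  assumes M: "mat_bdd M K" and hom: "\<And>v w t h. M v w (t *\<^sub>R h) = t *\<^sub>R M v w h"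
    and r: "r\<^sup>2 \<le> 1"
  shows "mat_bdd (\<lambda>v w h. r ^ nat \<bar>int (d w) - int (d v)\<bar> *\<^sub>R M v w h) K"
proof (rule mat_bdd_schur[OF M hom])
  fix F :: "'i set" assume F: "finite F" "F \<subseteq> I"
  define N where "N = Max (d ` F)"
  have N: "d w \<le> N" if "w \<in> F" for w
    unfolding N_def using that F by (intro Max_ge) auto
  let ?a = "\<lambda>j v. ar_row r (d v) j"
  have g: "r ^ nat \<bar>int (d w) - int (d v)\<bar> = (\<Sum>j\<le>N. ?a j v * ?a j w)" if "v \<in> F" "w \<in> F" for v w
    using that by (simp add: ar_row_gram[OF r N N])
  have "(\<Sum>j\<le>N. (?a j v)\<^sup>2) \<le> 1" if "v \<in> F" for v
    using g[OF that that] by (simp add: power2_eq_square)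
  with g show "\<exists>(J :: nat set) a b. finite J \<and>
      (\<forall>v\<in>F. \<forall>w\<in>F. r ^ nat \<bar>int (d w) - int (d v)\<bar> = (\<Sum>j\<in>J. a j v * b j w)) \<and>
      (\<forall>v\<in>F. (\<Sum>j\<in>J. (a j v)\<^sup>2) \<le> 1) \<and> (\<forall>w\<in>F. (\<Sum>j\<in>J. (b j w)\<^sup>2) \<le> 1)"
    by (intro exI[of _ "{..N}"] exI[of _ ?a]) blast
qed

text \<open>Schur multipliers compose, so the indices can be treated one at a time and each leaves
  the constant unchanged.\<close>

lemma mat_bdd_powers:
  fixes d :: "'i \<Rightarrow> nat \<Rightarrow> nat"
  assumes M: "mat_bdd M K" and hom: "\<And>v w t h. M v w (t *\<^sub>R h) = t *\<^sub>R M v w h"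
    and r: "r\<^sup>2 \<le> 1" and "finite J"
  shows "mat_bdd (\<lambda>v w h. r ^ (\<Sum>i\<in>J. nat \<bar>int (d w i) - int (d v i)\<bar>) *\<^sub>R M v w h) K"
  using \<open>finite J\<close>
proof (induction J rule: finite_induct)
  case (insert i J)
  show ?case
    using mat_bdd_power[OF insert.IH _ r, of "\<lambda>w. d w i"] insert.hyps
    by (simp add: hom power_add)
qed (simp add: M)

end

subsection \<open>Words\<close>

lemma rquot_append [simp]: "rquot (\<sigma> @ \<gamma>) \<gamma> = \<sigma>"
  unfolding rquot_def by (rule the_equality) auto

lemma mwords_appendI: "\<alpha> \<in> mwords k n \<Longrightarrow> w \<in> mwords k n \<Longrightarrow> (\<lambda>i. \<alpha> i @ w i) \<in> mwords k n"
  unfolding mwords_def by auto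

lemma mwords_dropI: "w \<in> mwords k n \<Longrightarrow> (\<lambda>i. drop (L i) (w i)) \<in> mwords k n"
  unfolding mwords_def by (auto dest!: in_set_dropD)

lemma mwords_outside: "w \<in> mwords k n \<Longrightarrow> i \<notin> {1..k} \<Longrightarrow> w i = []"
  unfolding mwords_def by blast

lemma mwords_letters: "w \<in> mwords k n \<Longrightarrow> i \<in> {1..k} \<Longrightarrow> set (w i) \<subseteq> {1..n i}"
  unfolding mwords_def by blast

lemma mwords_upd:
  "w \<in> mwords k n \<Longrightarrow> i \<in> {1..k} \<Longrightarrow> set x \<subseteq> {1..n i} \<Longrightarrow> w(i := x) \<in> mwords k n"
  unfolding mwords_def by auto

lemma finite_mwords_length: "finite {w \<in> mwords k n. \<forall>i\<in>{1..k}. length (w i) = L i}"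
proof -
  let ?B = "\<Union>i\<in>{1..k}. {xs. set xs \<subseteq> {1..n i} \<and> length xs = L i}"
  have "finite ?B" by (intro finite_UN_I finite_lists_length_eq) auto
  then have fin: "finite {w. \<forall>i. (i \<in> {1..k} \<longrightarrow> w i \<in> ?B) \<and> (i \<notin> {1..k} \<longrightarrow> w i = [])}"
    by (intro finite_set_of_finite_funs) auto
  have mem: "w i \<in> ?B" if "w \<in> mwords k n" "\<forall>i\<in>{1..k}. length (w i) = L i" "i \<in> {1..k}" for w i
    using that mwords_letters[OF that(1,3)] by blast
  show ?thesis
    by (rule finite_subset[OF _ fin]) (use mem mwords_outside in blast)
qed

text \<open>Column length minus row length: with this sign the monomial with words \<alpha>, \<beta>
  of multidegree m sends the basis vector of w to one of a word v with
  \<open>deg_diff v w = m\<close>, or to zero.\<close>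

definition deg_diff :: "mword \<Rightarrow> mword \<Rightarrow> nat \<Rightarrow> int"
  where "deg_diff v w = (\<lambda>i. int (length (w i)) - int (length (v i)))"

definition weight :: "nat \<Rightarrow> (nat \<Rightarrow> int) \<Rightarrow> nat"
  where "weight k m = (\<Sum>i=1..k. nat \<bar>m i\<bar>)"

lemma deg_diff_multi_ints: "v \<in> mwords k n \<Longrightarrow> w \<in> mwords k n \<Longrightarrow> deg_diff v w \<in> multi_ints k"
  by (auto simp: multi_ints_def deg_diff_def mwords_outside)

lemma finite_deg_diff: "finite {v \<in> mwords k n. deg_diff v w = m}"
  by (rule finite_subset[OF _ finite_mwords_length[of k n "\<lambda>i. nat (int (length (w i)) - m i)"]])
    (auto simp: deg_diff_def)

lemma finite_word_pairs: "finite (word_pairs k n m)"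
proof -
  let ?A = "\<lambda>s. {w \<in> mwords k n. \<forall>i\<in>{1..k}. length (w i) = nat (max (s * m i) 0)}"
  have "word_pairs k n m \<subseteq> ?A (-1) \<times> ?A 1"
    unfolding word_pairs_def by fastforce
  then show ?thesis
    by (rule finite_subset) (intro finite_cartesian_product finite_mwords_length)
qed

lemma word_pairs_mwords: "(\<alpha>, \<beta>) \<in> word_pairs k n m \<Longrightarrow> \<alpha> \<in> mwords k n \<and> \<beta> \<in> mwords k n"
  unfolding word_pairs_def by blast

lemma word_pairs_weight:
  assumes "(\<alpha>, \<beta>) \<in> word_pairs k n m"
  shows "(\<Sum>i=1..k. length (\<alpha> i) + length (\<beta> i)) = weight k m"
  unfolding weight_def
proof (intro sum.cong refl)
  fix i assume "i \<in> {1..k}"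
  then have "int (length (\<alpha> i)) = max (- m i) 0" "int (length (\<beta> i)) = max (m i) 0"
    using assms unfolding word_pairs_def by auto
  then show "length (\<alpha> i) + length (\<beta> i) = nat \<bar>m i\<bar>" by (auto simp: max_def split: if_splits)
qed

text \<open>\<open>S\<^sub>\<alpha> S\<^sub>\<beta>\<^sup>*\<close> maps the basis vector of \<open>w\<close> to the one of \<open>v\<close> iff
  \<open>w = \<beta> u\<close> and \<open>v = \<alpha> u\<close>, which determines \<open>\<alpha>\<close> and \<open>\<beta>\<close> as the two quotients.\<close>

definition word_acts :: "mword \<Rightarrow> mword \<Rightarrow> bool"
  where "word_acts \<beta> w \<longleftrightarrow> (\<forall>i. prefix (\<beta> i) (w i))"

definition word_act :: "mword \<Rightarrow> mword \<Rightarrow> mword \<Rightarrow> mword"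
  where "word_act \<alpha> \<beta> w = (\<lambda>i. \<alpha> i @ drop (length (\<beta> i)) (w i))"

text \<open>The claim is checked at each index separately. One of \<open>\<alpha> i\<close>,
  \<open>\<beta> i\<close> is empty, so the common remainder u is the shorter of \<open>v i\<close>
  and \<open>w i\<close>, and the other word of the pair is the right quotient of the longer by the
  shorter.\<close>

lemma word_acts_iff:
  assumes v: "v \<in> mwords k n" and w: "w \<in> mwords k n"
    and ab: "(\<alpha>, \<beta>) \<in> word_pairs k n m" and m: "m \<in> multi_ints k"
  shows "word_acts \<beta> w \<and> word_act \<alpha> \<beta> w = v \<longleftrightarrow>
    comparable_rc k v w \<and> deg_diff v w = m \<and> \<alpha> = cr_plus v w \<and> \<beta> = cr_minus v w"
proof -
  have out: "v i = []" "w i = []" "\<alpha> i = []" "\<beta> i = []" "m i = 0" if "i \<notin> {1..k}" for i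
    using that v w ab m by (auto simp: mwords_outside word_pairs_def multi_ints_def)
  have len: "int (length (\<alpha> i)) = max (- m i) 0" "int (length (\<beta> i)) = max (m i) 0" for i
    using ab out[of i] by (cases "i \<in> {1..k}", auto simp: word_pairs_def)+
  have nil: "\<alpha> i = [] \<or> \<beta> i = []" for i
    using len[of i] by (cases "m i \<ge> 0") auto
  have pointwise: "prefix b y \<and> a @ drop (length b) y = x \<longleftrightarrow>
      (strict_suffix x y \<or> strict_suffix y x \<or> x = y) \<and> int (length y) - int (length x) = z \<and>
      a = (if strict_suffix y x then rquot x y else []) \<and>
      b = (if strict_suffix x y then rquot y x else [])"
    if nl: "a = [] \<or> b = []" and la: "int (length a) = max (- z) 0" and lb: "int (length b) = max z 0"
    for a b x y :: "nat list" and z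
  proof (intro iffI; elim conjE)
    assume "prefix b y" "a @ drop (length b) y = x"
    then obtain u where u: "y = b @ u" "x = a @ u" by (auto elim: prefixE)
    consider "a = []" "b = []" | "a = []" "b \<noteq> []" | "a \<noteq> []" "b = []" using nl by blast
    then show "(strict_suffix x y \<or> strict_suffix y x \<or> x = y) \<and> int (length y) - int (length x) = z \<and>
      a = (if strict_suffix y x then rquot x y else []) \<and>
      b = (if strict_suffix x y then rquot y x else [])"
    proof cases
      case 1
      then show ?thesis using u la lb by auto
    next
      case 2
      then have s: "strict_suffix x y" using u by (simp add: strict_suffix_def suffix_def)
      moreover have "\<not> strict_suffix y x" using s by (rule suffix_order.less_not_sym)
      ultimately show ?thesis using u 2 la lb by (auto simp: max_def split: if_splits)
    next
      case 3
      then have s: "strict_suffix y x" using u by (simp add: strict_suffix_def suffix_def)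
      moreover have "\<not> strict_suffix x y" using s by (rule suffix_order.less_not_sym)
      ultimately show ?thesis using u 3 la lb by (auto simp: max_def split: if_splits)
    qed
  next
    assume cmp: "strict_suffix x y \<or> strict_suffix y x \<or> x = y"
      and "a = (if strict_suffix y x then rquot x y else [])"
      and "b = (if strict_suffix x y then rquot y x else [])"
    then show "prefix b y \<and> a @ drop (length b) y = x"
    proof (elim disjE)
      assume s: "strict_suffix x y"
      then obtain u where "y = u @ x" "u \<noteq> []" by (auto simp: strict_suffix_def suffix_def)
      moreover have "\<not> strict_suffix y x" using s by (rule suffix_order.less_not_sym)
      ultimately show ?thesis
        using s \<open>a = _\<close> \<open>b = _\<close> by simp
    next
      assume s: "strict_suffix y x"
      then obtain u where "x = u @ y" "u \<noteq> []" by (auto simp: strict_suffix_def suffix_def)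
      moreover have "\<not> strict_suffix x y" using s by (rule suffix_order.less_not_sym)
      ultimately show ?thesis
        using s \<open>a = _\<close> \<open>b = _\<close> by simp
    qed (use \<open>a = _\<close> \<open>b = _\<close> in simp)
  qed
  \<comment> \<open>Outside {1..k} both words are empty, so comparability can be read at every
    natural number and the equivalence becomes a pointwise one.\<close>
  have cmp: "comparable_rc k v w \<longleftrightarrow>
      (\<forall>i. strict_suffix (v i) (w i) \<or> strict_suffix (w i) (v i) \<or> v i = w i)"
    unfolding comparable_rc_def using out by metis
  show ?thesis
    unfolding word_acts_def word_act_def cmp deg_diff_def cr_plus_def cr_minus_def fun_eq_iff
    by (simp only: all_conj_distrib[symmetric]) (simp only: pointwise[OF nil len])
qed

text \<open>Ensures that a matrix built from the quotients reads the coefficients only at index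
  pairs of the formal series, where they are known to be in \<open>bop\<close>.\<close>

lemma cr_word_pairs:
  assumes v: "v \<in> mwords k n" and w: "w \<in> mwords k n" and cmp: "comparable_rc k v w"
  shows "(cr_plus v w, cr_minus v w) \<in> word_pairs k n (deg_diff v w)"
proof -
  have out: "v i = []" "w i = []" if "i \<notin> {1..k}" for i
    using that v w by (auto simp: mwords_outside)
  have pt: "set (cr_plus v w i) \<subseteq> set (v i) \<and> set (cr_minus v w i) \<subseteq> set (w i) \<and>
     int (length (cr_plus v w i)) = max (- deg_diff v w i) 0 \<and>
     int (length (cr_minus v w i)) = max (deg_diff v w i) 0" if i: "i \<in> {1..k}" for i
  proof -
    consider "strict_suffix (v i) (w i)" | "strict_suffix (w i) (v i)" | "v i = w i"
      using cmp i unfolding comparable_rc_def by blast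
    then show ?thesis
    proof cases
      case 1
      then obtain u where "w i = u @ v i" "u \<noteq> []" by (auto simp: strict_suffix_def suffix_def)
      moreover have "\<not> strict_suffix (w i) (v i)" using 1 by (rule suffix_order.less_not_sym)
      ultimately show ?thesis using 1 by (simp add: cr_plus_def cr_minus_def deg_diff_def)
    next
      case 2
      then obtain u where "v i = u @ w i" "u \<noteq> []" by (auto simp: strict_suffix_def suffix_def)
      moreover have "\<not> strict_suffix (v i) (w i)" using 2 by (rule suffix_order.less_not_sym)
      ultimately show ?thesis using 2 by (simp add: cr_plus_def cr_minus_def deg_diff_def)
    next
      case 3
      then show ?thesis by (simp add: cr_plus_def cr_minus_def deg_diff_def)
    qed
  qed
  have "set (cr_plus v w i) \<subseteq> {1..n i}" "set (cr_minus v w i) \<subseteq> {1..n i}" if i: "i \<in> {1..k}" for i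
    by (rule order_trans[OF _ mwords_letters[OF v i]], use pt[OF i] in blast)
      (rule order_trans[OF _ mwords_letters[OF w i]], use pt[OF i] in blast)
  moreover have "cr_plus v w i = []" "cr_minus v w i = []" if "i \<notin> {1..k}" for i
    by (simp_all add: cr_plus_def cr_minus_def out[OF that])
  ultimately have "cr_plus v w \<in> mwords k n" "cr_minus v w \<in> mwords k n"
    unfolding mwords_def by blast+
  with pt show ?thesis unfolding word_pairs_def by blast
qed

lemma word_act_mwords:
  assumes "\<alpha> \<in> mwords k n" "w \<in> mwords k n"
  shows "word_act \<alpha> \<beta> w \<in> mwords k n"
  unfolding word_act_def using assms by (intro mwords_appendI mwords_dropI)

lemma inj_on_word_act: "inj_on (word_act \<alpha> \<beta>) {w. word_acts \<beta> w}"
proof (rule inj_onI, rule ext)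
  fix w w' i assume "w \<in> {w. word_acts \<beta> w}" "w' \<in> {w. word_acts \<beta> w}"
    and eq: "word_act \<alpha> \<beta> w = word_act \<alpha> \<beta> w'"
  then have "prefix (\<beta> i) (w i)" "prefix (\<beta> i) (w' i)" by (auto simp: word_acts_def)
  then obtain u u' where "w i = \<beta> i @ u" "w' i = \<beta> i @ u'" by (auto elim!: prefixE)
  then show "w i = w' i"
    using fun_cong[OF eq, of i] by (simp add: word_act_def)
qed


subsection \<open>Tensor products and creation operators\<close>

lemma zero_mem_closure_cspan: "0 \<in> closure (cspan (S :: 'a::{complex_vector,real_normed_vector} set))"
  by (meson closure_subset complex_vector.span_zero subsetD)

lemma add_mem_closure_cspan:
  fixes S :: "'a::{complex_vector,real_normed_vector} set"
  assumes "x \<in> closure (cspan S)" "y \<in> closure (cspan S)"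
  shows "x + y \<in> closure (cspan S)"
proof -
  obtain f g where "\<forall>m. f m \<in> cspan S" "f \<longlonglongrightarrow> x" "\<forall>m. g m \<in> cspan S" "g \<longlonglongrightarrow> y"
    using assms unfolding closure_sequential by blast
  then show ?thesis
    unfolding closure_sequential
    by (intro exI[of _ "\<lambda>m. f m + g m"]) (auto intro: tendsto_add complex_vector.span_add)
qed

lemma scaleC_mem_closure_cspan:
  fixes S :: "'a::complex_inner set"
  assumes "x \<in> closure (cspan S)"
  shows "c *\<^sub>C x \<in> closure (cspan S)"
proof -
  obtain f where "\<forall>m. f m \<in> cspan S" "f \<longlonglongrightarrow> x"
    using assms unfolding closure_sequential by blast
  then show ?thesis
    unfolding closure_sequential
    by (intro exI[of _ "\<lambda>m. c *\<^sub>C f m"])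
      (auto intro: bounded_linear.tendsto[OF bounded_linear_scaleC] complex_vector.span_scale)
qed

lemma op_prod_Nil [simp]: "op_prod [] = id_blinfun"
  and op_prod_Cons [simp]: "op_prod (T # Ts) = T o\<^sub>L op_prod Ts"
  by (simp_all add: op_prod_def)

lemma op_prod_bop: "set Ts \<subseteq> bop \<Longrightarrow> op_prod Ts \<in> bop"
  by (induction Ts) auto

lemma op_prod_mem:
  assumes "closed_operator_algebra U" "id_blinfun \<in> U" "set Ts \<subseteq> U"
  shows "op_prod Ts \<in> U"
  using assms(3) by (induction Ts) (use assms(1,2) in \<open>auto simp: closed_operator_algebra_def\<close>)

locale polyball_space =
  fixes k :: nat and n :: "nat \<Rightarrow> nat"
    and e :: "mword \<Rightarrow> 'f::chilbert_space"
    and ten :: "'e::chilbert_space \<Rightarrow> 'f \<Rightarrow> 'h::chilbert_space"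
  assumes onb: "is_onb_on (mwords k n) e" and tensor: "is_hilbert_tensor ten"
begin

abbreviation W :: "mword set"
  where "W \<equiv> mwords k n"

lemma ten_add_left: "ten (h + h') x = ten h x + ten h' x"
  and ten_add_right: "ten h (x + x') = ten h x + ten h x'"
  and ten_scaleC_left: "ten (c *\<^sub>C h) x = c *\<^sub>C ten h x"
  and ten_scaleC_right: "ten h (c *\<^sub>C x) = c *\<^sub>C ten h x"
  and cinner_ten: "cinner (ten h x) (ten l y) = cinner h l * cinner x y"
  and dense_ten: "closure (cspan {ten h x |h x. True}) = UNIV"
  using tensor unfolding is_hilbert_tensor_def by blast+

lemma cinner_e: "v \<in> W \<Longrightarrow> w \<in> W \<Longrightarrow> cinner (e v) (e w) = (if v = w then 1 else 0)"
  and dense_e: "closure (cspan (e ` W)) = UNIV"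
  using onb unfolding is_onb_on_def by blast+

lemma ten_zero_right [simp]: "ten h 0 = 0"
  using ten_scaleC_right[of h 0 0] by simp

lemma ten_scaleR_right: "ten h (r *\<^sub>R x) = r *\<^sub>R ten h x"
  using ten_scaleC_right[of h "of_real r" x] by (simp add: scaleC_of_real)

lemma norm_ten: "norm (ten h x) = norm h * norm x"
proof -
  have "complex_of_real ((norm (ten h x))\<^sup>2) = cinner h h * cinner x x"
    by (simp only: cinner_self[symmetric] cinner_ten)
  also have "\<dots> = complex_of_real ((norm h * norm x)\<^sup>2)"
    by (simp add: cinner_self power_mult_distrib)
  finally have "(norm (ten h x))\<^sup>2 = (norm h * norm x)\<^sup>2"
    unfolding of_real_eq_iff .
  then show ?thesis by (simp add: power2_eq_iff_nonneg)
qed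

lemma bounded_linear_ten: "bounded_linear (ten h)"
  by (rule bounded_linear_intro[where K = "norm h"])
    (simp_all add: ten_add_right norm_ten ten_scaleR_right)

sublocale F: hilbert_sum W "\<lambda>w c. c *\<^sub>C e w"
proof
  have "{c *\<^sub>C e w |w c. w \<in> W} = {c *\<^sub>C x |c x. x \<in> e ` W}" by blast
  have "e ` W \<subseteq> {c *\<^sub>C e w |w c. w \<in> W}"
  proof
    fix x assume "x \<in> e ` W"
    then obtain w where "w \<in> W" "x = 1 *\<^sub>C e w" by auto
    then show "x \<in> {c *\<^sub>C e w |w c. w \<in> W}" by blast
  qed
  then have "UNIV \<subseteq> closure (cspan {c *\<^sub>C e w |w c. w \<in> W})"
    unfolding dense_e[symmetric] by (intro closure_mono complex_vector.span_mono)
  then show "closure (cspan {c *\<^sub>C e w |w c. w \<in> W}) = UNIV" by blast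
qed (simp_all add: scaleC_add_left scaleC_scaleC scaleC_complex_def cinner_complex_def
    cinner_scaleC_left cinner_scaleC_right cinner_e)

sublocale H: hilbert_sum W "\<lambda>w h. ten h (e w)"
proof
  let ?S = "{ten h (e w) |w h. w \<in> W}"
  \<comment> \<open>Density in two stages: for fixed h the basis vectors approximate every x, and
    then the elementary tensors approximate everything.\<close>
  have ten: "ten h x \<in> closure (cspan ?S)" for h x
    using dense_e
  proof (rule closure_cspan_induct[where P = "\<lambda>x. ten h x \<in> closure (cspan ?S)"])
    show "ten h x \<in> closure (cspan ?S)" if "x \<in> e ` W" for x
    proof -
      have "ten h x \<in> ?S" using that by blast
      then show ?thesis by (meson closure_subset complex_vector.span_base subsetD)
    qed
    have "closed (ten h -` closure (cspan ?S))"
      by (intro closed_vimage closed_closure)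
        (simp add: bounded_linear_ten linear_continuous_on)
    then show "closed {x. ten h x \<in> closure (cspan ?S)}" by (simp add: vimage_def)
  qed (simp_all add: ten_add_right ten_scaleC_right zero_mem_closure_cspan
      add_mem_closure_cspan scaleC_mem_closure_cspan)
  have "x \<in> closure (cspan ?S)" for x
    using dense_ten
  proof (rule closure_cspan_induct[where P = "\<lambda>x. x \<in> closure (cspan ?S)"])
    show "closed {x. x \<in> closure (cspan ?S)}" by simp
    fix x assume "x \<in> {ten h x |h x. True}"
    then obtain h y where "x = ten h y" by blast
    then show "x \<in> closure (cspan ?S)" by (simp only: ten)
  qed (rule zero_mem_closure_cspan, erule (1) add_mem_closure_cspan, erule scaleC_mem_closure_cspan)
  then show "closure (cspan ?S) = UNIV" by blast
qed (simp_all add: ten_add_left ten_scaleC_left cinner_ten cinner_e)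

lemma op_tensor_eqI:
  assumes T: "T \<in> bop" and X: "X \<in> bop" and Y: "Y \<in> bop"
    and basis: "\<And>w h. w \<in> W \<Longrightarrow> blinfun_apply T (ten h (e w)) = ten (X h) (Y (e w))"
  shows "op_tensor ten X Y = T" and "blinfun_apply T (ten h x) = ten (X h) (Y x)"
proof -
  have all: "T (ten h x) = ten (X h) (Y x)" for h x
    using dense_e
  proof (rule closure_cspan_induct[where P = "\<lambda>x. T (ten h x) = ten (X h) (Y x)"])
    show "closed {x. T (ten h x) = ten (X h) (Y x)}"
      by (intro closed_Collect_eq linear_continuous_on
          bounded_linear_compose[OF blinfun.bounded_linear_right bounded_linear_ten]
          bounded_linear_compose[OF bounded_linear_ten blinfun.bounded_linear_right])
  qed (auto simp: basis blinfun.zero_right ten_add_right blinfun.add_right ten_scaleC_right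
      bop_scaleC[OF T] bop_scaleC[OF Y])
  show "T (ten h x) = ten (X h) (Y x)" by (rule all)
  show "op_tensor ten X Y = T"
    unfolding op_tensor_def
  proof (rule the_equality)
    fix T' assume T': "T' \<in> bop \<and> (\<forall>h x. blinfun_apply T' (ten h x) = ten (X h) (Y x))"
    show "T' = T"
      by (rule bop_eqI_dense[OF dense_ten]) (use T T' all in auto)
  qed (use T all in blast)
qed

text \<open>\<open>op_tensor\<close> is given by a definite description, so it is only known to be the
  tensor product of operators where the latter is shown to exist; weighted partial shifts of the
  basis are all that occurs.\<close>

lemma op_tensor_shift:
  assumes X: "X \<in> bop" and Y: "Y \<in> bop"
    and D: "D \<subseteq> W" "inj_on f D" "f ` D \<subseteq> W"
    and Y_e: "\<And>w. w \<in> W \<Longrightarrow> blinfun_apply Y (e w) = (if w \<in> D then r *\<^sub>R e (f w) else 0)"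
  shows "op_tensor ten X Y \<in> bop"
    and "blinfun_apply (op_tensor ten X Y) (ten h x) = ten (X h) (Y x)"
proof -
  obtain T where T: "T \<in> bop"
    "\<And>w h. w \<in> W \<Longrightarrow> blinfun_apply T (ten h (e w)) = (if w \<in> D then ten (X h) (e (f w)) else 0)"
    using H.partial_shift_exists[OF D X] by blast
  have rT: "r *\<^sub>R T \<in> bop" using T by blast
  have basis: "(r *\<^sub>R T) (ten h (e w)) = ten (X h) (Y (e w))" if "w \<in> W" for w h
    using that by (simp add: T(2) Y_e blinfun.scaleR_left ten_scaleR_right)
  have eq: "op_tensor ten X Y = r *\<^sub>R T" by (rule op_tensor_eqI(1)[OF rT X Y basis])
  show "op_tensor ten X Y \<in> bop" unfolding eq by (rule rT)
  show "op_tensor ten X Y (ten h x) = ten (X h) (Y x)"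
    unfolding eq by (rule op_tensor_eqI(2)[OF rT X Y basis])
qed

section \<open>Creation operators and their monomials on basis vectors\<close>

lemma basis_shift:
  assumes "f ` W \<subseteq> W" "inj_on f W"
  defines "S \<equiv> THE T. T \<in> bop \<and> (\<forall>w\<in>W. blinfun_apply T (e w) = e (f w))"
  shows "S \<in> bop" and "w \<in> W \<Longrightarrow> blinfun_apply S (e w) = e (f w)"
proof -
  obtain T where T: "T \<in> bop" "\<And>w c. w \<in> W \<Longrightarrow> blinfun_apply T (c *\<^sub>C e w) = c *\<^sub>C e (f w)"
    using F.partial_shift_exists[OF order_refl assms(2,1) bop_id] by auto
  let ?P = "\<lambda>T. T \<in> bop \<and> (\<forall>w\<in>W. blinfun_apply T (e w) = e (f w))"
  have PT: "?P T" using T(1) T(2)[of _ 1] by simp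
  have "T' = T" if "?P T'" for T'
    by (rule bop_eqI_dense[OF dense_e]) (use that PT in auto)
  then have "?P S" unfolding S_def by (rule theI[of ?P, OF PT])
  then show "S \<in> bop" "w \<in> W \<Longrightarrow> blinfun_apply S (e w) = e (f w)" by auto
qed

lemma
  assumes i: "i \<in> {1..k}" and j: "j \<in> {1..n i}"
  shows left_creation_bop: "left_creation k n e i j \<in> bop"
    and left_creation_e: "w \<in> W \<Longrightarrow> left_creation k n e i j (e w) = e (w(i := j # w i))"
    and right_creation_bop: "right_creation k n e i j \<in> bop"
    and right_creation_e: "w \<in> W \<Longrightarrow> right_creation k n e i j (e w) = e (w(i := w i @ [j]))"
proof -
  have inj: "inj_on (\<lambda>w::mword. w(i := g (w i))) W" if "inj g" for g
  proof (rule inj_onI)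
    fix v w :: mword assume eq: "v(i := g (v i)) = w(i := g (w i))"
    show "v = w"
    proof
      fix l
      show "v l = w l" using fun_cong[OF eq, of l] injD[OF that] by (cases "l = i") auto
    qed
  qed
  have m: "(\<lambda>w. w(i := j # w i)) ` W \<subseteq> W" "(\<lambda>w. w(i := w i @ [j])) ` W \<subseteq> W"
    using mwords_letters[OF _ i] j by (intro image_subsetI mwords_upd i; simp)+
  have l: "inj_on (\<lambda>w::mword. w(i := j # w i)) W" by (rule inj) (simp add: inj_def)
  have r: "inj_on (\<lambda>w::mword. w(i := w i @ [j])) W" by (rule inj) (simp add: inj_def)
  show "left_creation k n e i j \<in> bop" "w \<in> W \<Longrightarrow> left_creation k n e i j (e w) = e (w(i := j # w i))"
    unfolding left_creation_def using basis_shift[OF m(1) l] by auto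
  show "right_creation k n e i j \<in> bop"
    "w \<in> W \<Longrightarrow> right_creation k n e i j (e w) = e (w(i := w i @ [j]))"
    unfolding right_creation_def using basis_shift[OF m(2) r] by auto
qed

lemma
  assumes i: "i \<in> {1..k}" and \<alpha>: "set \<alpha> \<subseteq> {1..n i}"
  shows left_creation_word_bop: "left_creation_word k n e i \<alpha> \<in> bop"
    and left_creation_word_e: "w \<in> W \<Longrightarrow> left_creation_word k n e i \<alpha> (e w) = e (w(i := \<alpha> @ w i))"
proof -
  show "left_creation_word k n e i \<alpha> \<in> bop"
    unfolding left_creation_word_def using i \<alpha> left_creation_bop by (intro op_prod_bop) auto
  show "left_creation_word k n e i \<alpha> (e w) = e (w(i := \<alpha> @ w i))" if w: "w \<in> W"
    using \<alpha>
  proof (induction \<alpha>)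
    case (Cons j \<alpha>)
    then have "w(i := \<alpha> @ w i) \<in> W"
      using i w mwords_letters[OF w i] by (intro mwords_upd) auto
    then have step: "left_creation k n e i j (e (w(i := \<alpha> @ w i))) =
        e ((w(i := \<alpha> @ w i))(i := j # (w(i := \<alpha> @ w i)) i))"
      using Cons.prems by (intro left_creation_e i) auto
    have "left_creation_word k n e i (j # \<alpha>) (e w) =
        left_creation k n e i j (left_creation_word k n e i \<alpha> (e w))"
      by (simp add: left_creation_word_def)
    also have "left_creation_word k n e i \<alpha> (e w) = e (w(i := \<alpha> @ w i))"
      by (rule Cons.IH) (use Cons.prems in simp)
    finally show ?case
      by (simp only: step fun_upd_upd fun_upd_same append_Cons)
  qed (simp add: left_creation_word_def)
qed

lemma adj_left_creation_word_e:
  assumes i: "i \<in> {1..k}" and \<beta>: "set \<beta> \<subseteq> {1..n i}" and w: "w \<in> W"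
  shows "adj (left_creation_word k n e i \<beta>) (e w) =
    (if prefix \<beta> (w i) then e (w(i := drop (length \<beta>) (w i))) else 0)"
proof (rule F.hilbert_sum_eqI)
  fix v c assume v: "v \<in> W"
  let ?L = "left_creation_word k n e i \<beta>"
  have L: "?L \<in> bop" by (rule left_creation_word_bop[OF i \<beta>])
  have v': "v(i := \<beta> @ v i) \<in> W"
    using i \<beta> mwords_letters[OF v i] v by (intro mwords_upd) auto
  have w': "w(i := drop (length \<beta>) (w i)) \<in> W"
    using i w mwords_letters[OF w i] by (intro mwords_upd) (auto dest: in_set_dropD)
  have eq: "w = v(i := \<beta> @ v i) \<longleftrightarrow> prefix \<beta> (w i) \<and> w(i := drop (length \<beta>) (w i)) = v"
    by (auto simp: fun_eq_iff prefix_def)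
  have "cinner (adj ?L (e w)) (c *\<^sub>C e v) = cnj c * cinner (e w) (e (v(i := \<beta> @ v i)))"
    by (simp add: cinner_adj'[OF L, symmetric] bop_scaleC[OF L] left_creation_word_e[OF i \<beta> v]
        cinner_scaleC_right)
  also have "\<dots> = cinner (if prefix \<beta> (w i) then e (w(i := drop (length \<beta>) (w i))) else 0) (c *\<^sub>C e v)"
    using w v v' w' eq by (simp add: cinner_e cinner_scaleC_right)
  finally show "cinner (adj ?L (e w)) (c *\<^sub>C e v) =
    cinner (if prefix \<beta> (w i) then e (w(i := drop (length \<beta>) (w i))) else 0) (c *\<^sub>C e v)" .
qed

lemma left_products_e:
  assumes \<alpha>: "\<alpha> \<in> W" and w: "w \<in> W" and "set ks \<subseteq> {1..k}" "distinct ks"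
  shows "op_prod (map (\<lambda>i. left_creation_word k n e i (\<alpha> i)) ks) (e w) =
    e (\<lambda>i. if i \<in> set ks then \<alpha> i @ w i else w i)"
  using assms(3,4)
proof (induction ks)
  case (Cons i ks)
  let ?v = "\<lambda>l. if l \<in> set ks then \<alpha> l @ w l else w l"
  have v: "?v \<in> W" using \<alpha> w unfolding mwords_def by auto
  have "left_creation_word k n e i (\<alpha> i) (e ?v) = e (?v(i := \<alpha> i @ ?v i))"
    using Cons.prems \<alpha> v by (intro left_creation_word_e mwords_letters) auto
  moreover have "?v(i := \<alpha> i @ ?v i) = (\<lambda>l. if l \<in> set (i # ks) then \<alpha> l @ w l else w l)"
    using Cons.prems by auto
  moreover have "op_prod (map (\<lambda>i. left_creation_word k n e i (\<alpha> i)) ks) (e w) = e ?v"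
    using Cons by simp
  ultimately show ?case by simp
qed simp

lemma adj_left_products_e:
  assumes \<beta>: "\<beta> \<in> W" and w: "w \<in> W" and "set ks \<subseteq> {1..k}" "distinct ks"
  shows "op_prod (map (\<lambda>i. adj (left_creation_word k n e i (\<beta> i))) ks) (e w) =
    (if \<forall>i\<in>set ks. prefix (\<beta> i) (w i)
     then e (\<lambda>i. if i \<in> set ks then drop (length (\<beta> i)) (w i) else w i) else 0)"
  using assms(3,4)
proof (induction ks)
  case (Cons i ks)
  let ?v = "\<lambda>l. if l \<in> set ks then drop (length (\<beta> l)) (w l) else w l"
  have v: "?v \<in> W" using w unfolding mwords_def by (auto dest: in_set_dropD)
  have "?v(i := drop (length (\<beta> i)) (?v i)) =
      (\<lambda>l. if l \<in> set (i # ks) then drop (length (\<beta> l)) (w l) else w l)"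
    using Cons.prems by auto
  moreover have "?v i = w i" using Cons.prems by simp
  moreover have "adj (left_creation_word k n e i (\<beta> i)) (e ?v) =
    (if prefix (\<beta> i) (?v i) then e (?v(i := drop (length (\<beta> i)) (?v i))) else 0)"
    using Cons.prems \<beta> v by (intro adj_left_creation_word_e mwords_letters) auto
  ultimately show ?case
    using Cons by (auto simp: blinfun.zero_right)
qed simp

lemma creation_monomial_bop:
  assumes "\<alpha> \<in> W" "\<beta> \<in> W"
  shows "creation_monomial k n e \<alpha> \<beta> \<in> bop"
proof -
  have bop: "left_creation_word k n e i (\<gamma> i) \<in> bop" if "i \<in> set [1..<Suc k]" "\<gamma> \<in> W" for i \<gamma>
    using that by (intro left_creation_word_bop mwords_letters) auto
  have "\<forall>i\<in>set [1..<Suc k]. left_creation_word k n e i (\<alpha> i) \<in> bop"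
    "\<forall>i\<in>set [1..<Suc k]. adj (left_creation_word k n e i (\<beta> i)) \<in> bop"
    using bop assms adj_bop by blast+
  then show ?thesis
    unfolding creation_monomial_def
    by (intro bop_compose op_prod_bop) (simp_all only: set_map image_subset_iff)
qed

lemma creation_monomial_e:
  assumes \<alpha>: "\<alpha> \<in> W" and \<beta>: "\<beta> \<in> W" and w: "w \<in> W"
  shows "creation_monomial k n e \<alpha> \<beta> (e w) = (if word_acts \<beta> w then e (word_act \<alpha> \<beta> w) else 0)"
proof -
  let ?ks = "[1..<Suc k]"
  let ?v = "\<lambda>i. drop (length (\<beta> i)) (w i)"
  have ks: "set ?ks = {1..k}" "distinct ?ks" by auto
  have v: "?v \<in> W" by (rule mwords_dropI[OF w])
  have "(\<lambda>i. if i \<in> set ?ks then drop (length (\<beta> i)) (w i) else w i) = ?v"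
    unfolding ks using mwords_outside[OF w] by auto
  moreover have "(\<forall>i\<in>set ?ks. prefix (\<beta> i) (w i)) \<longleftrightarrow> word_acts \<beta> w"
    unfolding ks word_acts_def using mwords_outside[OF \<beta>] by (metis Nil_prefix)
  ultimately have adj: "op_prod (map (\<lambda>i. adj (left_creation_word k n e i (\<beta> i))) ?ks) (e w) =
      (if word_acts \<beta> w then e ?v else 0)"
    by (simp only: adj_left_products_e[OF \<beta> w eq_refl[OF ks(1)] ks(2)])
  have "(\<lambda>i. if i \<in> set ?ks then \<alpha> i @ ?v i else ?v i) = word_act \<alpha> \<beta> w"
    unfolding ks word_act_def using mwords_outside[OF \<alpha>] by auto
  then have "op_prod (map (\<lambda>i. left_creation_word k n e i (\<alpha> i)) ?ks) (e ?v) = e (word_act \<alpha> \<beta> w)"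
    by (simp only: left_products_e[OF \<alpha> v eq_refl[OF ks(1)] ks(2)])
  moreover have "creation_monomial k n e \<alpha> \<beta> (e w) =
      op_prod (map (\<lambda>i. left_creation_word k n e i (\<alpha> i)) ?ks) (if word_acts \<beta> w then e ?v else 0)"
    by (simp only: creation_monomial_def blinfun_apply_blinfun_compose adj)
  ultimately show ?thesis
    by (simp add: blinfun.zero_right del: upt_Suc)
qed

lemma
  assumes X: "X \<in> bop" and \<alpha>: "\<alpha> \<in> W" and \<beta>: "\<beta> \<in> W"
  shows op_tensor_monomial_bop: "op_tensor ten X (r *\<^sub>R creation_monomial k n e \<alpha> \<beta>) \<in> bop"
    and op_tensor_monomial:
      "op_tensor ten X (r *\<^sub>R creation_monomial k n e \<alpha> \<beta>) (ten h x) =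
        r *\<^sub>R ten (X h) (creation_monomial k n e \<alpha> \<beta> x)"
proof -
  let ?D = "{w \<in> W. word_acts \<beta> w}" and ?Y = "r *\<^sub>R creation_monomial k n e \<alpha> \<beta>"
  have D: "?D \<subseteq> W" "inj_on (word_act \<alpha> \<beta>) ?D" "word_act \<alpha> \<beta> ` ?D \<subseteq> W"
    using inj_on_word_act word_act_mwords[OF \<alpha>] by (auto intro: inj_on_subset)
  have Y: "?Y \<in> bop" by (intro bop_scaleR creation_monomial_bop \<alpha> \<beta>)
  have Y_e: "?Y (e w) = (if w \<in> ?D then r *\<^sub>R e (word_act \<alpha> \<beta> w) else 0)" if "w \<in> W" for w
    using that by (simp add: blinfun.scaleR_left creation_monomial_e \<alpha> \<beta>)
  show "op_tensor ten X ?Y \<in> bop" by (rule op_tensor_shift(1)[OF X Y D Y_e])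
  have "op_tensor ten X ?Y (ten h x) = ten (X h) (?Y x)"
    by (rule op_tensor_shift(2)[OF X Y D Y_e])
  then show "op_tensor ten X ?Y (ten h x) = r *\<^sub>R ten (X h) (creation_monomial k n e \<alpha> \<beta> x)"
    by (simp add: blinfun.scaleR_left ten_scaleR_right)
qed

end

subsection \<open>The matrix of a multi-Toeplitz operator\<close>

lemma strict_suffix_snoc: "strict_suffix (x @ [s]) (y @ [t]) \<longleftrightarrow> s = t \<and> strict_suffix x y"
  by (auto simp: strict_suffix_def)

lemma rquot_snoc: "strict_suffix y x \<Longrightarrow> rquot (x @ [s]) (y @ [s]) = rquot x y"
  by (auto simp: strict_suffix_def suffix_def)

definition snoc_at :: "nat \<Rightarrow> nat \<Rightarrow> mword \<Rightarrow> mword"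
  where "snoc_at i s w = w(i := w i @ [s])"

text \<open>The combinatorial content of the Toeplitz relation: words in the suffix order extended
  by a last letter are comparable only if the letters agree. The quotients are then unchanged, as
  the next two lemmas record.\<close>

lemma comparable_snoc:
  assumes "i \<in> {1..k}"
  shows "comparable_rc k (snoc_at i s v) (snoc_at i t w) \<longleftrightarrow> s = t \<and> comparable_rc k v w"
proof -
  let ?P = "\<lambda>v w (j::nat). strict_suffix (v j :: nat list) (w j) \<or> strict_suffix (w j) (v j) \<or> v j = w j"
  have "?P (snoc_at i s v) (snoc_at i t w) j \<longleftrightarrow> (j = i \<longrightarrow> s = t) \<and> ?P v w j" for j
    by (cases "j = i") (auto simp: snoc_at_def strict_suffix_snoc)
  then show ?thesis
    unfolding comparable_rc_def using assms by (simp only:) blast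
qed

lemma cr_plus_snoc: "cr_plus (snoc_at i s v) (snoc_at i s w) = cr_plus v w"
  by (rule ext) (simp add: cr_plus_def snoc_at_def strict_suffix_snoc rquot_snoc)

lemma cr_minus_snoc: "cr_minus (snoc_at i s v) (snoc_at i s w) = cr_minus v w"
  by (rule ext) (simp add: cr_minus_def snoc_at_def strict_suffix_snoc rquot_snoc)

context polyball_space
begin

lemma snoc_at_W: "w \<in> W \<Longrightarrow> i \<in> {1..k} \<Longrightarrow> s \<in> {1..n i} \<Longrightarrow> snoc_at i s w \<in> W"
  unfolding snoc_at_def using mwords_letters[of w k n i] by (intro mwords_upd) auto

lemma inj_snoc_at: "inj (snoc_at i s)"
proof (rule injI, rule ext)
  fix v w l assume eq: "snoc_at i s v = snoc_at i s w"
  show "v l = w l"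
    using fun_cong[OF eq, of l] by (cases "l = i") (auto simp: snoc_at_def)
qed

lemma
  assumes i: "i \<in> {1..k}" and t: "t \<in> {1..n i}"
  shows right_tensor_bop: "op_tensor ten id_blinfun (right_creation k n e i t) \<in> bop"
    and right_tensor: "w \<in> W \<Longrightarrow> op_tensor ten id_blinfun (right_creation k n e i t) (ten h (e w)) =
      ten h (e (snoc_at i t w))"
proof -
  note R = right_creation_bop[OF i t]
  have f: "snoc_at i t ` W \<subseteq> W" using snoc_at_W[OF _ i t] by blast
  have inj: "inj_on (snoc_at i t) W" using inj_snoc_at by (rule inj_on_subset) simp
  have e: "right_creation k n e i t (e w) = (if w \<in> W then 1 *\<^sub>R e (snoc_at i t w) else 0)"
    if "w \<in> W" for w
    using that by (simp add: right_creation_e[OF i t] snoc_at_def)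
  show "op_tensor ten id_blinfun (right_creation k n e i t) \<in> bop"
    by (rule op_tensor_shift(1)[OF bop_id R order_refl inj f e])
  show "op_tensor ten id_blinfun (right_creation k n e i t) (ten h (e w)) = ten h (e (snoc_at i t w))"
    if "w \<in> W"
    using op_tensor_shift(2)[OF bop_id R order_refl inj f e, of h "e w"] e[OF that] that by simp
qed

text \<open>The tensor product with the adjoint of a right creation operator has to be shown to
  exist as well. That adjoint is the partial shift whose domain is the set of words with last letter
  s at index i, and which deletes this letter.\<close>

lemma
  assumes i: "i \<in> {1..k}" and s: "s \<in> {1..n i}"
  shows adj_right_tensor_bop: "op_tensor ten id_blinfun (adj (right_creation k n e i s)) \<in> bop"
    and cinner_adj_right_tensor: "v \<in> W \<Longrightarrow>
      cinner (op_tensor ten id_blinfun (adj (right_creation k n e i s)) x) (ten l (e v)) =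
      cinner x (ten l (e (snoc_at i s v)))"
proof -
  let ?R = "right_creation k n e i s" and ?D = "snoc_at i s ` W"
  note R = right_creation_bop[OF i s]
  have aR: "adj ?R \<in> bop" by (rule adj_bop[OF R])
  have adj_e: "cinner (adj ?R y) (e v) = cinner y (e (snoc_at i s v))" if "v \<in> W" for y v
    using that by (simp add: cinner_adj'[OF R, symmetric] right_creation_e[OF i s] snoc_at_def)
  have D: "?D \<subseteq> W" using snoc_at_W[OF _ i s] by blast
  have inj: "inj_on (inv (snoc_at i s)) ?D" by (rule inj_on_inv_into) blast
  have im: "inv (snoc_at i s) ` ?D \<subseteq> W" by (auto simp: inv_f_f[OF inj_snoc_at])
  have e: "adj ?R (e w) = (if w \<in> ?D then 1 *\<^sub>R e (inv (snoc_at i s) w) else 0)" if "w \<in> W" for w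
  proof (rule F.hilbert_sum_eqI)
    fix v c assume v: "v \<in> W"
    show "cinner (adj ?R (e w)) (c *\<^sub>C e v) =
        cinner (if w \<in> ?D then 1 *\<^sub>R e (inv (snoc_at i s) w) else 0) (c *\<^sub>C e v)"
      using that v snoc_at_W[OF v i s] inj_snoc_at[of i s]
      by (auto simp: cinner_scaleC_right adj_e cinner_e inv_f_f[OF inj_snoc_at] inj_eq)
  qed
  show bop: "op_tensor ten id_blinfun (adj ?R) \<in> bop"
    by (rule op_tensor_shift(1)[OF bop_id aR D inj im e])
  have app: "op_tensor ten id_blinfun (adj ?R) (ten h y) = ten h (adj ?R y)" for h y
    using op_tensor_shift(2)[OF bop_id aR D inj im e] by simp
  show "cinner (op_tensor ten id_blinfun (adj ?R) x) (ten l (e v)) = cinner x (ten l (e (snoc_at i s v)))"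
    if v: "v \<in> W"
    using dense_ten
  proof (rule closure_cspan_induct[where P = "\<lambda>x. cinner (op_tensor ten id_blinfun (adj ?R) x) (ten l (e v)) =
      cinner x (ten l (e (snoc_at i s v)))"])
    show "closed {x. cinner (op_tensor ten id_blinfun (adj ?R) x) (ten l (e v)) =
      cinner x (ten l (e (snoc_at i s v)))}"
      by (intro closed_Collect_eq linear_continuous_on bounded_linear_cinner_left
          bounded_linear_compose[OF bounded_linear_cinner_left blinfun.bounded_linear_right])
  qed (auto simp: app cinner_ten adj_e[OF v] blinfun.zero_right blinfun.add_right bop_scaleC[OF bop]
      cinner_add_left cinner_scaleC_left)
qed

text \<open>Multiplying by the right creation operators and their adjoints only moves the row and
  column labels, so the operator identity is one between entries of A.\<close>

lemma toeplitz_iff: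
  assumes A: "A \<in> bop"
  shows "multi_toeplitz k n e ten A \<longleftrightarrow>
    (\<forall>i\<in>{1..k}. \<forall>s\<in>{1..n i}. \<forall>t\<in>{1..n i}. \<forall>v\<in>W. \<forall>w\<in>W. \<forall>h l.
      cinner (A (ten h (e (snoc_at i t w)))) (ten l (e (snoc_at i s v))) =
      (if s = t then cinner (A (ten h (e w))) (ten l (e v)) else 0))"
proof -
  have "op_tensor ten id_blinfun (adj (right_creation k n e i s)) o\<^sub>L A o\<^sub>L
      op_tensor ten id_blinfun (right_creation k n e i t) = (if s = t then A else 0) \<longleftrightarrow>
    (\<forall>v\<in>W. \<forall>w\<in>W. \<forall>h l. cinner (A (ten h (e (snoc_at i t w)))) (ten l (e (snoc_at i s v))) =
      (if s = t then cinner (A (ten h (e w))) (ten l (e v)) else 0))" (is "?T = ?S \<longleftrightarrow> ?R")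
    if i: "i \<in> {1..k}" and s: "s \<in> {1..n i}" and t: "t \<in> {1..n i}" for i s t
  proof -
    have T: "?T \<in> bop" "?S \<in> bop"
      using A adj_right_tensor_bop[OF i s] right_tensor_bop[OF i t] by auto
    have ent: "cinner (?T (ten h (e w))) (ten l (e v)) =
        cinner (A (ten h (e (snoc_at i t w)))) (ten l (e (snoc_at i s v)))"
      if "v \<in> W" "w \<in> W" for v w h l
      using that by (simp add: cinner_adj_right_tensor[OF i s] right_tensor[OF i t])
    have S: "cinner (?S (ten h (e w))) (ten l (e v)) =
        (if s = t then cinner (A (ten h (e w))) (ten l (e v)) else 0)" for v w h l
      by simp
    show ?thesis
    proof
      assume "?T = ?S"
      show ?R
      proof (intro ballI allI)
        fix v w h l assume "v \<in> W" "w \<in> W"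
        from ent[OF this, of h l] show "cinner (A (ten h (e (snoc_at i t w)))) (ten l (e (snoc_at i s v))) =
          (if s = t then cinner (A (ten h (e w))) (ten l (e v)) else 0)"
          by (simp only: \<open>?T = ?S\<close> S)
      qed
    next
      assume ?R
      then show "?T = ?S"
        by (intro H.bop_eqI_entries[OF T]) (simp only: ent S)
    qed
  qed
  then show ?thesis
    unfolding multi_toeplitz_def using A by simp
qed

end

section \<open>The matrix attached to a family of coefficients\<close>

locale polyball_series = polyball_space k n e ten
  for k n and e :: "mword \<Rightarrow> 'f::chilbert_space"
    and ten :: "'e::chilbert_space \<Rightarrow> 'f \<Rightarrow> 'h::chilbert_space" +
  fixes C :: "mword \<Rightarrow> mword \<Rightarrow> 'e \<Rightarrow>\<^sub>L 'e"
  assumes C_bop: "\<forall>m\<in>multi_ints k. \<forall>(\<alpha>, \<beta>)\<in>word_pairs k n m. C \<alpha> \<beta> \<in> bop"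
begin

text \<open>The first argument is the row, the second the column. The series in (i) for a fixed
  \<gamma> thus runs over the column of \<gamma>.\<close>

definition M :: "mword \<Rightarrow> mword \<Rightarrow> 'e \<Rightarrow>\<^sub>L 'e"
  where "M v w = (if comparable_rc k v w then C (cr_plus v w) (cr_minus v w) else 0)"

lemma M_bop: "v \<in> W \<Longrightarrow> w \<in> W \<Longrightarrow> M v w \<in> bop"
  using C_bop deg_diff_multi_ints[of v k n w] cr_word_pairs[of v k n w] unfolding M_def by auto

lemma M_snoc: "i \<in> {1..k} \<Longrightarrow> M (snoc_at i s v) (snoc_at i t w) = (if s = t then M v w else 0)"
  by (simp add: M_def comparable_snoc cr_plus_snoc cr_minus_snoc)

text \<open>The monomial of (\<alpha>, \<beta>) takes the column \<beta> to the row \<alpha> with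
  empty remainder, so every coefficient of the series occurs as an entry of
  \<open>M\<close>.\<close>

lemma M_word_pair:
  assumes "m \<in> multi_ints k" "(\<alpha>, \<beta>) \<in> word_pairs k n m"
  shows "M \<alpha> \<beta> = C \<alpha> \<beta>"
proof -
  have "word_acts \<beta> \<beta> \<and> word_act \<alpha> \<beta> \<beta> = \<alpha>"
    by (simp add: word_acts_def word_act_def)
  then have "comparable_rc k \<alpha> \<beta>" "cr_plus \<alpha> \<beta> = \<alpha>" "cr_minus \<alpha> \<beta> = \<beta>"
    using word_acts_iff[of \<alpha> k n \<beta> \<alpha> \<beta> m] word_pairs_mwords[OF assms(2)] assms by auto
  then show ?thesis by (simp add: M_def)
qed

text \<open>The case distinctions in the test vectors disappear: the lengths force
  \<open>\<beta> i\<close> to be empty for m i < 0 and \<open>\<alpha> i\<close> to be empty for m i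
  \<ge> 0. A Fourier coefficient is therefore simply the entry of A at row \<alpha> and column
  \<beta>.\<close>

lemma fourier_iff:
  "is_fourier_series k n e ten C A \<longleftrightarrow>
    (\<forall>m\<in>multi_ints k. \<forall>(\<alpha>, \<beta>)\<in>word_pairs k n m. \<forall>h l.
      cinner (M \<alpha> \<beta> h) l = cinner (A (ten h (e \<beta>))) (ten l (e \<alpha>)))"
proof -
  have "(\<lambda>i. if m i \<ge> 0 then \<beta> i else []) = \<beta>" "(\<lambda>i. if m i \<ge> 0 then [] else \<alpha> i) = \<alpha>"
    if "m \<in> multi_ints k" "(\<alpha>, \<beta>) \<in> word_pairs k n m" for m \<alpha> \<beta>
  proof -
    have "(m i < 0 \<longrightarrow> \<beta> i = []) \<and> (m i \<ge> 0 \<longrightarrow> \<alpha> i = [])" for i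
    proof (cases "i \<in> {1..k}")
      case True
      then show ?thesis using that(2) unfolding word_pairs_def by fastforce
    next
      case False
      then show ?thesis using word_pairs_mwords[OF that(2)] mwords_outside by blast
    qed
    then show "(\<lambda>i. if m i \<ge> 0 then \<beta> i else []) = \<beta>" "(\<lambda>i. if m i \<ge> 0 then [] else \<alpha> i) = \<alpha>"
      by (auto simp: fun_eq_iff)
  qed
  note eq = this
  show ?thesis
    unfolding is_fourier_series_def
  proof (intro ball_cong refl)
    fix m p assume m: "m \<in> multi_ints k" and p: "p \<in> word_pairs k n m"
    obtain \<alpha> \<beta> where p_eq: "p = (\<alpha>, \<beta>)" by (cases p)
    show "(case p of (\<alpha>, \<beta>) \<Rightarrow> \<forall>h l. cinner (C \<alpha> \<beta> h) l =
        cinner (A (ten h (e (\<lambda>i. if m i \<ge> 0 then \<beta> i else [])))) (ten l (e (\<lambda>i. if m i \<ge> 0 then [] else \<alpha> i)))) =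
      (case p of (\<alpha>, \<beta>) \<Rightarrow> \<forall>h l. cinner (M \<alpha> \<beta> h) l = cinner (A (ten h (e \<beta>))) (ten l (e \<alpha>)))"
      using eq[OF m p[unfolded p_eq]] M_word_pair[OF m p[unfolded p_eq]] by (simp only: p_eq prod.case)
  qed
qed

lemma toeplitz_fourier_iff:
  "multi_toeplitz k n e ten A \<and> is_fourier_series k n e ten C A \<longleftrightarrow>
    A \<in> bop \<and> (\<forall>v\<in>W. \<forall>w\<in>W. \<forall>h l.
      cinner (A (ten h (e w))) (ten l (e v)) = cinner (M v w h) l)"
proof (intro iffI; elim conjE)
  assume A: "A \<in> bop" and M: "\<forall>v\<in>W. \<forall>w\<in>W. \<forall>h l.
      cinner (A (ten h (e w))) (ten l (e v)) = cinner (M v w h) l"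
  have "is_fourier_series k n e ten C A"
    unfolding fourier_iff using M word_pairs_mwords by fastforce
  moreover have "multi_toeplitz k n e ten A"
    unfolding toeplitz_iff[OF A] using M by (auto simp: snoc_at_W M_snoc)
  ultimately show "multi_toeplitz k n e ten A \<and> is_fourier_series k n e ten C A" by blast
next
  assume T: "multi_toeplitz k n e ten A" and Fs: "is_fourier_series k n e ten C A"
  have A: "A \<in> bop" using T unfolding multi_toeplitz_def by blast
  note T = T[unfolded toeplitz_iff[OF A]]
  have "cinner (A (ten h (e w))) (ten l (e v)) = cinner (M v w h) l"
    if "v \<in> W" "w \<in> W" for v w h l
    using that
  proof (induction "\<Sum>i=1..k. length (v i)" arbitrary: v w rule: less_induct)
    case less
    show ?case
    proof (cases "\<exists>i\<in>{1..k}. v i \<noteq> [] \<and> w i \<noteq> []")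
      case True
      then obtain i where i: "i \<in> {1..k}" "v i \<noteq> []" "w i \<noteq> []" by blast
      let ?s = "last (v i)" and ?t = "last (w i)"
      define v' where "v' = v(i := butlast (v i))"
      define w' where "w' = w(i := butlast (w i))"
      have v: "v = snoc_at i ?s v'" and w: "w = snoc_at i ?t w'"
        using i by (simp_all add: snoc_at_def v'_def w'_def)
      have W': "v' \<in> W" "w' \<in> W"
      proof -
        have "set (butlast (u i)) \<subseteq> {1..n i}" if "u \<in> W" for u
          using mwords_letters[OF that i(1)] by (meson in_set_butlastD subset_iff)
        then show "v' \<in> W" "w' \<in> W"
          unfolding v'_def w'_def using less.prems i by (auto intro!: mwords_upd simp del: One_nat_def)
      qed
      have st: "?s \<in> {1..n i}" "?t \<in> {1..n i}"
        using i less.prems mwords_letters[of _ k n i] by (meson last_in_set subsetD)+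
      have "(\<Sum>j=1..k. length (v' j)) < (\<Sum>j=1..k. length (v j))"
        using i by (intro sum_strict_mono_ex1) (auto simp: v'_def intro!: bexI[of _ i])
      note IH = less.hyps[OF this W']
      \<comment> \<open>Different last letters are stripped too: in that case the Toeplitz relation
        and the failure of comparability make both sides zero.\<close>
      have "cinner (A (ten h (e w))) (ten l (e v)) =
          (if ?s = ?t then cinner (A (ten h (e w'))) (ten l (e v')) else 0)"
        using T i(1) st W' by (subst v, subst w) blast
      also have "\<dots> = cinner (M v w h) l"
        by (subst v, subst w) (simp add: M_snoc[OF i(1)] IH)
      finally show ?thesis .
    next
      case False
      \<comment> \<open>No index has both words nonempty, so v and w are themselves an index pair of
        the series and the entry is a Fourier coefficient.\<close>
      then have "(v, w) \<in> word_pairs k n (deg_diff v w)"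
        using less.prems unfolding word_pairs_def deg_diff_def by (auto simp: max_def)
      then have "cinner (M v w h) l = cinner (A (ten h (e w))) (ten l (e v))"
        using Fs deg_diff_multi_ints[OF less.prems] unfolding fourier_iff by blast
      then show ?thesis by simp
    qed
  qed
  then show "A \<in> bop \<and> (\<forall>v\<in>W. \<forall>w\<in>W. \<forall>h l.
      cinner (A (ten h (e w))) (ten l (e v)) = cinner (M v w h) l)"
    using A by blast
qed

subsection \<open>The homogeneous parts of the series\<close>

abbreviation block :: "real \<Rightarrow> (nat \<Rightarrow> int) \<Rightarrow> 'h \<Rightarrow>\<^sub>L 'h"
  where "block \<equiv> phi_block k n e ten C"

abbreviation wt :: "mword \<Rightarrow> mword \<Rightarrow> nat"
  where "wt v w \<equiv> weight k (deg_diff v w)"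

lemma C_bopD: "m \<in> multi_ints k \<Longrightarrow> (\<alpha>, \<beta>) \<in> word_pairs k n m \<Longrightarrow> C \<alpha> \<beta> \<in> bop"
  using C_bop by blast

lemma block_bop:
  assumes "m \<in> multi_ints k"
  shows "block r m \<in> bop"
  unfolding phi_block_def
proof (rule bop_sum, clarify)
  fix \<alpha> \<beta> assume "(\<alpha>, \<beta>) \<in> word_pairs k n m"
  then show "op_tensor ten (C \<alpha> \<beta>) (r ^ (\<Sum>i=1..k. length (\<alpha> i) + length (\<beta> i)) *\<^sub>R
      creation_monomial k n e \<alpha> \<beta>) \<in> bop"
    using C_bopD[OF assms] word_pairs_mwords by (intro op_tensor_monomial_bop) auto
qed

text \<open>Of all monomials of multidegree m at most one connects column w with row v, namely the
  one given by the two quotients; the sum over word pairs collapses to it.\<close>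

lemma cinner_block:
  assumes m: "m \<in> multi_ints k" and v: "v \<in> W" and w: "w \<in> W"
  shows "cinner (block r m (ten h (e w))) (ten l (e v)) =
    (if deg_diff v w = m then of_real (r ^ weight k m) * cinner (M v w h) l else 0)"
proof -
  let ?c = "comparable_rc k v w \<and> deg_diff v w = m"
  let ?p = "(cr_plus v w, cr_minus v w)"
  have trm: "cinner (op_tensor ten (C \<alpha> \<beta>) (r ^ (\<Sum>i=1..k. length (\<alpha> i) + length (\<beta> i)) *\<^sub>R
      creation_monomial k n e \<alpha> \<beta>) (ten h (e w))) (ten l (e v)) =
      (if ?c \<and> (\<alpha>, \<beta>) = ?p then of_real (r ^ weight k m) * cinner (M v w h) l else 0)"
    if p: "(\<alpha>, \<beta>) \<in> word_pairs k n m" for \<alpha> \<beta>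
  proof -
    have W: "\<alpha> \<in> W" "\<beta> \<in> W" using word_pairs_mwords[OF p] by auto
    have "cinner (creation_monomial k n e \<alpha> \<beta> (e w)) (e v) =
        (if word_acts \<beta> w \<and> word_act \<alpha> \<beta> w = v then 1 else 0)"
      using v word_act_mwords[OF W(1) w, of \<beta>] by (simp add: creation_monomial_e[OF W w] cinner_e)
    also have "\<dots> = (if ?c \<and> (\<alpha>, \<beta>) = ?p then 1 else 0)"
      unfolding word_acts_iff[OF v w p m] by auto
    finally show ?thesis
      unfolding op_tensor_monomial[OF C_bopD[OF m p] W] word_pairs_weight[OF p]
      by (auto simp: cinner_scaleR_left cinner_ten M_def)
  qed
  have "cinner (block r m (ten h (e w))) (ten l (e v)) =
      (\<Sum>p\<in>word_pairs k n m. if ?c \<and> p = ?p then of_real (r ^ weight k m) * cinner (M v w h) l else 0)"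
    unfolding phi_block_def blinfun.sum_left cinner_sum_left
  proof (intro sum.cong refl)
    fix p assume p: "p \<in> word_pairs k n m"
    obtain \<alpha> \<beta> where p_eq: "p = (\<alpha>, \<beta>)" by (cases p)
    show "cinner ((case p of (\<alpha>, \<beta>) \<Rightarrow> op_tensor ten (C \<alpha> \<beta>)
        (r ^ (\<Sum>i=1..k. length (\<alpha> i) + length (\<beta> i)) *\<^sub>R creation_monomial k n e \<alpha> \<beta>)) (ten h (e w)))
        (ten l (e v)) =
      (if ?c \<and> p = ?p then of_real (r ^ weight k m) * cinner (M v w h) l else 0)"
      using trm[OF p[unfolded p_eq]] by (simp only: p_eq prod.case)
  qed
  also have "\<dots> = (\<Sum>p\<in>word_pairs k n m. if p = ?p then (if ?c then of_real (r ^ weight k m) * cinner (M v w h) l else 0) else 0)"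
    by (intro sum.cong refl) simp
  also have "\<dots> = (if ?c then of_real (r ^ weight k m) * cinner (M v w h) l else 0)"
    using cr_word_pairs[OF v w] by (auto simp: finite_word_pairs)
  finally show ?thesis by (auto simp: M_def)
qed

lemma block_scale:
  assumes m: "m \<in> multi_ints k"
  shows "block r m = r ^ weight k m *\<^sub>R block 1 m"
proof (rule H.bop_eqI_entries)
  show "block r m \<in> bop" "r ^ weight k m *\<^sub>R block 1 m \<in> bop"
    using block_bop[OF m] by auto
  fix v w h l assume "v \<in> W" "w \<in> W"
  then show "cinner (block r m (ten h (e w))) (ten l (e v)) =
      cinner ((r ^ weight k m *\<^sub>R block 1 m) (ten h (e w))) (ten l (e v))"
    by (simp add: cinner_block[OF m] blinfun.scaleR_left cinner_scaleR_left)
qed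

lemma norm_block_le:
  assumes m: "m \<in> multi_ints k" and K: "H.mat_bdd (\<lambda>v w. blinfun_apply (M v w)) K" and r: "0 \<le> r"
  shows "norm (block r m) \<le> r ^ weight k m * K"
proof -
  have "norm (block 1 m) \<le> K"
  proof (rule H.norm_le_mat_bdd[OF block_bop[OF m]])
    show "H.mat_bdd (\<lambda>v w h. of_bool ((\<lambda>i. int (length (w i)) - int (length (v i))) = m) *\<^sub>R M v w h) K"
      by (rule H.mat_bdd_diagonal[OF K, where D = "\<lambda>w i. int (length (w i))"])
        (simp add: blinfun.scaleR_right)
    fix v w h l assume "v \<in> W" "w \<in> W"
    then show "cinner (block 1 m (ten h (e w))) (ten l (e v)) =
      cinner (of_bool ((\<lambda>i. int (length (w i)) - int (length (v i))) = m) *\<^sub>R M v w h) l"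
      by (simp add: cinner_block[OF m] deg_diff_def)
  qed
  then show ?thesis
    by (subst block_scale[OF m]) (simp add: r mult_left_mono)
qed

lemma phi_op_has_sum:
  assumes K: "H.mat_bdd (\<lambda>v w. blinfun_apply (M v w)) K" and r: "0 \<le> r" "r < 1"
  shows "(block r has_sum phi_op k n e ten C r) (multi_ints k)"
proof -
  have "(\<lambda>m. r ^ weight k m) summable_on multi_ints k"
    unfolding multi_ints_eq weight_def by (rule summable_on_geometric_multi[OF r]) simp
  then have "(\<lambda>m. r ^ weight k m * K) summable_on multi_ints k"
    by (rule summable_on_cmult_left)
  then have "(\<lambda>m. norm (block r m)) summable_on multi_ints k"
    by (rule summable_on_comparison_test) (use norm_block_le[OF _ K r(1)] in auto)
  then have "block r summable_on multi_ints k" by (rule abs_summable_summable)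
  then obtain \<Phi> where \<Phi>: "(block r has_sum \<Phi>) (multi_ints k)" by (auto simp: summable_on_def)
  moreover have "phi_op k n e ten C r = \<Phi>"
    unfolding phi_op_def by (rule iter_sums_eq_multi_ints[OF \<Phi>])
  ultimately show ?thesis by simp
qed

lemma phi_op_bop:
  assumes "(block r has_sum \<Phi>) (multi_ints k)"
  shows "\<Phi> \<in> bop"
  by (rule closed_has_sum_mem[OF assms closed_bop]) (auto simp: block_bop)

text \<open>A given entry receives a contribution from the single multidegree
  \<open>deg_diff v w\<close>. This identifies any sum of the series, however its convergence was
  obtained.\<close>

lemma cinner_of_has_sum:
  assumes x: "((\<lambda>m. block r m (ten h (e w))) has_sum x) (multi_ints k)" and v: "v \<in> W" and w: "w \<in> W"
  shows "cinner x (ten l (e v)) = of_real (r ^ wt v w) * cinner (M v w h) l"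
proof -
  have "((\<lambda>m. cinner (block r m (ten h (e w))) (ten l (e v))) has_sum cinner x (ten l (e v))) (multi_ints k)"
    by (rule has_sum_bounded_linear[OF bounded_linear_cinner_left x])
  moreover have "((\<lambda>m. cinner (block r m (ten h (e w))) (ten l (e v))) has_sum
      of_real (r ^ wt v w) * cinner (M v w h) l) (multi_ints k)"
    using deg_diff_multi_ints[OF v w] v w
    by (intro has_sum_finite_neutralI[of "{deg_diff v w}"]) (auto simp: cinner_block)
  ultimately show ?thesis by (rule has_sum_unique)
qed

lemma has_sum_apply:
  assumes "(block r has_sum \<Phi>) (multi_ints k)"
  shows "((\<lambda>m. block r m x) has_sum \<Phi> x) (multi_ints k)"
  by (rule has_sum_bounded_linear[OF blinfun.bounded_linear_left assms])

lemma norm_phi_op_le: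
  assumes K: "H.mat_bdd (\<lambda>v w. blinfun_apply (M v w)) K" and r: "0 \<le> r" "r < 1"
    and \<Phi>: "(block r has_sum \<Phi>) (multi_ints k)"
  shows "norm \<Phi> \<le> K"
proof (rule H.norm_le_mat_bdd[OF phi_op_bop[OF \<Phi>]])
  have "r\<^sup>2 \<le> 1" using r by (simp add: power_le_one)
  then show "H.mat_bdd (\<lambda>v w h. r ^ (\<Sum>i\<in>{1..k}. nat \<bar>int (length (w i)) - int (length (v i))\<bar>) *\<^sub>R M v w h) K"
    by (intro H.mat_bdd_powers[OF K, where d = "\<lambda>w i. length (w i)"])
      (simp_all add: blinfun.scaleR_right)
  fix v w h l assume "v \<in> W" "w \<in> W"
  then show "cinner (\<Phi> (ten h (e w))) (ten l (e v)) =
      cinner (r ^ (\<Sum>i\<in>{1..k}. nat \<bar>int (length (w i)) - int (length (v i))\<bar>) *\<^sub>R M v w h) l"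
    by (simp add: cinner_of_has_sum[OF has_sum_apply[OF \<Phi>]] cinner_scaleR_left weight_def deg_diff_def)
qed


subsection \<open>The series on polynomials\<close>

text \<open>The form in which (i) enters: for h = l the terms of its series are the squared norms of
  the entries of one column, and the incomparable rows add only zeros.\<close>

definition square_summable_columns :: bool
  where "square_summable_columns \<longleftrightarrow> (\<forall>w\<in>W. \<forall>h. (\<lambda>v. (norm (M v w h))\<^sup>2) summable_on W)"

lemma square_summable_columns_of_wot:
  "(\<forall>\<gamma>\<in>W. wot_summable_on
      (\<lambda>\<omega>. adj (C (cr_plus \<omega> \<gamma>) (cr_minus \<omega> \<gamma>)) o\<^sub>L C (cr_plus \<omega> \<gamma>) (cr_minus \<omega> \<gamma>))
      {\<omega> \<in> W. comparable_rc k \<omega> \<gamma>}) \<Longrightarrow> square_summable_columns"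
  unfolding square_summable_columns_def
proof (intro ballI allI)
  fix \<gamma> h
  let ?C = "\<lambda>\<omega>. C (cr_plus \<omega> \<gamma>) (cr_minus \<omega> \<gamma>)" and ?I = "{\<omega> \<in> W. comparable_rc k \<omega> \<gamma>}"
  assume \<gamma>: "\<gamma> \<in> W" and "\<forall>\<gamma>\<in>W. wot_summable_on
      (\<lambda>\<omega>. adj (C (cr_plus \<omega> \<gamma>) (cr_minus \<omega> \<gamma>)) o\<^sub>L C (cr_plus \<omega> \<gamma>) (cr_minus \<omega> \<gamma>))
      {\<omega> \<in> W. comparable_rc k \<omega> \<gamma>}"
  then have "wot_summable_on (\<lambda>\<omega>. adj (?C \<omega>) o\<^sub>L ?C \<omega>) ?I" by blast
  then obtain B where "((\<lambda>\<omega>. cinner ((adj (?C \<omega>) o\<^sub>L ?C \<omega>) h) h) has_sum cinner (blinfun_apply B h) h) ?I"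
    unfolding wot_summable_on_def by blast
  then have "((\<lambda>\<omega>. Re (cinner ((adj (?C \<omega>) o\<^sub>L ?C \<omega>) h) h)) has_sum Re (cinner (B h) h)) ?I"
    by (rule has_sum_Re)
  then have "((\<lambda>\<omega>. (norm (M \<omega> \<gamma> h))\<^sup>2) has_sum Re (cinner (B h) h)) W"
  proof (rule has_sum_cong_neutral[THEN iffD1, rotated -1])
    fix \<omega> assume "\<omega> \<in> ?I \<inter> W"
    then have \<omega>: "\<omega> \<in> W" "M \<omega> \<gamma> = ?C \<omega>" by (simp_all add: M_def)
    then have "?C \<omega> \<in> bop" using M_bop[OF _ \<gamma>, of \<omega>] by simp
    then have "cinner ((adj (?C \<omega>) o\<^sub>L ?C \<omega>) h) h = cinner (?C \<omega> h) (?C \<omega> h)"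
      by (simp flip: cinner_adj')
    then show "Re (cinner ((adj (?C \<omega>) o\<^sub>L ?C \<omega>) h) h) = (norm (M \<omega> \<gamma> h))\<^sup>2"
      by (simp add: \<omega>(2) cinner_self)
  qed (auto simp: M_def)
  then show "(\<lambda>\<omega>. (norm (M \<omega> \<gamma> h))\<^sup>2) summable_on W" by (auto simp: summable_on_def)
qed

lemma block_vec_has_sum:
  assumes col: square_summable_columns and w: "w \<in> W" and r: "0 \<le> r" "r \<le> 1"
  shows "\<exists>x. ((\<lambda>m. block r m (ten h (e w))) has_sum x) (multi_ints k)"
proof -
  define a where "a v = r ^ wt v w *\<^sub>R M v w h" for v
  let ?V = "\<lambda>v. ten (a v) (e v)"
  have "(\<lambda>v. (norm (a v))\<^sup>2) summable_on W"
  proof (rule summable_on_comparison_test)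
    show "(\<lambda>v. (norm (M v w h))\<^sup>2) summable_on W"
      using col w unfolding square_summable_columns_def by blast
    show "(norm (a v))\<^sup>2 \<le> (norm (M v w h))\<^sup>2" for v
      using r by (intro power_mono) (auto simp: a_def power_le_one mult_left_le_one_le)
  qed simp
  then obtain x where "(?V has_sum x) W"
    using H.summable_on_V summable_on_def by blast
  \<comment> \<open>Every row has exactly one multidegree relative to w, and only finitely many rows
    share it, so each group is a finite sum and equals a block applied to the vector.\<close>
  moreover have "bij_betw snd (SIGMA m:multi_ints k. {v \<in> W. deg_diff v w = m}) W"
    by (rule bij_betwI[where g = "\<lambda>v. (deg_diff v w, v)"]) (auto simp: deg_diff_multi_ints w)
  ultimately have "((\<lambda>p. ?V (snd p)) has_sum x) (SIGMA m:multi_ints k. {v \<in> W. deg_diff v w = m})"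
    by (simp add: has_sum_reindex_bij_betw[of snd _ W ?V])
  then have "((\<lambda>m. block r m (ten h (e w))) has_sum x) (multi_ints k)"
  proof (rule has_sum_SigmaD)
    fix m assume m: "m \<in> multi_ints k"
    let ?G = "{v \<in> W. deg_diff v w = m}"
    have "block r m (ten h (e w)) = (\<Sum>v\<in>?G. ?V v)"
    proof (rule H.hilbert_sum_eqI)
      fix u l assume u: "u \<in> W"
      have "cinner (\<Sum>v\<in>?G. ?V v) (ten l (e u)) = (\<Sum>v\<in>?G. if v = u then cinner (a u) l else 0)"
        unfolding cinner_sum_left
        by (intro sum.cong refl) (use u in \<open>auto simp: H.cinner_V\<close>)
      also have "\<dots> = (if deg_diff u w = m then cinner (a u) l else 0)"
        using u by (simp add: finite_deg_diff)
      finally show "cinner (block r m (ten h (e w))) (ten l (e u)) = cinner (\<Sum>v\<in>?G. ?V v) (ten l (e u))"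
        by (simp add: cinner_block[OF m u w] a_def cinner_scaleR_left)
    qed
    then show "((\<lambda>v. ?V (snd (m, v))) has_sum block r m (ten h (e w))) ?G"
      by (simp add: has_sum_finite_iff finite_deg_diff)
  qed
  then show ?thesis by blast
qed

lemma phi_vec_eqI:
  "((\<lambda>m. block r m p) has_sum x) (multi_ints k) \<Longrightarrow> phi_vec k n e ten C r p = x"
  unfolding phi_vec_def by (rule iter_sums_eq_multi_ints)

lemma phi_vec_polynomial:
  assumes col: square_summable_columns and r: "0 \<le> r" "r \<le> 1" and F: "finite F" "F \<subseteq> W"
  shows "((\<lambda>m. block r m (\<Sum>w\<in>F. ten (x w) (e w))) has_sum
      phi_vec k n e ten C r (\<Sum>w\<in>F. ten (x w) (e w))) (multi_ints k)"
    and "cinner (phi_vec k n e ten C r (\<Sum>w\<in>F. ten (x w) (e w))) (\<Sum>v\<in>F. ten (y v) (e v)) =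
      (\<Sum>w\<in>F. \<Sum>v\<in>F. of_real (r ^ wt v w) * cinner (M v w (x w)) (y v))"
proof -
  have "\<forall>w\<in>F. \<exists>z. ((\<lambda>m. block r m (ten (x w) (e w))) has_sum z) (multi_ints k)"
    using block_vec_has_sum[OF col _ r] F by blast
  then obtain z where z: "\<And>w. w \<in> F \<Longrightarrow> ((\<lambda>m. block r m (ten (x w) (e w))) has_sum z w) (multi_ints k)"
    by metis
  have s: "((\<lambda>m. block r m (\<Sum>w\<in>F. ten (x w) (e w))) has_sum (\<Sum>w\<in>F. z w)) (multi_ints k)"
    unfolding blinfun.sum_right by (rule has_sum_sum_index[OF z])
  note eq = phi_vec_eqI[OF s]
  show "((\<lambda>m. block r m (\<Sum>w\<in>F. ten (x w) (e w))) has_sum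
      phi_vec k n e ten C r (\<Sum>w\<in>F. ten (x w) (e w))) (multi_ints k)"
    unfolding eq by (rule s)
  show "cinner (phi_vec k n e ten C r (\<Sum>w\<in>F. ten (x w) (e w))) (\<Sum>v\<in>F. ten (y v) (e v)) =
      (\<Sum>w\<in>F. \<Sum>v\<in>F. of_real (r ^ wt v w) * cinner (M v w (x w)) (y v))"
    unfolding eq
    by (subst cinner_sum_left, rule sum.cong[OF refl], subst cinner_sum_right, rule sum.cong[OF refl])
      (rule cinner_of_has_sum[OF z], use F in auto)
qed

lemma polynomialE:
  assumes "p \<in> polynomials k n e ten"
  obtains F x where "finite F" "F \<subseteq> W" "p = (\<Sum>w\<in>F. ten (x w) (e w))"
  using assms unfolding polynomials_def by blast

lemma polynomialI: "finite F \<Longrightarrow> F \<subseteq> W \<Longrightarrow> (\<Sum>w\<in>F. ten (x w) (e w)) \<in> polynomials k n e ten"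
  unfolding polynomials_def by blast

lemma polynomial_scaleR:
  assumes "p \<in> polynomials k n e ten"
  shows "c *\<^sub>R p \<in> polynomials k n e ten"
proof -
  obtain F x where "finite F" "F \<subseteq> W" "p = (\<Sum>w\<in>F. ten (x w) (e w))"
    using assms by (rule polynomialE)
  then have "c *\<^sub>R p = (\<Sum>w\<in>F. ten (c *\<^sub>R x w) (e w))"
    by (simp add: scaleR_sum_right H.V_scaleR)
  then show ?thesis using polynomialI[of F "\<lambda>w. c *\<^sub>R x w"] \<open>finite F\<close> \<open>F \<subseteq> W\<close> by simp
qed

lemma zero_polynomial: "0 \<in> polynomials k n e ten"
  using polynomialI[of "{}"] by simp

text \<open>Passing from the unit ball to all polynomials by rescaling. Here f is only known to be
  homogeneous on polynomials, so the usual operator norm inequality does not apply.\<close>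

lemma polynomial_bound:
  fixes f :: "'h \<Rightarrow> 'h"
  assumes hom: "\<And>p c. p \<in> polynomials k n e ten \<Longrightarrow> f (c *\<^sub>R p) = c *\<^sub>R f p"
    and K: "\<And>p. p \<in> polynomials k n e ten \<Longrightarrow> norm p \<le> 1 \<Longrightarrow> norm (f p) \<le> K"
    and p: "p \<in> polynomials k n e ten"
  shows "norm (f p) \<le> K * norm p"
proof (cases "p = 0")
  case True
  then show ?thesis using hom[OF p, of 0] by simp
next
  case False
  then have "norm (f ((1 / norm p) *\<^sub>R p)) \<le> K"
    by (intro K polynomial_scaleR p) simp
  then show ?thesis using False by (simp add: hom[OF p] divide_le_eq)
qed

lemma phi_vec_scaleR:
  assumes col: square_summable_columns and r: "0 \<le> r" "r \<le> 1" and p: "p \<in> polynomials k n e ten"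
  shows "phi_vec k n e ten C r (c *\<^sub>R p) = c *\<^sub>R phi_vec k n e ten C r p"
proof -
  obtain F x where F: "finite F" "F \<subseteq> W" and p_eq: "p = (\<Sum>w\<in>F. ten (x w) (e w))"
    using p by (rule polynomialE)
  have "((\<lambda>m. block r m p) has_sum phi_vec k n e ten C r p) (multi_ints k)"
    unfolding p_eq by (rule phi_vec_polynomial(1)[OF col r F])
  then have "((\<lambda>m. c *\<^sub>R block r m p) has_sum c *\<^sub>R phi_vec k n e ten C r p) (multi_ints k)"
    by (rule has_sum_bounded_linear[OF bounded_linear_scaleR_right])
  then show ?thesis
    by (intro phi_vec_eqI) (simp add: blinfun.scaleR_right)
qed

lemma multi_toeplitz_exists:
  assumes col: square_summable_columns
    and K: "\<And>r p. 0 \<le> r \<Longrightarrow> r < 1 \<Longrightarrow> p \<in> polynomials k n e ten \<Longrightarrow> norm p \<le> 1 \<Longrightarrow>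
      norm (phi_vec k n e ten C r p) \<le> K"
  shows "\<exists>A. multi_toeplitz k n e ten A \<and> is_fourier_series k n e ten C A"
proof -
  have K0: "0 \<le> K"
    using order_trans[OF norm_ge_zero K[OF order_refl zero_less_one zero_polynomial]] by simp
  have "H.mat_bdd (\<lambda>v w. blinfun_apply (M v w)) K"
    unfolding H.mat_bdd_def
  proof (intro conjI allI impI K0)
    fix F x y assume F: "finite F" "F \<subseteq> W"
    let ?g = "\<lambda>r. \<Sum>w\<in>F. \<Sum>v\<in>F. of_real (r ^ wt v w) * cinner (M v w (x w)) (y v)"
    let ?x = "\<Sum>w\<in>F. ten (x w) (e w)" and ?y = "\<Sum>w\<in>F. ten (y w) (e w)"
    let ?K = "K * (L2_set (\<lambda>w. norm (x w)) F * L2_set (\<lambda>w. norm (y w)) F)"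
    have le: "cmod (?g r) \<le> ?K" if r: "0 \<le> r" "r < 1" for r
    proof -
      have r1: "r \<le> 1" using r by simp
      have "cmod (?g r) = cmod (cinner (phi_vec k n e ten C r ?x) ?y)"
        by (simp only: phi_vec_polynomial(2)[OF col r(1) r1 F])
      also have "\<dots> \<le> norm (phi_vec k n e ten C r ?x) * norm ?y" by (rule norm_cinner_le)
      also have "\<dots> \<le> (K * norm ?x) * norm ?y"
        by (intro mult_right_mono polynomial_bound[where f = "phi_vec k n e ten C r"]
            phi_vec_scaleR[OF col r(1) r1] K r polynomialI F) auto
      finally show ?thesis by (simp add: H.norm_sum_V_L2[OF F] mult.assoc)
    qed
    \<comment> \<open>For fixed F, x and y this is the modulus of a polynomial in r, so its limit at
      1 is the undamped section and no exchange of limits takes place.\<close>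
    have "((\<lambda>r. cmod (?g r)) \<longlongrightarrow> cmod (?g 1)) (at_left 1)"
      by (intro tendsto_intros)
    moreover have "eventually (\<lambda>r. cmod (?g r) \<le> ?K) (at_left 1)"
      using eventually_at_left_real[of 0 1] by (rule eventually_mono) (use le in auto)
    ultimately have "cmod (?g 1) \<le> ?K" by (rule tendsto_upperbound) simp
    then show "cmod (\<Sum>w\<in>F. \<Sum>v\<in>F. cinner (M v w (x w)) (y v)) \<le> ?K" by simp
  qed
  moreover have "(\<lambda>v. ten (M v w h) (e v)) summable_on W" if "w \<in> W" for w h
    using col that unfolding square_summable_columns_def by (intro H.summable_on_V) blast
  ultimately have "\<exists>A\<in>bop. \<forall>v\<in>W. \<forall>w\<in>W. \<forall>h l.
      cinner (blinfun_apply A (ten h (e w))) (ten l (e v)) = cinner (M v w h) l"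
    by (intro H.op_of_mat_exists M_bop)
  then show ?thesis unfolding toeplitz_fourier_iff by blast
qed

end

subsection \<open>Membership in the span of products\<close>

context polyball_space
begin

definition left_word :: "mword \<Rightarrow> 'f \<Rightarrow>\<^sub>L 'f"
  where "left_word \<alpha> = op_prod (map (\<lambda>i. left_creation_word k n e i (\<alpha> i)) [1..<Suc k])"

lemma left_word_polyball_algebra:
  assumes \<alpha>: "\<alpha> \<in> W"
  shows "left_word \<alpha> \<in> polyball_algebra k n e"
  unfolding polyball_algebra_def hull_def
proof (rule InterI, clarify)
  fix U assume U: "closed_operator_algebra U"
    and sub: "insert id_blinfun {left_creation k n e i j |i j. i \<in> {1..k} \<and> j \<in> {1..n i}} \<subseteq> U"
  have id: "id_blinfun \<in> U" using sub by blast
  have gen: "left_creation k n e i j \<in> U" if "i \<in> {1..k}" "j \<in> {1..n i}" for i j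
    using sub that by blast
  have "left_creation_word k n e i (\<alpha> i) \<in> U" if i: "i \<in> {1..k}" for i
    unfolding left_creation_word_def
  proof (rule op_prod_mem[OF U id])
    show "set (map (left_creation k n e i) (\<alpha> i)) \<subseteq> U"
      unfolding set_map using gen[OF i] mwords_letters[OF \<alpha> i] by blast
  qed
  then show "left_word \<alpha> \<in> U"
    unfolding left_word_def by (intro op_prod_mem[OF U id]) auto
qed

lemma
  assumes X: "X \<in> bop" and \<alpha>: "\<alpha> \<in> W"
  shows left_tensor_bop: "op_tensor ten X (left_word \<alpha>) \<in> bop"
    and left_tensor: "w \<in> W \<Longrightarrow> op_tensor ten X (left_word \<alpha>) (ten h (e w)) = ten (X h) (e (\<lambda>i. \<alpha> i @ w i))"
proof -
  let ?f = "\<lambda>w i. \<alpha> i @ w i"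
  have "left_creation_word k n e i (\<alpha> i) \<in> bop" if "i \<in> {1..k}" for i
    by (rule left_creation_word_bop[OF that mwords_letters[OF \<alpha> that]])
  then have Y: "left_word \<alpha> \<in> bop"
    unfolding left_word_def by (intro op_prod_bop) auto
  have im: "?f ` W \<subseteq> W" using mwords_appendI[OF \<alpha>] by blast
  have inj: "inj_on ?f W" by (rule inj_onI) (simp add: fun_eq_iff)
  have e: "left_word \<alpha> (e w) = (if w \<in> W then 1 *\<^sub>R e (?f w) else 0)" if w: "w \<in> W" for w
  proof -
    have ks: "set [1..<Suc k] = {1..k}" "distinct [1..<Suc k]" by auto
    have "(\<lambda>i. if i \<in> set [1..<Suc k] then \<alpha> i @ w i else w i) = ?f w"
      unfolding ks using mwords_outside[OF \<alpha>] by auto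
    then have "left_word \<alpha> (e w) = e (?f w)"
      unfolding left_word_def by (simp only: left_products_e[OF \<alpha> w eq_refl[OF ks(1)] ks(2)])
    then show ?thesis using w by simp
  qed
  show "op_tensor ten X (left_word \<alpha>) \<in> bop"
    by (rule op_tensor_shift(1)[OF X Y order_refl inj im e])
  show "op_tensor ten X (left_word \<alpha>) (ten h (e w)) = ten (X h) (e (?f w))" if "w \<in> W"
    using op_tensor_shift(2)[OF X Y order_refl inj im e, of h "e w"] e[OF that] that by simp
qed

lemma left_tensor_min_tensor:
  assumes "X \<in> bop" "\<alpha> \<in> W"
  shows "op_tensor ten X (left_word \<alpha>) \<in> min_tensor ten bop (polyball_algebra k n e)"
proof -
  have "op_tensor ten X (left_word \<alpha>) \<in> {op_tensor ten X Y |X Y. X \<in> bop \<and> Y \<in> polyball_algebra k n e}"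
    using assms left_word_polyball_algebra by blast
  then show ?thesis
    unfolding min_tensor_def by (meson closure_subset complex_vector.span_base subsetD)
qed

text \<open>At every index one of \<open>\<alpha>\<close>, \<open>\<beta>\<close> is trivial, so \<open>S\<^sub>\<alpha> S\<^sub>\<beta>\<^sup>* = S\<^sub>\<beta>\<^sup>* S\<^sub>\<alpha>\<close>.\<close>

lemma monomial_eq_adj_product:
  assumes X: "X \<in> bop" and p: "(\<alpha>, \<beta>) \<in> word_pairs k n m"
  shows "op_tensor ten X (r *\<^sub>R creation_monomial k n e \<alpha> \<beta>) =
    adj (op_tensor ten id_blinfun (left_word \<beta>)) o\<^sub>L op_tensor ten (r *\<^sub>R X) (left_word \<alpha>)"
proof -
  have \<alpha>: "\<alpha> \<in> W" and \<beta>: "\<beta> \<in> W" using p unfolding word_pairs_def by auto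
  have nil: "\<alpha> i = [] \<or> \<beta> i = []" for i
  proof (cases "i \<in> {1..k}")
    case True
    then have "int (length (\<alpha> i)) = max (- m i) 0" "int (length (\<beta> i)) = max (m i) 0"
      using p unfolding word_pairs_def by auto
    then show ?thesis by (cases "m i \<ge> 0") auto
  qed (use mwords_outside[OF \<alpha>] in blast)
  have rX: "r *\<^sub>R X \<in> bop" using X by blast
  have f: "op_tensor ten id_blinfun (left_word \<beta>) \<in> bop" by (rule left_tensor_bop[OF bop_id \<beta>])
  show ?thesis
  proof (rule H.bop_eqI_entries)
    show "op_tensor ten X (r *\<^sub>R creation_monomial k n e \<alpha> \<beta>) \<in> bop"
      by (rule op_tensor_monomial_bop[OF X \<alpha> \<beta>])
    show "adj (op_tensor ten id_blinfun (left_word \<beta>)) o\<^sub>L op_tensor ten (r *\<^sub>R X) (left_word \<alpha>) \<in> bop"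
      by (intro bop_compose adj_bop f left_tensor_bop[OF rX \<alpha>])
    fix v w h l assume v: "v \<in> W" and w: "w \<in> W"
    \<comment> \<open>The right side compares the images of w under S_\<alpha> and of v under
      S_\<beta>. If \<beta> i is empty both sides say the same; if \<alpha> i is empty both say that
      w i is \<beta> i followed by v i.\<close>
    have pt: "prefix (\<beta> i) (w i) \<and> \<alpha> i @ drop (length (\<beta> i)) (w i) = v i \<longleftrightarrow> \<alpha> i @ w i = \<beta> i @ v i" for i
      using nil[of i] by (auto simp: prefix_def)
    have iff: "word_acts \<beta> w \<and> word_act \<alpha> \<beta> w = v \<longleftrightarrow> (\<lambda>i. \<alpha> i @ w i) = (\<lambda>i. \<beta> i @ v i)"
      unfolding word_acts_def word_act_def fun_eq_iff all_conj_distrib[symmetric] pt ..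
    have "cinner (creation_monomial k n e \<alpha> \<beta> (e w)) (e v) =
        (if word_acts \<beta> w \<and> word_act \<alpha> \<beta> w = v then 1 else 0)"
      using v word_act_mwords[OF \<alpha> w, of \<beta>] by (simp add: creation_monomial_e[OF \<alpha> \<beta> w] cinner_e)
    also have "\<dots> = cinner (e (\<lambda>i. \<alpha> i @ w i)) (e (\<lambda>i. \<beta> i @ v i))"
      unfolding iff using mwords_appendI[OF \<alpha> w] mwords_appendI[OF \<beta> v] by (simp add: cinner_e)
    finally have eq: "cinner (creation_monomial k n e \<alpha> \<beta> (e w)) (e v) =
        cinner (e (\<lambda>i. \<alpha> i @ w i)) (e (\<lambda>i. \<beta> i @ v i))" .
    show "cinner (op_tensor ten X (r *\<^sub>R creation_monomial k n e \<alpha> \<beta>) (ten h (e w))) (ten l (e v)) =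
      cinner ((adj (op_tensor ten id_blinfun (left_word \<beta>)) o\<^sub>L op_tensor ten (r *\<^sub>R X) (left_word \<alpha>))
        (ten h (e w))) (ten l (e v))"
      by (simp add: op_tensor_monomial[OF X \<alpha> \<beta>] cinner_adj'[OF f, symmetric] cinner_ten eq
          left_tensor[OF rX \<alpha> w] left_tensor[OF bop_id \<beta> v] cinner_scaleR_left blinfun.scaleR_left)
  qed
qed

end

context polyball_series
begin

text \<open>Every block is a finite sum of products f^* g with f = I \<otimes> S_\<beta> and with g
  carrying both the coefficient and the power of r. The closure of their span contains the sum of
  the blocks.\<close>

lemma phi_op_mem_closure_span:
  assumes "(block r has_sum \<Phi>) (multi_ints k)"
  shows "\<Phi> \<in> closure (cspan {adj f o\<^sub>L g |f g.
      f \<in> min_tensor ten bop (polyball_algebra k n e) \<and>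
      g \<in> min_tensor ten bop (polyball_algebra k n e)})" (is "_ \<in> closure (cspan ?S)")
proof (rule closed_has_sum_mem[OF assms])
  show "block r m \<in> closure (cspan ?S)" if m: "m \<in> multi_ints k" for m
  proof -
    have "block r m \<in> cspan ?S"
      unfolding phi_block_def
    proof (rule complex_vector.span_sum, clarify)
      fix \<alpha> \<beta> assume p: "(\<alpha>, \<beta>) \<in> word_pairs k n m"
      let ?r = "r ^ (\<Sum>i=1..k. length (\<alpha> i) + length (\<beta> i))"
      have C: "C \<alpha> \<beta> \<in> bop" "?r *\<^sub>R C \<alpha> \<beta> \<in> bop" using C_bopD[OF m p] by auto
      have "adj (op_tensor ten id_blinfun (left_word \<beta>)) o\<^sub>L op_tensor ten (?r *\<^sub>R C \<alpha> \<beta>) (left_word \<alpha>) \<in> ?S"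
        using left_tensor_min_tensor[OF bop_id, of \<beta>] left_tensor_min_tensor[OF C(2), of \<alpha>]
          word_pairs_mwords[OF p] by blast
      then show "op_tensor ten (C \<alpha> \<beta>) (?r *\<^sub>R creation_monomial k n e \<alpha> \<beta>) \<in> cspan ?S"
        unfolding monomial_eq_adj_product[OF C(1) p] by (rule complex_vector.span_base)
    qed
    then show ?thesis by (meson closure_subset subsetD)
  qed
qed (auto intro: zero_mem_closure_cspan add_mem_closure_cspan)


subsection \<open>The series of a multi-Toeplitz operator\<close>

context
  fixes A :: "'h \<Rightarrow>\<^sub>L 'h"
  assumes A: "A \<in> bop"
    and entries: "\<forall>v\<in>W. \<forall>w\<in>W. \<forall>h l. cinner (A (ten h (e w))) (ten l (e v)) = cinner (M v w h) l"
begin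

lemma mat_bdd_M: "H.mat_bdd (\<lambda>v w. blinfun_apply (M v w)) (norm A)"
  by (rule H.mat_bdd_entries) (use entries in blast)

lemma coord_A: "v \<in> W \<Longrightarrow> w \<in> W \<Longrightarrow> H.coord v (A (ten h (e w))) = M v w h"
  by (rule cinner_eqI) (use entries in \<open>simp flip: H.cinner_V_right\<close>)

lemma square_summable_columns_A: square_summable_columns
  unfolding square_summable_columns_def
proof (intro ballI allI)
  fix w h assume w: "w \<in> W"
  show "(\<lambda>v. (norm (M v w h))\<^sup>2) summable_on W"
    by (rule summable_on_cong[THEN iffD1, OF _ has_sum_imp_summable[OF H.parseval_norm[of "A (ten h (e w))"]]])
      (simp add: coord_A w)
qed

text \<open>The sum of the series is T^* T, where T is A restricted to the copy of \<open>'e\<close>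
  at \<gamma>; Parseval's identity for \<open>T h\<close> and \<open>T l\<close> is the required
  convergence.\<close>

lemma wot_summable_A:
  assumes \<gamma>: "\<gamma> \<in> W"
  shows "wot_summable_on
      (\<lambda>\<omega>. adj (C (cr_plus \<omega> \<gamma>) (cr_minus \<omega> \<gamma>)) o\<^sub>L C (cr_plus \<omega> \<gamma>) (cr_minus \<omega> \<gamma>))
      {\<omega> \<in> W. comparable_rc k \<omega> \<gamma>}"
  unfolding wot_summable_on_def
proof (intro bexI allI)
  let ?T = "A o\<^sub>L H.inj_op \<gamma>" and ?C = "\<lambda>\<omega>. C (cr_plus \<omega> \<gamma>) (cr_minus \<omega> \<gamma>)"
  have T: "?T \<in> bop" using A H.inj_op_bop[OF \<gamma>] by blast
  show "adj ?T o\<^sub>L ?T \<in> bop" using T adj_bop[OF T] by blast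
  fix h l
  have "((\<lambda>\<omega>. cinner (M \<omega> \<gamma> h) (M \<omega> \<gamma> l)) has_sum cinner (?T h) (?T l)) W"
    by (rule has_sum_cong[THEN iffD1, OF _ H.parseval])
      (simp add: coord_A \<gamma> H.inj_op_apply)
  then have "((\<lambda>\<omega>. cinner ((adj (?C \<omega>) o\<^sub>L ?C \<omega>) h) l) has_sum cinner (?T h) (?T l))
      {\<omega> \<in> W. comparable_rc k \<omega> \<gamma>}"
  proof (rule has_sum_cong_neutral[THEN iffD1, rotated -1])
    fix \<omega> assume "\<omega> \<in> W \<inter> {\<omega> \<in> W. comparable_rc k \<omega> \<gamma>}"
    then have \<omega>: "\<omega> \<in> W" "M \<omega> \<gamma> = ?C \<omega>" by (simp_all add: M_def)
    then have "?C \<omega> \<in> bop" using M_bop[OF _ \<gamma>, of \<omega>] by simp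
    then show "cinner (M \<omega> \<gamma> h) (M \<omega> \<gamma> l) = cinner ((adj (?C \<omega>) o\<^sub>L ?C \<omega>) h) l"
      by (simp add: \<omega>(2) flip: cinner_adj')
  qed (auto simp: M_def)
  then show "((\<lambda>\<omega>. cinner ((adj (?C \<omega>) o\<^sub>L ?C \<omega>) h) l) has_sum cinner ((adj ?T o\<^sub>L ?T) h) l)
      {\<omega> \<in> W. comparable_rc k \<omega> \<gamma>}"
    using cinner_adj'[OF T] by simp
qed

lemma phi_op_has_sum_A: "0 \<le> r \<Longrightarrow> r < 1 \<Longrightarrow> (block r has_sum phi_op k n e ten C r) (multi_ints k)"
  by (rule phi_op_has_sum[OF mat_bdd_M])

lemma norm_phi_op_le_A: "0 \<le> r \<Longrightarrow> r < 1 \<Longrightarrow> norm (phi_op k n e ten C r) \<le> norm A"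
  by (rule norm_phi_op_le[OF mat_bdd_M _ _ phi_op_has_sum_A])

lemma phi_vec_eq_phi_op: "0 \<le> r \<Longrightarrow> r < 1 \<Longrightarrow> phi_vec k n e ten C r p = phi_op k n e ten C r p"
  by (intro phi_vec_eqI has_sum_apply phi_op_has_sum_A)

text \<open>On a generator the series converges by square summability of the column, and comparing
  entries identifies its sum with the value of A. Linearity extends this to finite sums.\<close>

lemma phi_vec_one:
  assumes "p \<in> polynomials k n e ten"
  shows "phi_vec k n e ten C 1 p = A p"
proof -
  obtain F x where F: "finite F" "F \<subseteq> W" and p: "p = (\<Sum>w\<in>F. ten (x w) (e w))"
    using assms by (rule polynomialE)
  have base: "((\<lambda>m. block 1 m (ten h (e w))) has_sum A (ten h (e w))) (multi_ints k)" if w: "w \<in> W" for w h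
  proof -
    obtain z where z: "((\<lambda>m. block 1 m (ten h (e w))) has_sum z) (multi_ints k)"
      using block_vec_has_sum[OF square_summable_columns_A w, of 1] by auto
    have "z = A (ten h (e w))"
      by (rule H.hilbert_sum_eqI) (use entries in \<open>simp add: cinner_of_has_sum[OF z _ w] w\<close>)
    with z show ?thesis by simp
  qed
  show ?thesis
    unfolding p blinfun.sum_right
    by (rule phi_vec_eqI, unfold blinfun.sum_right, rule has_sum_sum_index, rule base)
      (use F in auto)
qed

lemma phi_op_tendsto_A: "((\<lambda>r. phi_op k n e ten C r x) \<longlongrightarrow> A x) (at_left 1)"
proof -
  \<comment> \<open>The value 0 outside [0, 1) keeps the bound by \<open>norm A\<close> valid for
    every real r.\<close>
  define T where "T r = (if 0 \<le> r \<and> r < 1 then phi_op k n e ten C r else 0)" for r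
  have "((\<lambda>r. T r x) \<longlongrightarrow> A x) (at_left 1)"
  proof (rule strong_limit_eq[where K = "norm A" and S = "{ten h (e w) |w h. w \<in> W}"])
    show "T r \<in> bop" for r
      unfolding T_def using phi_op_bop phi_op_has_sum_A by auto
    show "norm (T r) \<le> norm A" for r
      unfolding T_def using norm_phi_op_le_A by auto
    fix y assume "y \<in> {ten h (e w) |w h. w \<in> W}"
    then obtain w h where w: "w \<in> W" and y: "y = ten h (e w)" by blast
    show "((\<lambda>r. T r y) \<longlongrightarrow> A y) (at_left 1)"
    \<comment> \<open>On a column the damping multiplies the v-th coordinate by a power of r, which
      lies in [0, 1] and tends to 1 for each fixed v.\<close>
    proof (rule H.damped_tendsto)
      show "eventually (\<lambda>r. \<forall>v\<in>W. 0 \<le> r ^ wt v w \<and> r ^ wt v w \<le> 1 \<and>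
          H.coord v (T r y) = r ^ wt v w *\<^sub>R H.coord v (A y)) (at_left 1)"
        using eventually_at_left_one
      proof eventually_elim
        case (elim r)
        have "H.coord v (T r y) = r ^ wt v w *\<^sub>R H.coord v (A y)" if v: "v \<in> W" for v
        proof (rule cinner_eqI)
          fix l
          show "cinner (H.coord v (T r y)) l = cinner (r ^ wt v w *\<^sub>R H.coord v (A y)) l"
            using cinner_of_has_sum[OF has_sum_apply[OF phi_op_has_sum_A] v w] elim v w
            by (simp add: T_def y coord_A cinner_scaleR_left flip: H.cinner_V_right)
        qed
        then show ?case using elim by (auto simp: power_le_one)
      qed
      show "((\<lambda>r::real. r ^ wt v w) \<longlongrightarrow> 1) (at_left 1)" for v
      proof -
        have "((\<lambda>r::real. r ^ wt v w) \<longlongrightarrow> 1 ^ wt v w) (at_left 1)" by (intro tendsto_intros)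
        then show ?thesis by simp
      qed
    qed
  qed (simp, rule A, rule H.dense_V)
  then show ?thesis
    by (rule Lim_transform_eventually)
      (use eventually_at_left_one in \<open>rule eventually_mono, simp add: T_def\<close>)
qed

section \<open>The norm formulas\<close>

lemma norm_phi_op_tendsto: "((\<lambda>r. norm (phi_op k n e ten C r)) \<longlongrightarrow> norm A) (at_left 1)"
proof (rule order_tendstoI)
  fix a assume a: "norm A < a"
  show "eventually (\<lambda>r. norm (phi_op k n e ten C r) < a) (at_left 1)"
    using eventually_at_left_one
    by (rule eventually_mono) (auto intro: le_less_trans[OF norm_phi_op_le_A a])
next
  fix a assume a: "a < norm A"
  show "eventually (\<lambda>r. a < norm (phi_op k n e ten C r)) (at_left 1)"
  \<comment> \<open>Turning a bound by a on all vectors into a bound on the operator norm requires a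
    nonnegative a; a negative one lies below every norm.\<close>
  proof (cases "a < 0")
    case True
    then show ?thesis by (simp add: less_le_trans)
  next
    case False
    \<comment> \<open>Lower semicontinuity of the norm: one vector that witnesses a <
      \<open>norm A\<close> does the same for \<open>phi_op\<close> at all r close to 1, by strong
      convergence.\<close>
    have "\<exists>x. a * norm x < norm (A x)"
    proof (rule ccontr)
      assume "\<not> ?thesis"
      then have "norm A \<le> a" using False by (intro norm_blinfun_bound) (auto simp: not_less)
      with a show False by simp
    qed
    then obtain x where x: "a * norm x < norm (A x)" by blast
    have "eventually (\<lambda>r. a * norm x < norm (phi_op k n e ten C r x)) (at_left 1)"
      using order_tendstoD(1)[OF tendsto_norm[OF phi_op_tendsto_A] x] .
    then show ?thesis
    proof (rule eventually_mono)
      fix r assume "a * norm x < norm (phi_op k n e ten C r x)"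
      then have "a * norm x < norm (phi_op k n e ten C r) * norm x"
        using norm_blinfun less_le_trans by blast
      then show "a < norm (phi_op k n e ten C r)" by (simp add: mult_less_cancel_right)
    qed
  qed
qed

lemma norm_A_eq_SUP_phi_op: "ereal (norm A) = (SUP r\<in>{0..<1}. ereal (norm (phi_op k n e ten C r)))"
proof (rule antisym)
  show "ereal (norm A) \<le> (SUP r\<in>{0..<1}. ereal (norm (phi_op k n e ten C r)))"
  proof (rule tendsto_upperbound)
    show "((\<lambda>r. ereal (norm (phi_op k n e ten C r))) \<longlongrightarrow> ereal (norm A)) (at_left 1)"
      using norm_phi_op_tendsto by simp
    show "eventually (\<lambda>r. ereal (norm (phi_op k n e ten C r)) \<le>
        (SUP r\<in>{0..<1}. ereal (norm (phi_op k n e ten C r)))) (at_left 1)"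
      using eventually_at_left_one by (rule eventually_mono) (rule SUP_upper, simp)
  qed simp
  show "(SUP r\<in>{0..<1}. ereal (norm (phi_op k n e ten C r))) \<le> ereal (norm A)"
    by (rule SUP_least) (simp add: norm_phi_op_le_A)
qed

text \<open>The finite coordinate sums of x are polynomials converging to x, so the inequality
  passes to the limit by continuity of A.\<close>

lemma norm_le_polynomials:
  assumes K: "\<And>p. p \<in> polynomials k n e ten \<Longrightarrow> norm p \<le> 1 \<Longrightarrow> norm (A p) \<le> K"
  shows "norm A \<le> K"
proof (rule norm_blinfun_bound)
  show "0 \<le> K" using K[OF zero_polynomial] by (simp add: blinfun.zero_right)
  fix x
  let ?q = "\<lambda>F. \<Sum>w\<in>F. ten (H.coord w x) (e w)"
  show "norm (A x) \<le> K * norm x"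
  proof (rule tendsto_le)
    show "((\<lambda>F. norm (A (?q F))) \<longlongrightarrow> norm (A x)) (finite_subsets_at_top W)"
      by (intro tendsto_norm bounded_linear.tendsto[OF blinfun.bounded_linear_right]
          H.op_tendsto_coord_sum)
    show "((\<lambda>F. K * norm (?q F)) \<longlongrightarrow> K * norm x) (finite_subsets_at_top W)"
      by (intro tendsto_intros H.op_tendsto_coord_sum)
    show "eventually (\<lambda>F. norm (A (?q F)) \<le> K * norm (?q F)) (finite_subsets_at_top W)"
      by (rule eventually_finite_subsets_at_top_weakI, rule polynomial_bound)
        (simp_all add: K polynomialI blinfun.scaleR_right)
  qed simp
qed

lemma norm_A_eq_SUP_polynomials:
  "ereal (norm A) = (SUP q\<in>{q \<in> polynomials k n e ten. norm q \<le> 1}. ereal (norm (phi_vec k n e ten C 1 q)))"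
    (is "_ = ?s")
proof (rule antisym)
  have up: "ereal (norm (A q)) \<le> ?s" if "q \<in> polynomials k n e ten" "norm q \<le> 1" for q
    using that SUP_upper[of q "{q \<in> polynomials k n e ten. norm q \<le> 1}"
        "\<lambda>q. ereal (norm (phi_vec k n e ten C 1 q))"] by (simp add: phi_vec_one)
  have "0 \<le> ?s" using up[OF zero_polynomial] by (simp add: blinfun.zero_right zero_ereal_def)
  show "ereal (norm A) \<le> ?s"
  \<comment> \<open>A real supremum serves as the constant for polynomials; the value plus infinity
    makes the inequality trivial, and minus infinity is excluded by the zero polynomial.\<close>
  proof (cases ?s)
    case (real S)
    then have "norm A \<le> S" using up by (intro norm_le_polynomials) simp
    then show ?thesis using real by simp
  next
    case MInf
    then show ?thesis using \<open>0 \<le> ?s\<close> by simp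
  qed simp
  show "?s \<le> ereal (norm A)"
  proof (rule SUP_least)
    fix q assume q: "q \<in> {q \<in> polynomials k n e ten. norm q \<le> 1}"
    have "norm (A q) \<le> norm A * norm q" by (rule norm_blinfun)
    also have "\<dots> \<le> norm A" using q by (simp add: mult_left_le)
    finally show "ereal (norm (phi_vec k n e ten C 1 q)) \<le> ereal (norm A)"
      using q by (simp add: phi_vec_one)
  qed
qed

lemma SUP_phi_vec_finite:
  "(SUP r\<in>{0..<1}. SUP p\<in>{p \<in> polynomials k n e ten. norm p \<le> 1}.
    ereal (norm (phi_vec k n e ten C r p))) < \<infinity>"
proof -
  have "(SUP r\<in>{0..<1}. SUP p\<in>{p \<in> polynomials k n e ten. norm p \<le> 1}.
    ereal (norm (phi_vec k n e ten C r p))) \<le> ereal (norm A)"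
  proof (intro SUP_least)
    fix r :: real and p assume r: "r \<in> {0..<1}" and p: "p \<in> {p \<in> polynomials k n e ten. norm p \<le> 1}"
    have "norm (phi_op k n e ten C r p) \<le> norm (phi_op k n e ten C r) * norm p" by (rule norm_blinfun)
    also have "\<dots> \<le> norm A * 1"
      using r p by (intro mult_mono norm_phi_op_le_A) auto
    finally show "ereal (norm (phi_vec k n e ten C r p)) \<le> ereal (norm A)"
      using r by (simp add: phi_vec_eq_phi_op)
  qed
  then show ?thesis by (rule le_less_trans) simp
qed

end

end

theorem theorem1p5:
  fixes k :: nat and n :: "nat \<Rightarrow> nat"
    and e :: "mword \<Rightarrow> 'f::chilbert_space"
    and ten :: "'e::chilbert_space \<Rightarrow> 'f \<Rightarrow> 'h::chilbert_space"
    and C :: "mword \<Rightarrow> mword \<Rightarrow> 'e \<Rightarrow>\<^sub>L 'e"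
  assumes "k \<ge> 1" and "\<forall>i\<in>{1..k}. n i \<ge> 1"
    and "is_onb_on (mwords k n) e"
    and "is_hilbert_tensor ten"
    and "\<forall>m\<in>multi_ints k. \<forall>(\<alpha>, \<beta>)\<in>word_pairs k n m. C \<alpha> \<beta> \<in> bop"
  shows
    "((\<exists>A. multi_toeplitz k n e ten A \<and> is_fourier_series k n e ten C A) \<longleftrightarrow>
        (\<forall>\<gamma>\<in>mwords k n.
          wot_summable_on
            (\<lambda>\<omega>. adj (C (cr_plus \<omega> \<gamma>) (cr_minus \<omega> \<gamma>)) o\<^sub>L C (cr_plus \<omega> \<gamma>) (cr_minus \<omega> \<gamma>))
            {\<omega> \<in> mwords k n. comparable_rc k \<omega> \<gamma>}) \<and>
        (SUP r\<in>{0..<1}. SUP p\<in>{p \<in> polynomials k n e ten. norm p \<le> 1}.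
          ereal (norm (phi_vec k n e ten C r p))) < \<infinity>) \<and>
     (\<forall>A. multi_toeplitz k n e ten A \<and> is_fourier_series k n e ten C A \<longrightarrow>
        (\<forall>r\<in>{0..<1}.
          (\<forall>ks. distinct ks \<and> set ks = {1..k} \<longrightarrow>
            iter_sums ks (phi_block k n e ten C r) (phi_op k n e ten C r)) \<and>
          (phi_block k n e ten C r has_sum phi_op k n e ten C r) (multi_ints k) \<and>
          phi_op k n e ten C r \<in>
            closure (cspan {adj f o\<^sub>L g |f g.
              f \<in> min_tensor ten bop (polyball_algebra k n e) \<and>
              g \<in> min_tensor ten bop (polyball_algebra k n e)})) \<and>
        (\<forall>x. ((\<lambda>r. phi_op k n e ten C r x) \<longlongrightarrow> A x) (at_left 1)) \<and>
        ereal (norm A) = (SUP r\<in>{0..<1}. ereal (norm (phi_op k n e ten C r))) \<and>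
        ((\<lambda>r. norm (phi_op k n e ten C r)) \<longlongrightarrow> norm A) (at_left 1) \<and>
        ereal (norm A) = (SUP q\<in>{q \<in> polynomials k n e ten. norm q \<le> 1}.
          ereal (norm (phi_vec k n e ten C 1 q))))"
proof -
  interpret polyball_series k n e ten C
    by unfold_locales (rule assms)+
  let ?wot = "\<forall>\<gamma>\<in>mwords k n.
          wot_summable_on
            (\<lambda>\<omega>. adj (C (cr_plus \<omega> \<gamma>) (cr_minus \<omega> \<gamma>)) o\<^sub>L C (cr_plus \<omega> \<gamma>) (cr_minus \<omega> \<gamma>))
            {\<omega> \<in> mwords k n. comparable_rc k \<omega> \<gamma>}"
  let ?s = "SUP r\<in>{0..<1}. SUP p\<in>{p \<in> polynomials k n e ten. norm p \<le> 1}.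
          ereal (norm (phi_vec k n e ten C r p))"
  have "\<exists>A. multi_toeplitz k n e ten A \<and> is_fourier_series k n e ten C A" if wot: ?wot and s: "?s < \<infinity>"
  proof -
    have up: "ereal (norm (phi_vec k n e ten C r p)) \<le> ?s"
      if "0 \<le> r" "r < 1" "p \<in> polynomials k n e ten" "norm p \<le> 1" for r p
      by (rule SUP_upper2[of r], use that in simp, rule SUP_upper2[of p], use that in simp) simp
    \<comment> \<open>Any admissible pair shows that the supremum is not minus infinity; r = 0 and
      the zero polynomial are the simplest. Together with (ii) this makes it a real number.\<close>
    have "0 \<le> norm (phi_vec k n e ten C 0 0)" by simp
    then have "0 \<le> ?s"
      using order_trans[OF _ up[of 0 0]] zero_polynomial by (simp add: zero_ereal_def)
    then obtain K where "?s = ereal K" using s by (cases ?s) auto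
    then show ?thesis
      using multi_toeplitz_exists[OF square_summable_columns_of_wot[OF wot], of K] up by simp
  qed
  moreover have "?wot \<and> ?s < \<infinity>" if "multi_toeplitz k n e ten A \<and> is_fourier_series k n e ten C A" for A
    using that wot_summable_A SUP_phi_vec_finite unfolding toeplitz_fourier_iff by blast
  moreover have "(\<forall>r\<in>{0..<1}.
          (\<forall>ks. distinct ks \<and> set ks = {1..k} \<longrightarrow>
            iter_sums ks (phi_block k n e ten C r) (phi_op k n e ten C r)) \<and>
          (phi_block k n e ten C r has_sum phi_op k n e ten C r) (multi_ints k) \<and>
          phi_op k n e ten C r \<in>
            closure (cspan {adj f o\<^sub>L g |f g.
              f \<in> min_tensor ten bop (polyball_algebra k n e) \<and>
              g \<in> min_tensor ten bop (polyball_algebra k n e)})) \<and>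
        (\<forall>x. ((\<lambda>r. phi_op k n e ten C r x) \<longlongrightarrow> A x) (at_left 1)) \<and>
        ereal (norm A) = (SUP r\<in>{0..<1}. ereal (norm (phi_op k n e ten C r))) \<and>
        ((\<lambda>r. norm (phi_op k n e ten C r)) \<longlongrightarrow> norm A) (at_left 1) \<and>
        ereal (norm A) = (SUP q\<in>{q \<in> polynomials k n e ten. norm q \<le> 1}.
          ereal (norm (phi_vec k n e ten C 1 q)))"
    if "multi_toeplitz k n e ten A \<and> is_fourier_series k n e ten C A" for A
  proof -
    have A: "A \<in> bop" and entries: "\<forall>v\<in>W. \<forall>w\<in>W. \<forall>h l.
        cinner (A (ten h (e w))) (ten l (e v)) = cinner (M v w h) l"
      using that unfolding toeplitz_fourier_iff by blast+
    note hs = phi_op_has_sum_A[OF A entries]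
    have "\<forall>r\<in>{0..<1}.
          (\<forall>ks. distinct ks \<and> set ks = {1..k} \<longrightarrow>
            iter_sums ks (phi_block k n e ten C r) (phi_op k n e ten C r)) \<and>
          (phi_block k n e ten C r has_sum phi_op k n e ten C r) (multi_ints k) \<and>
          phi_op k n e ten C r \<in>
            closure (cspan {adj f o\<^sub>L g |f g.
              f \<in> min_tensor ten bop (polyball_algebra k n e) \<and>
              g \<in> min_tensor ten bop (polyball_algebra k n e)})"
    proof (intro ballI conjI allI impI)
      fix r :: real assume "r \<in> {0..<1}"
      then have r: "0 \<le> r" "r < 1" by auto
      show "iter_sums ks (phi_block k n e ten C r) (phi_op k n e ten C r)"
        if "distinct ks \<and> set ks = {1..k}" for ks
        using iter_sums_multi_ints[OF hs[OF r]] that by blast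
      show "(phi_block k n e ten C r has_sum phi_op k n e ten C r) (multi_ints k)" by (rule hs[OF r])
      show "phi_op k n e ten C r \<in>
            closure (cspan {adj f o\<^sub>L g |f g.
              f \<in> min_tensor ten bop (polyball_algebra k n e) \<and>
              g \<in> min_tensor ten bop (polyball_algebra k n e)})"
        by (rule phi_op_mem_closure_span[OF hs[OF r]])
    qed
    then show ?thesis
      using phi_op_tendsto_A[OF A entries] norm_A_eq_SUP_phi_op[OF A entries]
        norm_phi_op_tendsto[OF A entries] norm_A_eq_SUP_polynomials[OF A entries] by blast
  qed
  ultimately show ?thesis by blast
qed

end
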